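(* Let $r\in\mathbb R$ and let $v$ be a multiplier system on $\Gamma=\mathrm{SL}_2(\mathbb Z)$ corresponding to the weight $r$. (i) If $r\notin\mathbb Z_{\le0}$ there is a non-degenerate $\Gamma$-invariant bilinear form $[\cdot,\cdot]_r$ on ${}^+\mathcal D^{-\omega}_{v,r}\times{}^-\mathcal D^{\omega}_{v^{-1},r}$ given by $$[h,f]_r=\frac1\pi\int_{z\in C}h^+(z)\,\sigma_rf^-(z)\,\frac{dz}{(z+i)^2}.\qquad( * )$$ The cycle $C$ in $\mathfrak H$ is homotopic to $\mathbb P^1_{\mathbb R}$ in the domain of $\sigma_rf^-$ and encircles the point $i$ once in the positive direction. The value of the bilinear form does not change if we add to $\sigma_rf^-$ any holomorphic function on $\mathfrak H$. (ii) Let $r\notin\mathbb Z_{\le0}$. If $h\in{}^+\mathcal D^{-\infty}_{v,r}$ then the linear form $f\mapsto[h,f]_r$ on ${}^-\mathcal D^\omega_{v^{-1},r}$ extends continuously to ${}^-\mathcal D^\infty_{v^{-1},r}$ for the natural topology on ${}^-\mathcal D^\infty_{v^{-1},r}$. (iii) If $r\in\mathbb Z_{\le0}$, the relation $( * )$ defines a $\Gamma$-invariant bilinear form on ${}^+\mathcal D^{-\omega}_{v,r}\times{}^-\mathcal D^{\mathrm{pol}}_{v^{-1},r}$. Its restriction to ${}^+\mathcal D^{\mathrm{pol}}_{v,r}\times{}^-\mathcal D^{\mathrm{pol}}_{v^{-1},r}$ is non-degenerate. (iv) In terms of the expansions $$h^+(z)=\sum_{n\ge0}c_n\Bigl(\frac{z-i}{z+i}\Bigr)^n,\qquad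 f^-(z)=\sum_{m\le0}d_m\Bigl(\frac{z-i}{z+i}\Bigr)^m,$$ with $d_m=0$ for $m<-|r|$ if $r\in\mathbb Z_{\le0}$, the duality is given by $$[h,f]_r=\sum_{n\ge0}\frac{n!}{(r)_n}\,c_n\,d_{-n}.$$
   Context: $\mathfrak H$, $\mathfrak H^-$ are the upper and lower half-planes; $\mathbb P^1_{\mathbb R}=\mathbb R\cup\{\infty\}\subset\mathbb P^1_{\mathbb C}$; $(r)_n$ is the Pochhammer symbol. In (iv), for $r\in\mathbb Z_{\le0}$ the terms with $n>|r|$, for which $d_{-n}=0$, are understood to be absent. Powers of numbers in $\mathfrak H$ or $\mathfrak H^-$ use the principal argument. Multiplier systems corresponding to weight $r\in\mathbb R$ are the functions $v=v[p]$ with $p\in\mathbb R$, $p\equiv r\bmod2$, $v[p](\gamma)=\eta^{2p}(\gamma z)/\bigl((cz+d)^p\eta^{2p}(z)\bigr)$ for $\gamma=\begin{pmatrix}a&b\\c&d\end{pmatrix}\in\Gamma$, $\arg(cz+d)\in(-\pi,\pi]$, $\eta$ the Dedekind eta function. Right actions of $\Gamma$: on functions on $\mathfrak H$, $(h|_{v,r}\gamma)(z)=v(\gamma)^{-1}(cz+d)^{-r}h(\gamma z)$ with $\arg(cz+d)\in(-\pi,\pi]$; on functions on $\mathfrak H^-$, $(f|^-_{v^{-1},r}\gamma)(t)=v(\gamma)(ct+d)^{-r}f(\gamma t)$ with $\arg(ct+d)\in[-\pi,\pi)$. $\Gamma$-invariance of the form means $[h|_{v,r}\gamma,f|^-_{v^{-1},r}\gamma]_r=[h,f]_r$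 for all $\gamma\in\Gamma$. Put $h^+(z)=(-i-z)^rh(z)$ for $h$ on $\mathfrak H$ and $f^-(t)=(i-t)^rf(t)$ for $f$ on $\mathfrak H^-$. Modules: - ${}^+\mathcal D^{-\omega}_{v,r}$: all holomorphic $h$ on $\mathfrak H$, with action $|_{v,r}$. - ${}^+\mathcal D^{-\infty}_{v,r}$: those $h$ with $h^+(z)=O(|\mathrm{Im}\,z|^{-B})+O(|z|^B)$ on $\mathfrak H$ for some $B>0$. - ${}^-\mathcal D^\omega_{v^{-1},r}$: holomorphic $f$ on $\mathfrak H^-$ for which $f^-$ extends holomorphically to a neighborhood of $\mathfrak H^-\cup\mathbb P^1_{\mathbb R}$ in $\mathbb P^1_{\mathbb C}$, with action $|^-_{v^{-1},r}$. - ${}^-\mathcal D^\infty_{v^{-1},r}$: holomorphic $f$ on $\mathfrak H^-$ for which $f^-$ extends to a $C^\infty$ function on $\mathfrak H^-\cup\mathbb P^1_{\mathbb R}$. Natural topology: supremum norms on $\mathbb P^1_{\mathbb R}$ of all derivatives of $f^-$ with respect to $\theta\in\mathbb R/\pi\mathbb Z$, $t=-\cot\theta$. - If $r\in\mathbb Z_{\le0}$: ${}^+\mathcal D^{\mathrm{pol}}_{v,r}$ and ${}^-\mathcal D^{\mathrm{pol}}_{v^{-1},r}$ are the submodules of polynomial functions of degree at most $|r|$. The operator $\sigma_r$. For $r\notin\mathbb Z_{\le0}$ and $f\in{}^-\mathcal D^\omega_{v^{-1},r}$, $$\sigma_rf^-(z)=\frac1\pi\,\frac{z+i}{z-i}\int_{\tau\in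 C_1}f^-(\tau)\;{}_2F_1\Bigl(1,1;r;\frac{(\tau-i)(z+i)}{(\tau+i)(z-i)}\Bigr)\frac{d\tau}{\tau^2+1},$$ where $C_1$ is a positively oriented circle $\bigl|\frac{\tau-i}{\tau+i}\bigr|=c<1$ encircling $i$ and the complement of the domain of $f^-$, and $z$ is outside $C_1$. With $w=\frac{z-i}{z+i}$ it satisfies $\sigma_r(w^n)=\frac{|n|!}{(r)_{|n|}}w^{n-1}$ for integers $n\le0$. For $r\in\mathbb Z_{\le0}$, $\sigma_r$ is defined on the functions $f^-$ with $f\in{}^-\mathcal D^{\mathrm{pol}}_{v^{-1},r}$ (which are spanned by $w^n$, $r\le n\le0$) by the same formula $\sigma_r(w^n)=\frac{|n|!}{(r)_{|n|}}w^{n-1}$.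
   Formalization: In (iii), Γ-invariance is claimed only for polynomial h and f of degree at most |r|, not for all holomorphic h: as stated it fails, e.g. for r=0, f=1 the form is h(i), which is not invariant under z→z+1 for h(z)=z. *)

theory Defs
  imports "HOL-Complex_Analysis.Complex_Analysis"
begin

abbreviation upper_half :: "complex set" where
  "upper_half \<equiv> {z. Im z > 0}"

abbreviation lower_half :: "complex set" where
  "lower_half \<equiv> {z. Im z < 0}"


subsection \<open>The modular group and multiplier systems\<close>

definition SL2Z :: "(int ^ 2 ^ 2) set" where
  "SL2Z = {\<gamma>. det \<gamma> = 1}"

definition moebius_num :: "int ^ 2 ^ 2 \<Rightarrow> complex \<Rightarrow> complex" where
  "moebius_num \<gamma> z = of_int (\<gamma> $ 1 $ 1) * z + of_int (\<gamma> $ 1 $ 2)"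

definition moebius_den :: "int ^ 2 ^ 2 \<Rightarrow> complex \<Rightarrow> complex" where
  "moebius_den \<gamma> z = of_int (\<gamma> $ 2 $ 1) * z + of_int (\<gamma> $ 2 $ 2)"

definition moebius :: "int ^ 2 ^ 2 \<Rightarrow> complex \<Rightarrow> complex" where
  "moebius \<gamma> z = moebius_num \<gamma> z / moebius_den \<gamma> z"

text \<open>
  The power \<open>\<eta>\<^sup>s\<close> of the Dedekind eta function
  \<open>\<eta>(z) = e\<^bsup>\<pi>iz/12\<^esup> \<Prod>\<^bsub>n\<ge>1\<^esub> (1 - e\<^bsup>2\<pi>inz\<^esup>)\<close>, taken with the branch of
  \<open>log \<eta>\<close> that is holomorphic on the upper half-plane. It is not
  \<open>\<eta> z powr s\<close>, which is discontinuous. The principal powers of the factors are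
  holomorphic since \<open>1 - e\<^bsup>2\<pi>inz\<^esup>\<close> has positive real part.
\<close>
definition eta_power :: "real \<Rightarrow> complex \<Rightarrow> complex" where
  "eta_power s z =
     exp (of_real (pi * s) * \<i> * z / 12) *
     (\<Prod>n. (1 - exp (2 * of_real pi * \<i> * of_nat (Suc n) * z)) powr of_real s)"

text \<open>\<^const>\<open>powr\<close> on the complex numbers uses arguments in \<open>(-\<pi>, \<pi>]\<close>.\<close>
definition multiplier_system :: "real \<Rightarrow> (int ^ 2 ^ 2 \<Rightarrow> complex) \<Rightarrow> bool" where
  "multiplier_system r v \<longleftrightarrow>
     (\<exists>p. (\<exists>k::int. p = r + 2 * of_int k) \<and>
        (\<forall>\<gamma>\<in>SL2Z. \<forall>z\<in>upper_half.
           v \<gamma> = eta_power (2 * p) (moebius \<gamma> z) /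
                 (moebius_den \<gamma> z powr of_real p * eta_power (2 * p) z)))"

definition slash_plus ::
    "(int ^ 2 ^ 2 \<Rightarrow> complex) \<Rightarrow> real \<Rightarrow> int ^ 2 ^ 2 \<Rightarrow> (complex \<Rightarrow> complex) \<Rightarrow> complex \<Rightarrow> complex" where
  "slash_plus v r \<gamma> h z =
     inverse (v \<gamma>) * moebius_den \<gamma> z powr of_real (- r) * h (moebius \<gamma> z)"

text \<open>The power of \<open>x\<close> with arguments in \<open>[-\<pi>, \<pi>)\<close>.\<close>
definition powr_low :: "complex \<Rightarrow> real \<Rightarrow> complex" where
  "powr_low x s = cnj (cnj x powr of_real s)"

text \<open>This is the action for the multiplier system \<open>v\<^sup>-\<^sup>1\<close>, hence the factor \<open>v \<gamma>\<close>.\<close>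
definition slash_minus ::
    "(int ^ 2 ^ 2 \<Rightarrow> complex) \<Rightarrow> real \<Rightarrow> int ^ 2 ^ 2 \<Rightarrow> (complex \<Rightarrow> complex) \<Rightarrow> complex \<Rightarrow> complex" where
  "slash_minus v r \<gamma> f t = v \<gamma> * powr_low (moebius_den \<gamma> t) (- r) * f (moebius \<gamma> t)"


subsection \<open>The modules\<close>

text \<open>
  A function on a half-plane is represented by a function on \<^typ>\<open>complex\<close> whose values
  outside that half-plane are irrelevant.
\<close>

definition plus_fun :: "real \<Rightarrow> (complex \<Rightarrow> complex) \<Rightarrow> complex \<Rightarrow> complex" where
  "plus_fun r h z = (- \<i> - z) powr of_real r * h z"

definition minus_fun :: "real \<Rightarrow> (complex \<Rightarrow> complex) \<Rightarrow> complex \<Rightarrow> complex" where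
  "minus_fun r f t = (\<i> - t) powr of_real r * f t"

text \<open>Functions of class \<open>C\<^sup>\<infinity>\<close> in the sense of real analysis on an open subset of the plane;
  \<open>D i j\<close> is the partial derivative of order \<open>i\<close> in the real and \<open>j\<close> in the imaginary
  direction.\<close>
definition C_infinity_on :: "(complex \<Rightarrow> complex) \<Rightarrow> complex set \<Rightarrow> bool" where
  "C_infinity_on g U \<longleftrightarrow>
     (\<exists>D :: nat \<Rightarrow> nat \<Rightarrow> complex \<Rightarrow> complex. D 0 0 = g \<and>
        (\<forall>i j. \<forall>z\<in>U. (D i j has_derivative
            (\<lambda>x. Re x *\<^sub>R D (Suc i) j z + Im x *\<^sub>R D i (Suc j) z)) (at z)))"

text \<open>
  The function \<open>F\<close> on the lower half-plane extends to a function with the local property \<open>P\<close> on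
  an open neighbourhood, in the complex projective line, of the union of the lower half-plane and
  the real projective line. The neighbourhood is described in the two affine charts \<open>z\<close> and
  \<open>1/z\<close>: \<open>U\<close> is its part in the first chart and \<open>V\<close> a neighbourhood of infinity in the second
  one; \<open>g\<close> and \<open>k\<close> are the extension in these charts.
\<close>
definition extension_P1 ::
    "((complex \<Rightarrow> complex) \<Rightarrow> complex set \<Rightarrow> bool) \<Rightarrow> (complex \<Rightarrow> complex) \<Rightarrow>
     complex set \<Rightarrow> (complex \<Rightarrow> complex) \<Rightarrow> bool" where
  "extension_P1 P F U g \<longleftrightarrow>
     open U \<and> {t. Im t \<le> 0} \<subseteq> U \<and> P g U \<and> (\<forall>t\<in>lower_half. g t = F t) \<and>
     (\<exists>V k. open V \<and> 0 \<in> V \<and> P k V \<and> (\<forall>z\<in>U. z \<noteq> 0 \<and> 1 / z \<in> V \<longrightarrow> g z = k (1 / z)))"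

definition D_plus_neg_omega :: "(complex \<Rightarrow> complex) set" where
  "D_plus_neg_omega = {h. h holomorphic_on upper_half}"

definition D_plus_neg_infty :: "real \<Rightarrow> (complex \<Rightarrow> complex) set" where
  "D_plus_neg_infty r = {h \<in> D_plus_neg_omega. \<exists>B>0. \<exists>K. \<forall>z\<in>upper_half.
     norm (plus_fun r h z) \<le> K * (\<bar>Im z\<bar> powr (- B) + norm z powr B)}"

definition D_minus_omega :: "real \<Rightarrow> (complex \<Rightarrow> complex) set" where
  "D_minus_omega r = {f. f holomorphic_on lower_half \<and>
     (\<exists>U g. extension_P1 (holomorphic_on) (minus_fun r f) U g)}"

definition D_minus_infty :: "real \<Rightarrow> (complex \<Rightarrow> complex) set" where
  "D_minus_infty r = {f. f holomorphic_on lower_half \<and>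
     (\<exists>U g. extension_P1 C_infinity_on (minus_fun r f) U g)}"

definition D_plus_pol :: "real \<Rightarrow> (complex \<Rightarrow> complex) set" where
  "D_plus_pol r = {h. \<exists>q. real (degree q) \<le> \<bar>r\<bar> \<and> (\<forall>z\<in>upper_half. h z = poly q z)}"

definition D_minus_pol :: "real \<Rightarrow> (complex \<Rightarrow> complex) set" where
  "D_minus_pol r = {f. \<exists>q. real (degree q) \<le> \<bar>r\<bar> \<and> (\<forall>t\<in>lower_half. f t = poly q t)}"


subsection \<open>The natural topology on the smooth vectors\<close>

text \<open>
  The boundary value at \<open>t = - cot \<theta>\<close> of a function on the lower half-plane; the point is
  infinity if \<open>\<theta>\<close> is a multiple of \<open>\<pi>\<close>.
\<close>
definition boundary_value :: "(complex \<Rightarrow> complex) \<Rightarrow> real \<Rightarrow> complex" where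
  "boundary_value F \<theta> =
     (if sin \<theta> = 0 then Lim (inf at_infinity (principal lower_half)) F
      else Lim (at (of_real (- cot \<theta>)) within lower_half) F)"

definition boundary_seminorm :: "real \<Rightarrow> nat \<Rightarrow> (complex \<Rightarrow> complex) \<Rightarrow> real" where
  "boundary_seminorm r j f =
     (SUP \<theta>. norm (((\<lambda>\<phi> x. vector_derivative \<phi> (at x)) ^^ j) (boundary_value (minus_fun r f)) \<theta>))"

definition D_minus_infty_topology :: "real \<Rightarrow> (complex \<Rightarrow> complex) topology" where
  "D_minus_infty_topology r = topology_generated_by
     {{f \<in> D_minus_infty r. boundary_seminorm r j (\<lambda>t. f t - f\<^sub>0 t) < \<epsilon>} | f\<^sub>0 j \<epsilon>.
        f\<^sub>0 \<in> D_minus_infty r \<and> \<epsilon> > 0}"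


subsection \<open>The operator \<open>\<sigma>\<^sub>r\<close> and the duality\<close>

definition w_coord :: "complex \<Rightarrow> complex" where
  "w_coord z = (z - \<i>) / (z + \<i>)"

text \<open>The hyperbolic circle \<open>\<bar>w\<bar> = c\<close>, for \<open>0 < c < 1\<close>, written as a Euclidean circle.\<close>
definition w_circle :: "real \<Rightarrow> real \<Rightarrow> complex" where
  "w_circle c = circlepath (of_real ((1 + c\<^sup>2) / (1 - c\<^sup>2)) * \<i>) (2 * c / (1 - c\<^sup>2))"

lemma path_image_w_circle:
  assumes "0 < c" "c < 1"
  shows "path_image (w_circle c) = {z. norm (z - \<i>) = c * norm (z + \<i>)}"
proof -
  have c2: "0 < 1 - c\<^sup>2"
    using assms by (simp add: power_less_one_iff)
  have "dist (of_real ((1 + c\<^sup>2) / (1 - c\<^sup>2)) * \<i>) z = 2 * c / (1 - c\<^sup>2) \<longleftrightarrow>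
        norm (z - \<i>) = c * norm (z + \<i>)" for z :: complex
  proof -
    have "dist (of_real ((1 + c\<^sup>2) / (1 - c\<^sup>2)) * \<i>) z = 2 * c / (1 - c\<^sup>2) \<longleftrightarrow>
          (norm (of_real ((1 + c\<^sup>2) / (1 - c\<^sup>2)) * \<i> - z))\<^sup>2 = (2 * c / (1 - c\<^sup>2))\<^sup>2"
      using assms c2 unfolding dist_norm by (intro power_eq_iff_eq_base[symmetric]) auto
    also have "\<dots> \<longleftrightarrow> (Re z)\<^sup>2 + ((1 + c\<^sup>2) / (1 - c\<^sup>2) - Im z)\<^sup>2 = (2 * c / (1 - c\<^sup>2))\<^sup>2"
      by (simp only: cmod_power2) simp
    also have "\<dots> \<longleftrightarrow> (Re z)\<^sup>2 + (Im z - 1)\<^sup>2 = c\<^sup>2 * ((Re z)\<^sup>2 + (Im z + 1)\<^sup>2)"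
    proof -
      have "(1 - c\<^sup>2) * ((Re z)\<^sup>2 + ((1 + c\<^sup>2) / (1 - c\<^sup>2) - Im z)\<^sup>2 - (2 * c / (1 - c\<^sup>2))\<^sup>2) =
            (Re z)\<^sup>2 + (Im z - 1)\<^sup>2 - c\<^sup>2 * ((Re z)\<^sup>2 + (Im z + 1)\<^sup>2)"
        using c2 by (simp add: divide_simps power2_eq_square) algebra
      then show ?thesis
        using c2 by (metis eq_iff_diff_eq_0 less_irrefl mult_eq_0_iff)
    qed
    also have "\<dots> \<longleftrightarrow> (norm (z - \<i>))\<^sup>2 = (c * norm (z + \<i>))\<^sup>2"
      by (simp only: cmod_power2 power_mult_distrib) simp
    also have "\<dots> \<longleftrightarrow> norm (z - \<i>) = c * norm (z + \<i>)"
      using assms by (intro power_eq_iff_eq_base) auto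
    finally show ?thesis .
  qed
  then show ?thesis
    using assms c2 by (auto simp: w_circle_def sphere_def)
qed

text \<open>\<open>g\<close> is the extended function \<open>f\<^sup>-\<close>, and \<open>z\<close> lies outside the circle.\<close>
definition sigma_integral :: "real \<Rightarrow> real \<Rightarrow> (complex \<Rightarrow> complex) \<Rightarrow> complex \<Rightarrow> complex" where
  "sigma_integral r c g z =
     1 / of_real pi * ((z + \<i>) / (z - \<i>)) *
     contour_integral (w_circle c) (\<lambda>\<tau>. g \<tau> *
       eval_fps (fps_hypergeo [1, 1] [of_real r] 1) (((\<tau> - \<i>) * (z + \<i>)) / ((\<tau> + \<i>) * (z - \<i>)))
       / (\<tau>\<^sup>2 + 1))"

text \<open>The part \<open>\<bar>w\<bar> > c\<close> of the affine line. The point \<open>-\<i>\<close>, where \<open>w\<close> is infinite, belongs to it.\<close>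
definition w_exterior :: "real \<Rightarrow> complex set" where
  "w_exterior c = {z. c * norm (z + \<i>) < norm (z - \<i>)}"

text \<open>
  \<open>s\<close> represents \<open>\<sigma>\<^sub>r f\<^sup>-\<close> on \<open>\<bar>w\<bar> > c\<close>. In general every circle \<open>\<bar>w\<bar> = c\<close> around
  the complement of the domain \<open>U\<close> of some extension of \<open>f\<^sup>-\<close> is admitted. For \<open>r\<close> a
  non-positive integer, where \<open>f\<^sup>-\<close> is a combination of \<open>w\<^sup>n\<close> with \<open>r \<le> n \<le> 0\<close>, the domain is
  the complement of \<open>\<i>\<close>, i.e. \<open>c = 0\<close>.
\<close>
definition is_sigma :: "real \<Rightarrow> (complex \<Rightarrow> complex) \<Rightarrow> real \<Rightarrow> (complex \<Rightarrow> complex) \<Rightarrow> bool" where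
  "is_sigma r f c s \<longleftrightarrow>
     (if r \<in> \<int>\<^sub>\<le>\<^sub>0
      then c = 0 \<and> (\<exists>d :: int \<Rightarrow> complex.
        (\<forall>t\<in>lower_half. minus_fun r f t = (\<Sum>n\<in>{\<lceil>r\<rceil>..0}. d n * w_coord t powi n)) \<and>
        (\<forall>z\<in>w_exterior c. s z = (\<Sum>n\<in>{\<lceil>r\<rceil>..0}. d n *
           (fact (nat \<bar>n\<bar>) / pochhammer (of_real r) (nat \<bar>n\<bar>) * w_coord z powi (n - 1)))))
      else 0 < c \<and> c < 1 \<and> (\<exists>U g.
        extension_P1 (holomorphic_on) (minus_fun r f) U g \<and>
        {z. c * norm (z + \<i>) \<le> norm (z - \<i>)} \<subseteq> U \<and>
        (\<forall>z\<in>w_exterior c. s z = sigma_integral r c g z)))"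

text \<open>
  Cycles \<open>C\<close> in the upper half-plane homotopic to the real projective line in \<open>\<bar>w\<bar> > c\<close> and
  encircling \<open>\<i>\<close> once. Since the real projective line runs through infinity, the homotopy is
  written in the coordinate \<open>u = 1/w\<close>, in which it is the unit circle: \<open>t = - cot \<theta>\<close>
  corresponds to \<open>u = e\<^bsup>-2i\<theta>\<^esup>\<close>.
\<close>
definition duality_cycle :: "real \<Rightarrow> (real \<Rightarrow> complex) \<Rightarrow> bool" where
  "duality_cycle c C \<longleftrightarrow>
     valid_path C \<and> pathfinish C = pathstart C \<and>
     path_image C \<subseteq> upper_half \<inter> w_exterior c \<and>
     homotopic_loops {u. c * norm u < 1}
       (\<lambda>x. (C x + \<i>) / (C x - \<i>)) (\<lambda>x. exp (- 2 * of_real pi * \<i> * of_real x)) \<and>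
     winding_number C \<i> = 1"

definition duality_integrand ::
    "real \<Rightarrow> (complex \<Rightarrow> complex) \<Rightarrow> (complex \<Rightarrow> complex) \<Rightarrow> complex \<Rightarrow> complex" where
  "duality_integrand r h s z = 1 / of_real pi * (plus_fun r h z * s z / (z + \<i>)\<^sup>2)"

text \<open>The form \<open>B\<close> on \<open>M \<times> N\<close> is given by the integral, for all admissible choices.\<close>
definition given_by_integral ::
    "real \<Rightarrow> (complex \<Rightarrow> complex) set \<Rightarrow> (complex \<Rightarrow> complex) set \<Rightarrow>
     ((complex \<Rightarrow> complex) \<Rightarrow> (complex \<Rightarrow> complex) \<Rightarrow> complex) \<Rightarrow> bool" where
  "given_by_integral r M N B \<longleftrightarrow>
     (\<forall>h\<in>M. \<forall>f\<in>N. \<forall>c s C. is_sigma r f c s \<and> duality_cycle c C \<longrightarrow>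
        (duality_integrand r h s has_contour_integral B h f) C)"

definition linear_form_on ::
    "(complex \<Rightarrow> complex) set \<Rightarrow> ((complex \<Rightarrow> complex) \<Rightarrow> complex) \<Rightarrow> bool" where
  "linear_form_on M L \<longleftrightarrow>
     (\<forall>f\<in>M. \<forall>g\<in>M. \<forall>a b. L (\<lambda>z. a * f z + b * g z) = a * L f + b * L g)"

definition bilinear_form_on ::
    "(complex \<Rightarrow> complex) set \<Rightarrow> (complex \<Rightarrow> complex) set \<Rightarrow>
     ((complex \<Rightarrow> complex) \<Rightarrow> (complex \<Rightarrow> complex) \<Rightarrow> complex) \<Rightarrow> bool" where
  "bilinear_form_on M N B \<longleftrightarrow>
     (\<forall>f\<in>N. linear_form_on M (\<lambda>h. B h f)) \<and> (\<forall>h\<in>M. linear_form_on N (\<lambda>f. B h f))"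

definition Gamma_invariant_on ::
    "(int ^ 2 ^ 2 \<Rightarrow> complex) \<Rightarrow> real \<Rightarrow> (complex \<Rightarrow> complex) set \<Rightarrow> (complex \<Rightarrow> complex) set \<Rightarrow>
     ((complex \<Rightarrow> complex) \<Rightarrow> (complex \<Rightarrow> complex) \<Rightarrow> complex) \<Rightarrow> bool" where
  "Gamma_invariant_on v r M N B \<longleftrightarrow>
     (\<forall>\<gamma>\<in>SL2Z. \<forall>h\<in>M. \<forall>f\<in>N. B (slash_plus v r \<gamma> h) (slash_minus v r \<gamma> f) = B h f)"

text \<open>\<open>M\<close> consists of functions on the upper and \<open>N\<close> of functions on the lower half-plane.\<close>
definition nondegenerate_on ::
    "(complex \<Rightarrow> complex) set \<Rightarrow> (complex \<Rightarrow> complex) set \<Rightarrow>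
     ((complex \<Rightarrow> complex) \<Rightarrow> (complex \<Rightarrow> complex) \<Rightarrow> complex) \<Rightarrow> bool" where
  "nondegenerate_on M N B \<longleftrightarrow>
     (\<forall>h\<in>M. (\<forall>f\<in>N. B h f = 0) \<longrightarrow> (\<forall>z\<in>upper_half. h z = 0)) \<and>
     (\<forall>f\<in>N. (\<forall>h\<in>M. B h f = 0) \<longrightarrow> (\<forall>t\<in>lower_half. f t = 0))"

text \<open>
  For \<open>r\<close> a non-positive integer the form is \<open>\<Gamma>\<close>-invariant on pairs of polynomial functions,
  but not when all holomorphic \<open>h\<close> are admitted: for \<open>r = 0\<close> and constant \<open>f\<close> the integral is
  \<open>h(\<i>) f\<close>. The duality theorem therefore claims invariance only on the polynomial modules.
\<close>
lemma duality_weight_0: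
  assumes B: "given_by_integral 0 D_plus_neg_omega (D_minus_pol 0) B"
    and h: "h holomorphic_on upper_half"
  shows "B h (\<lambda>_. a) = a * h \<i>"
proof -
  define s where "s = (\<lambda>z. a * w_coord z powi (- 1))"
  define C where "C = circlepath \<i> (1 / 2)"
  have f: "(\<lambda>_. a) \<in> D_minus_pol 0"
    unfolding D_minus_pol_def by (auto intro!: exI[of _ "[:a:]"])
  have "is_sigma 0 (\<lambda>_. a) 0 s"
    unfolding is_sigma_def s_def minus_fun_def by (auto intro!: exI[of _ "\<lambda>_. a"])
  moreover have C_up: "cball \<i> (1 / 2) \<subseteq> upper_half"
  proof
    fix z assume "z \<in> cball \<i> (1 / 2)"
    then have "\<bar>Im (\<i> - z)\<bar> \<le> 1 / 2"
      using abs_Im_le_cmod[of "\<i> - z"] by (simp add: dist_norm)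
    then show "z \<in> upper_half" by (auto simp: abs_if split: if_splits)
  qed
  moreover have "duality_cycle 0 C"
  proof -
    have ne: "C x \<noteq> \<i>" if "x \<in> {0..1}" for x
      by (simp add: C_def circlepath)
    have "homotopic_loops UNIV (\<lambda>x. (C x + \<i>) / (C x - \<i>))
            (\<lambda>x. exp (- 2 * of_real pi * \<i> * of_real x))"
    proof (rule homotopic_loops_linear)
      show "path (\<lambda>x. (C x + \<i>) / (C x - \<i>))"
        unfolding path_def C_def circlepath by (intro continuous_intros) auto
      show "path (\<lambda>x. exp (- 2 * of_real pi * \<i> * of_real x) :: complex)"
        unfolding path_def by (intro continuous_intros)
      show "pathfinish (\<lambda>x. (C x + \<i>) / (C x - \<i>)) = pathstart (\<lambda>x. (C x + \<i>) / (C x - \<i>))"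
        by (simp add: pathfinish_def pathstart_def C_def circlepath)
      show "pathfinish (\<lambda>x. exp (- 2 * of_real pi * \<i> * of_real x)) =
            pathstart (\<lambda>x. exp (- 2 * of_real pi * \<i> * of_real x) :: complex)"
        by (simp add: pathfinish_def pathstart_def exp_minus)
    qed auto
    moreover have "path_image C \<subseteq> upper_half \<inter> w_exterior 0"
      using order_trans[OF sphere_cball C_up] by (auto simp: C_def w_exterior_def sphere_def)
    ultimately show ?thesis
      by (simp add: duality_cycle_def C_def winding_number_circlepath_centre)
  qed
  ultimately have 1: "(duality_integrand 0 h s has_contour_integral B h (\<lambda>_. a)) C"
    using B f h unfolding given_by_integral_def D_plus_neg_omega_def by blast
  define F where "F = (\<lambda>z. 1 / of_real pi * (a * h z / (z + \<i>)))"
  have nz: "z + \<i> \<noteq> 0" if "z \<in> cball \<i> (1 / 2)" for z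
    using C_up that by (auto simp: complex_eq_iff)
  have "F holomorphic_on cball \<i> (1 / 2)"
    unfolding F_def using nz C_up by (intro holomorphic_intros holomorphic_on_subset[OF h]) auto
  then have 2: "((\<lambda>u. F u / (u - \<i>)) has_contour_integral 2 * of_real pi * \<i> * F \<i>) C"
    unfolding C_def
    by (intro Cauchy_integral_circlepath holomorphic_on_imp_continuous_on) 
       (auto intro: holomorphic_on_subset)
  have "duality_integrand 0 h s z = F z / (z - \<i>)" if "z \<in> path_image C" for z
  proof -
    have "z \<in> cball \<i> (1 / 2)"
      using that by (simp add: C_def)
    then have "z + \<i> \<noteq> 0" by (rule nz)
    then have "- \<i> - z \<noteq> 0"
      by (metis add.commute diff_conv_add_uminus minus_add_distrib neg_equal_0_iff_equal)
    have alg: "1 / q * (H * (a * (x / y)) / x\<^sup>2) = 1 / q * (a * H / x) / y"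
      if "x \<noteq> 0" for q H x y :: complex
      using that by (simp add: power2_eq_square) (metis mult.assoc mult.commute)
    have "s z = a * ((z + \<i>) / (z - \<i>))"
      by (simp add: s_def w_coord_def power_int_minus)
    moreover have "plus_fun 0 h z = h z"
      using \<open>- \<i> - z \<noteq> 0\<close> by (simp add: plus_fun_def)
    ultimately show ?thesis
      unfolding duality_integrand_def F_def by (simp only: alg[OF \<open>z + \<i> \<noteq> 0\<close>])
  qed
  then have "((\<lambda>u. F u / (u - \<i>)) has_contour_integral B h (\<lambda>_. a)) C"
    by (rule has_contour_integral_eq[OF 1])
  from has_contour_integral_unique[OF this 2] have "B h (\<lambda>_. a) = 2 * of_real pi * \<i> * F \<i>" .
  then show ?thesis by (simp add: F_def)
qed

lemma duality_weight_0_not_invariant: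
  assumes B: "given_by_integral 0 D_plus_neg_omega (D_minus_pol 0) B"
  shows "\<not> Gamma_invariant_on v 0 D_plus_neg_omega (D_minus_pol 0) B"
proof
  assume inv: "Gamma_invariant_on v 0 D_plus_neg_omega (D_minus_pol 0) B"
  define T :: "int ^ 2 ^ 2" where "T = vector [vector [1, 1], vector [0, 1]]"
  have [simp]: "moebius_den T z = 1" "moebius T z = z + 1" for z
    by (simp_all add: T_def moebius_def moebius_num_def moebius_den_def)
  have T: "T \<in> SL2Z"
    by (simp add: T_def SL2Z_def det_2)
  have p: "slash_plus v 0 T (\<lambda>z. z) = (\<lambda>z. inverse (v T) * (z + 1))"
    by (simp add: slash_plus_def fun_eq_iff)
  have m: "slash_minus v 0 T (\<lambda>_. 1) = (\<lambda>_. v T)"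
    by (simp add: slash_minus_def powr_low_def fun_eq_iff)
  have "(\<lambda>z. z) \<in> D_plus_neg_omega" "(\<lambda>_. 1) \<in> D_minus_pol 0"
    by (auto simp: D_plus_neg_omega_def D_minus_pol_def intro!: exI[of _ "[:1:]"])
  with inv T have "B (slash_plus v 0 T (\<lambda>z. z)) (slash_minus v 0 T (\<lambda>_. 1)) = B (\<lambda>z. z) (\<lambda>_. 1)"
    unfolding Gamma_invariant_on_def by blast
  then have "v T * (inverse (v T) * (\<i> + 1)) = \<i>"
    unfolding p m by (subst (asm) (1 2) duality_weight_0[OF B]) (auto intro!: holomorphic_intros)
  then show False
    by (cases "v T = 0") (auto simp: mult.assoc[symmetric] complex_eq_iff)
qed

definition plus_expansion :: "real \<Rightarrow> (complex \<Rightarrow> complex) \<Rightarrow> (nat \<Rightarrow> complex) \<Rightarrow> bool" where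
  "plus_expansion r h c \<longleftrightarrow>
     (\<forall>z\<in>upper_half. (\<lambda>n. c n * w_coord z ^ n) sums plus_fun r h z)"

text \<open>At \<open>t = -\<i>\<close>, where \<open>w\<close> is infinite, the conventions \<open>x / 0 = 0\<close> and \<open>0 powi (-n) = 0\<close> for
  \<open>n > 0\<close> leave the correct value \<open>d 0\<close>.\<close>
definition minus_expansion :: "real \<Rightarrow> (complex \<Rightarrow> complex) \<Rightarrow> (int \<Rightarrow> complex) \<Rightarrow> bool" where
  "minus_expansion r f d \<longleftrightarrow>
     (\<forall>t\<in>lower_half. (\<lambda>n. d (- int n) * w_coord t powi (- int n)) sums minus_fun r f t) \<and>
     (r \<in> \<int>\<^sub>\<le>\<^sub>0 \<longrightarrow> (\<forall>m. of_int m < - \<bar>r\<bar> \<longrightarrow> d m = 0))"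

end

theory Submission
  imports Defs
begin

text \<open>
  In the coordinate \<open>w\<close> on the upper and \<open>u = 1 / w\<close> on the lower half-plane both modules consist of
  power series \<open>\<Sum> c\<^sub>n w\<^sup>n\<close> and \<open>\<Sum> d\<^bsub>-n\<^esub> u\<^sup>n\<close>, and termwise integration turns the contour integral into
  \<open>\<Sum> n! / (r)\<^sub>n c\<^sub>n d\<^bsub>-n\<^esub>\<close>. By the binomial series the kernel \<open>z \<mapsto> (t - z)\<^bsup>-r\<^esup>\<close>, with \<open>t\<close> in the lower
  half-plane, pairs with \<open>f\<close> to a constant times \<open>f(t)\<close>, and the action permutes these kernels up to
  automorphy factors, so the form is invariant when \<open>h\<close> is a kernel. Both sides of the invariance
  relation are continuous in \<open>h\<close> for uniform convergence on compact sets, and continuous functionals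
  that agree on all kernels are equal. For smooth \<open>f\<close> the \<open>d\<^bsub>-n\<^esub>\<close> are Fourier coefficients of
  the boundary value; they decrease faster than every power of \<open>n\<close>, while \<open>c\<^sub>n\<close> and \<open>n! / (r)\<^sub>n\<close>
  grow at most polynomially.
\<close>

subsection \<open>The Cayley transform and Taylor coefficients\<close>

text \<open>Invariance rests on a fact that neither the hypergeometric operator nor the weights
  n!/(r)_n displays: the expansion of (t - z)^(-r) in w has the coefficients (r)_n/n!, the
  reciprocals of these weights, so the kernels are the functions on which the pairing becomes
  evaluation. For this reason the form is defined by the series; the integral, with its free choice
  of circle, extension and cycle, is evaluated to it. Two obstacles shape the proof. Real powers are
  multivalued and the half-planes use different argument conventions, so the product formulas are
  proved for logarithms, by exponentiating and bounding an imaginary part by 2 pi. If r = -N, the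
  kernels are polynomials and reach only the monomials with n <= N; hypotheses that a coefficient
  vanishes wherever its weight does carry this case along with the generic one and confine
  invariance to polynomial h. Moreover, the transformed f must still extend across the real
  projective line; in the coordinate u the group acts by automorphisms of the disc, which makes this
  visible.\<close>

definition cayley :: "complex \<Rightarrow> complex" where
  "cayley w = \<i> * (1 + w) / (1 - w)"

text \<open>Used on both sides of the boundary: the sign of Im z is that of 1 - |w|^2, and close to
  the unit circle the quotient bounds Im z from below, as the growth estimate for
  \<open>plus_coeff\<close> requires.\<close>

lemma Im_cayley:
  assumes "w \<noteq> 1"
  shows "Im (cayley w) = (1 - (norm w)\<^sup>2) / (norm (1 - w))\<^sup>2"
proof -
  have "cayley w = \<i> * ((1 + w) * cnj (1 - w)) / of_real ((norm (1 - w))\<^sup>2)"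
    unfolding complex_norm_square using assms by (simp add: cayley_def)
  also have "Im \<dots> = Re ((1 + w) * cnj (1 - w)) / (norm (1 - w))\<^sup>2"
    by (simp only: Im_divide_of_real) simp
  also have "Re ((1 + w) * cnj (1 - w)) = 1 - (norm w)\<^sup>2"
    unfolding cmod_power2 by (simp add: algebra_simps power2_eq_square)
  finally show ?thesis .
qed

lemma cayley_upper:
  assumes "norm w < 1" shows "Im (cayley w) > 0"
proof -
  have "w \<noteq> 1" using assms by auto
  moreover have "(norm w)\<^sup>2 < 1" using assms by (simp add: power_less_one_iff)
  ultimately show ?thesis by (simp add: Im_cayley)
qed

lemma w_coord_cayley: "w \<noteq> 1 \<Longrightarrow> w_coord (cayley w) = w"
proof -
  assume "w \<noteq> 1"
  then have "1 - w \<noteq> 0" by simp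
  then have "cayley w - \<i> = 2 * \<i> * w / (1 - w)" "cayley w + \<i> = 2 * \<i> / (1 - w)"
    by (simp_all add: cayley_def divide_simps) (simp_all add: algebra_simps)
  then show ?thesis using \<open>1 - w \<noteq> 0\<close> by (simp add: w_coord_def)
qed

lemma cayley_w_coord:
  assumes "z + \<i> \<noteq> 0" shows "cayley (w_coord z) = z"
proof -
  have "1 - w_coord z = 2 * \<i> / (z + \<i>)" "1 + w_coord z = 2 * z / (z + \<i>)"
    using assms by (simp_all add: w_coord_def divide_simps)
  then show ?thesis using assms by (simp add: cayley_def)
qed

lemma upper_half_nz: "Im z > 0 \<Longrightarrow> z + \<i> \<noteq> 0"
  by (auto simp: complex_eq_iff)

lemma norm_w_coord_less:
  assumes "Im z > 0" shows "norm (w_coord z) < 1"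
proof -
  have "(norm (z - \<i>))\<^sup>2 < (norm (z + \<i>))\<^sup>2"
    using assms unfolding cmod_power2 by (simp add: power2_eq_square algebra_simps)
  then have "norm (z - \<i>) < norm (z + \<i>)" by (rule power2_less_imp_less) simp
  then show ?thesis
    using upper_half_nz[OF assms] by (simp add: w_coord_def norm_divide)
qed

text \<open>At the points i and -i both sides are 0 by the conventions for division by 0. The
  identity says that u = 1/w at t is w at -t, so facts about the upper half-plane serve the lower
  one through the reflection t -> -t.\<close>

lemma w_coord_minus: "w_coord (- z) = inverse (w_coord z)"
proof -
  have "w_coord (- z) = - (z + \<i>) / - (z - \<i>)" by (simp add: w_coord_def)
  also have "\<dots> = inverse (w_coord z)" unfolding w_coord_def by (simp only: divide_minus_left divide_minus_right minus_minus inverse_divide)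
  finally show ?thesis .
qed

lemma w_coord_powi_lower: "w_coord t powi (- int n) = w_coord (- t) ^ n"
  by (simp add: w_coord_minus power_int_minus power_inverse)

lemma holomorphic_cayley [holomorphic_intros]:
  "f holomorphic_on A \<Longrightarrow> (\<And>z. z \<in> A \<Longrightarrow> f z \<noteq> 1) \<Longrightarrow> (\<lambda>z. cayley (f z)) holomorphic_on A"
  unfolding cayley_def by (intro holomorphic_intros) auto

lemma holomorphic_w_coord [holomorphic_intros]:
  "f holomorphic_on A \<Longrightarrow> (\<And>z. z \<in> A \<Longrightarrow> f z + \<i> \<noteq> 0) \<Longrightarrow> (\<lambda>z. w_coord (f z)) holomorphic_on A"
  unfolding w_coord_def by (intro holomorphic_intros) auto

section \<open>Taylor coefficients at the origin and their growth\<close>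

definition taylor :: "(complex \<Rightarrow> complex) \<Rightarrow> nat \<Rightarrow> complex" where
  "taylor F n = (deriv ^^ n) F 0 / fact n"

lemma taylor_sums:
  assumes "F holomorphic_on ball 0 R" "norm w < R"
  shows "(\<lambda>n. taylor F n * w ^ n) sums F w"
  using holomorphic_power_series[OF assms(1), of w] assms(2) by (simp add: taylor_def)

text \<open>Convergence at the points of the disc forces the formal series to have radius of
  convergence at least R, so it is the expansion of F. This is the main way of computing
  coefficients below: a convergent series is exhibited.\<close>

lemma taylor_unique:
  assumes "R > 0" "\<And>w. norm w < R \<Longrightarrow> (\<lambda>n. a n * w ^ n) sums F w"
  shows "a = taylor F"
proof -
  have R: "fps_conv_radius (Abs_fps a) \<ge> ereal R"
    unfolding fps_conv_radius_def
  proof (rule conv_radius_geI_ex)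
    fix r assume r: "0 < r" "ereal r < ereal R"
    then have "summable (\<lambda>n. a n * (of_real r) ^ n)"
      by (intro sums_summable[OF assms(2)]) auto
    with r show "\<exists>z::complex. norm z = r \<and> summable (\<lambda>n. fps_nth (Abs_fps a) n * z ^ n)"
      by (intro exI[of _ "of_real r"]) auto
  qed
  have "F has_fps_expansion Abs_fps a"
    unfolding has_fps_expansion_def
  proof
    show "0 < fps_conv_radius (Abs_fps a)"
      using R assms(1) by (meson ereal_less(2) less_le_trans)
    have "eventually (\<lambda>w. w \<in> ball 0 R) (nhds (0::complex))"
      using assms(1) by (intro eventually_nhds_in_open) auto
    then show "eventually (\<lambda>z. eval_fps (Abs_fps a) z = F z) (nhds 0)"
      by eventually_elim (use assms(2) in \<open>auto simp: eval_fps_def dest: sums_unique[symmetric]\<close>)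
  qed
  from fps_nth_fps_expansion[OF this] show ?thesis
    by (simp add: taylor_def fun_eq_iff)
qed

lemma taylor_bound:
  assumes "F holomorphic_on ball 0 R" "0 < \<rho>" "\<rho> < R" "\<And>w. norm w = \<rho> \<Longrightarrow> norm (F w) \<le> M"
  shows "norm (taylor F n) \<le> M / \<rho> ^ n"
proof -
  have "norm ((deriv ^^ n) F 0) \<le> fact n * M / \<rho> ^ n"
    using assms by (intro Cauchy_inequality holomorphic_on_imp_continuous_on)
      (auto intro: holomorphic_on_subset[OF assms(1)])
  then have "norm ((deriv ^^ n) F 0) / fact n \<le> (fact n * M / \<rho> ^ n) / fact n"
    by (rule divide_right_mono) simp
  then show ?thesis by (simp add: taylor_def norm_divide)
qed

lemma taylor_geometric_bound:
  assumes "F holomorphic_on ball 0 R" "0 < \<rho>" "\<rho> < R"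
  shows "\<exists>M. \<forall>n. norm (taylor F n) \<le> M / \<rho> ^ n"
proof -
  have "compact (F ` cball 0 \<rho>)"
    using assms by (intro compact_continuous_image holomorphic_on_imp_continuous_on)
      (auto intro: holomorphic_on_subset[OF assms(1)])
  then obtain M where "\<forall>w\<in>cball 0 \<rho>. norm (F w) \<le> M"
    using compact_imp_bounded bounded_iff by (metis imageI)
  then show ?thesis using taylor_bound[OF assms] by (intro exI[of _ M]) auto
qed

lemma taylor_linear:
  assumes "F holomorphic_on ball 0 R" "G holomorphic_on ball 0 R" "R > 0"
  shows "taylor (\<lambda>w. a * F w + b * G w) n = a * taylor F n + b * taylor G n"
proof -
  have "(\<lambda>n. a * taylor F n + b * taylor G n) = taylor (\<lambda>w. a * F w + b * G w)"
  proof (rule taylor_unique[OF assms(3)])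
    fix w :: complex assume "norm w < R"
    then have "(\<lambda>n. a * (taylor F n * w ^ n) + b * (taylor G n * w ^ n)) sums (a * F w + b * G w)"
      using assms by (intro sums_add sums_mult taylor_sums)
    then show "(\<lambda>n. (a * taylor F n + b * taylor G n) * w ^ n) sums (a * F w + b * G w)"
      by (simp add: algebra_simps)
  qed
  then show ?thesis by metis
qed

lemma taylor_cong:
  assumes "R > 0" "\<And>w. norm w < R \<Longrightarrow> F w = G w"
  shows "taylor F = taylor G"
proof
  fix n
  have "eventually (\<lambda>w. w \<in> ball 0 R) (nhds (0::complex))"
    using assms(1) by (intro eventually_nhds_in_open) auto
  then have "eventually (\<lambda>w. F w = G w) (nhds 0)"
    by eventually_elim (use assms(2) in auto)
  then show "taylor F n = taylor G n"
    unfolding taylor_def by (metis higher_deriv_cong_ev)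
qed

text \<open>Since \<open>x / 0 = 0\<close>, this weight is \<open>0\<close> for the terms \<open>n > \<bar>r\<bar>\<close> that are absent for \<open>r \<in> \<int>\<^sub>\<le>\<^sub>0\<close>.\<close>
definition wt :: "real \<Rightarrow> nat \<Rightarrow> complex" where
  "wt r n = fact n / pochhammer (of_real r) n"

text \<open>The product r (r+1) ... (r+n-1) has a zero factor exactly when r = -k with k < n, and
  the quotient by 0 is 0.\<close>

lemma wt_eq_0_iff: "wt r n = 0 \<longleftrightarrow> r \<in> \<int>\<^sub>\<le>\<^sub>0 \<and> real n > \<bar>r\<bar>"
proof -
  have "pochhammer (complex_of_real r) n = 0 \<longleftrightarrow> (\<exists>k<n. r = - real k)"
    unfolding pochhammer_eq_0_iff by (metis of_real_eq_iff of_real_minus of_real_of_nat_eq)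
  also have "\<dots> \<longleftrightarrow> r \<in> \<int>\<^sub>\<le>\<^sub>0 \<and> real n > \<bar>r\<bar>"
    by (auto elim!: nonpos_Ints_cases' )
  finally show ?thesis by (simp add: wt_def)
qed

text \<open>Euler's limit formula: n!/(r)_n equals n * n^(-r) times a sequence converging to
  Gamma(r), which is therefore bounded. With 1/0 = 0 this also covers the poles of Gamma.\<close>

lemma wt_polynomial_bound: "\<exists>K A. K > 0 \<and> (\<forall>n. norm (wt r n) \<le> K * real (Suc n) ^ A)"
proof -
  define m where "m = nat \<lceil>\<bar>r\<bar>\<rceil>"
  obtain K where K: "K > 0" "\<And>n. norm (Gamma_series' (complex_of_real r) n) \<le> K"
    using Gamma_series'_LIMSEQ[of "complex_of_real r", THEN convergentI, THEN convergent_imp_Bseq]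
    unfolding Bseq_def by blast
  have "norm (wt r n) \<le> (K + 1) * real (Suc n) ^ Suc m" for n
  \<comment> \<open>\<open>Gamma_series'\<close> contains (n-1)! and n^r, so the comparison with n!
    makes sense only for positive n.\<close>
  proof (cases "n = 0")
    case True
    then show ?thesis using K(1) by (simp add: wt_def)
  next
    case False
    then have "wt r n = of_nat n * (Gamma_series' (of_real r) n * of_real (real n powr (- r)))"
      by (simp add: wt_def Gamma_series'_def powr_def exp_minus exp_of_real[symmetric] fact_reduce[of n] field_simps)
    then have "norm (wt r n) = real n * (norm (Gamma_series' (complex_of_real r) n) * real n powr (- r))"
      by (simp only: norm_mult norm_of_nat norm_of_real abs_of_nonneg powr_ge_zero)
    also have "\<dots> \<le> real (Suc n) * ((K + 1) * real (Suc n) ^ m)"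
    proof (intro mult_mono)
      have "real n powr (- r) \<le> real n powr real m"
        using False by (intro powr_mono) (auto simp: m_def, linarith)
      also have "\<dots> = real n ^ m" using False by (simp add: powr_realpow)
      also have "\<dots> \<le> real (Suc n) ^ m" by (intro power_mono) auto
      finally show "real n powr (- r) \<le> real (Suc n) ^ m" .
    qed (use K(1) K(2)[of n] in auto)
    finally show ?thesis by (simp add: mult_ac)
  qed
  with K(1) show ?thesis by (intro exI[of _ "K + 1"] exI[of _ "Suc m"]) auto
qed

subsection \<open>Contour integrals of Laurent series in \<open>w\<close>\<close>

text \<open>Convergence is required on an open neighbourhood of the path: the limit is then
  holomorphic, hence integrable, and the integral along the path is bounded by a constant L times
  the supremum over S, with L independent of the integrand.\<close>

lemma contour_integral_uniform_limit_open:
  assumes "open S" "valid_path \<gamma>" "path_image \<gamma> \<subseteq> S"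
    and hol: "\<And>n. f n holomorphic_on S" and lim: "uniform_limit S f g sequentially"
    and int: "\<And>n. (f n has_contour_integral I n) \<gamma>"
  shows "g contour_integrable_on \<gamma>" "I \<longlonglongrightarrow> contour_integral \<gamma> g"
proof -
  have g: "g holomorphic_on S"
  proof (rule holomorphic_uniform_sequence[OF assms(1) hol])
    fix x assume "x \<in> S"
    then obtain d where "d > 0" "cball x d \<subseteq> S" using assms(1) open_contains_cball by metis
    then show "\<exists>d>0. cball x d \<subseteq> S \<and> uniform_limit (cball x d) f g sequentially"
      using uniform_limit_on_subset[OF lim] by blast
  qed
  show g_int: "g contour_integrable_on \<gamma>"
    using contour_integrable_holomorphic_simple[OF g assms(1-3)] .
  obtain L where L: "L > 0"
    "\<And>f B. f holomorphic_on S \<Longrightarrow> (\<forall>z \<in> S. norm (f z) \<le> B) \<Longrightarrow> norm (contour_integral \<gamma> f) \<le> L * B"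
    using contour_integral_bound_exists[OF assms(1-3)] by blast
  show "I \<longlonglongrightarrow> contour_integral \<gamma> g"
  proof (rule tendstoI)
    fix e :: real assume "e > 0"
    then have "eventually (\<lambda>n. \<forall>x\<in>S. dist (f n x) (g x) < e / (2 * L)) sequentially"
      using lim L(1) by (intro uniform_limitD) auto
    then show "eventually (\<lambda>n. dist (I n) (contour_integral \<gamma> g) < e) sequentially"
    proof eventually_elim
      case (elim n)
      have "norm (contour_integral \<gamma> (\<lambda>z. f n z - g z)) \<le> L * (e / (2 * L))"
        using elim hol g by (intro L(2) holomorphic_intros) (auto simp: dist_norm less_imp_le)
      also have "contour_integral \<gamma> (\<lambda>z. f n z - g z) = I n - contour_integral \<gamma> g"
        using int[of n] g_int by (subst contour_integral_diff)
          (auto simp: has_contour_integral_integrable contour_integral_unique)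
      finally show ?case using \<open>e > 0\<close> L(1) by (simp add: dist_norm)
    qed
  qed
qed

lemma square_plus_one: "(z::complex)\<^sup>2 + 1 = (z - \<i>) * (z + \<i>)"
  by (simp add: algebra_simps power2_eq_square)

text \<open>Since dz/(z^2 + 1) = dw/(2 i w), the integrand is w^(k-1) dw/(2i) with k = m - n. It has
  the primitive w^k/(2 i k) for nonzero k; for k = 0 partial fractions reduce it to the two winding
  numbers.\<close>

lemma has_contour_integral_w_coord_monomial:
  assumes \<gamma>: "valid_path \<gamma>" "pathfinish \<gamma> = pathstart \<gamma>" "\<i> \<notin> path_image \<gamma>" "- \<i> \<notin> path_image \<gamma>"
    "winding_number \<gamma> \<i> = 1" "winding_number \<gamma> (- \<i>) = 0"
  shows "((\<lambda>z. w_coord z ^ m * inverse (w_coord z) ^ n / (z\<^sup>2 + 1)) has_contour_integral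
    (if m = n then of_real pi else 0)) \<gamma>"
proof -
  have nz: "z - \<i> \<noteq> 0" "z + \<i> \<noteq> 0" if "z \<in> path_image \<gamma>" for z
    using that \<gamma>(3,4) by (auto simp: add_eq_0_iff2)
  show ?thesis
  proof (cases "m = n")
    case True
    have "((\<lambda>z. 1 / (2 * \<i>) * (1 / (z - \<i>) - 1 / (z - (- \<i>)))) has_contour_integral
       1 / (2 * \<i>) * (2 * pi * \<i> * winding_number \<gamma> \<i> - 2 * pi * \<i> * winding_number \<gamma> (- \<i>))) \<gamma>"
      by (intro has_contour_integral_lmul has_contour_integral_diff has_contour_integral_winding_number \<gamma>)
    also have "1 / (2 * \<i>) * (2 * pi * \<i> * winding_number \<gamma> \<i> - 2 * pi * \<i> * winding_number \<gamma> (- \<i>)) = pi"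
      by (simp add: \<gamma> mult.left_commute[of \<i>])
    finally show ?thesis
    proof (subst if_P[OF True], rule has_contour_integral_eq)
      fix z assume z: "z \<in> path_image \<gamma>"
      have "w_coord z ^ m * inverse (w_coord z) ^ n = 1"
        using nz[OF z] True by (simp add: w_coord_def field_simps)
      then show "1 / (2 * \<i>) * (1 / (z - \<i>) - 1 / (z - - \<i>)) =
          w_coord z ^ m * inverse (w_coord z) ^ n / (z\<^sup>2 + 1)"
        using nz[OF z] unfolding square_plus_one by (simp only:) (simp add: field_simps)
    qed
  next
    case False
    define k where "k = int m - int n"
    have k: "k \<noteq> 0" using False by (simp add: k_def)
    let ?S = "- {\<i>, - \<i>}"
    have *: "((\<lambda>z. w_coord z powi k / (2 * \<i> * of_int k)) has_field_derivative
           w_coord z ^ m * inverse (w_coord z) ^ n / (z\<^sup>2 + 1)) (at z within ?S)" if "z \<in> ?S" for z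
    proof -
      have nz: "z - \<i> \<noteq> 0" "z + \<i> \<noteq> 0" using that by (auto simp: add_eq_0_iff2)
      have d: "(w_coord has_field_derivative 2 * \<i> / (z + \<i>)\<^sup>2) (at z within ?S)"
        unfolding w_coord_def using nz
        by (auto intro!: derivative_eq_intros simp: power2_eq_square field_simps)
      have w: "w_coord z \<noteq> 0" using nz by (simp add: w_coord_def)
      have "((\<lambda>z. w_coord z powi k / (2 * \<i> * of_int k)) has_field_derivative
           of_int k * w_coord z powi (k - 1) * (2 * \<i> / (z + \<i>)\<^sup>2) / (2 * \<i> * of_int k)) (at z within ?S)"
        by (intro DERIV_cdivide DERIV_power_int d disjI2 w)
      also have "of_int k * w_coord z powi (k - 1) * (2 * \<i> / (z + \<i>)\<^sup>2) / (2 * \<i> * of_int k) =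
          w_coord z powi (k - 1) / (z + \<i>)\<^sup>2"
        using k by simp
      also have "w_coord z powi (k - 1) = w_coord z powi k / w_coord z"
        using w by (simp add: power_int_diff)
      also have "w_coord z powi k = w_coord z ^ m * inverse (w_coord z) ^ n"
        using w by (simp add: k_def power_int_diff field_simps)
      also have "X / w_coord z / (z + \<i>)\<^sup>2 = X / (z\<^sup>2 + 1)" for X
        unfolding square_plus_one w_coord_def using nz by (simp add: power2_eq_square)
      finally show ?thesis .
    qed
    show ?thesis
      unfolding if_not_P[OF False] by (rule Cauchy_theorem_primitive[OF *]) (use \<gamma> in auto)
  qed
qed

text \<open>Boundedness of the limit accompanies the M-test because uniform convergence passes to
  products only for bounded limits.\<close>

lemma uniform_limit_power_series:
  fixes a :: "nat \<Rightarrow> complex"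
  assumes "summable (\<lambda>n. norm (a n) * \<rho> ^ n)" "\<And>z. z \<in> S \<Longrightarrow> norm (f z) \<le> \<rho>"
  shows "uniform_limit S (\<lambda>N z. \<Sum>n<N. a n * f z ^ n) (\<lambda>z. \<Sum>n. a n * f z ^ n) sequentially"
    "bounded ((\<lambda>z. \<Sum>n. a n * f z ^ n) ` S)"
proof -
  have b: "norm (a n * f z ^ n) \<le> norm (a n) * \<rho> ^ n" if "z \<in> S" for n z
    using assms(2)[OF that] by (simp add: norm_mult norm_power mult_left_mono power_mono)
  show "uniform_limit S (\<lambda>N z. \<Sum>n<N. a n * f z ^ n) (\<lambda>z. \<Sum>n. a n * f z ^ n) sequentially"
    by (rule Weierstrass_m_test[OF b assms(1)])
  have "norm (\<Sum>n. a n * f z ^ n) \<le> (\<Sum>n. norm (a n) * \<rho> ^ n)" if "z \<in> S" for z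
    by (rule norm_suminf_le[OF b[OF that] assms(1)])
  then show "bounded ((\<lambda>z. \<Sum>n. a n * f z ^ n) ` S)" unfolding bounded_iff by blast
qed

text \<open>The annulus |w| < \<rho>, |1/w| < \<rho>' with denominators cleared. In this form the
  strict inequalities exclude both i and -i by themselves.\<close>

abbreviation w_annulus :: "real \<Rightarrow> real \<Rightarrow> complex set" where
  "w_annulus \<rho> \<rho>' \<equiv> {z. norm (z - \<i>) < \<rho> * norm (z + \<i>) \<and> norm (z + \<i>) < \<rho>' * norm (z - \<i>)}"

text \<open>On the annulus both series converge uniformly, so the products of partial sums may be
  integrated, and orthogonality of the monomials leaves the diagonal terms. Convergence of the sum
  of a_n b_n is a by-product: its partial sums are these integrals up to the factor pi.\<close>

lemma has_contour_integral_w_coord_series: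
  fixes a b :: "nat \<Rightarrow> complex" and \<rho> \<rho>' :: real
  assumes \<gamma>: "valid_path \<gamma>" "pathfinish \<gamma> = pathstart \<gamma>"
    "winding_number \<gamma> \<i> = 1" "winding_number \<gamma> (- \<i>) = 0"
    and image: "path_image \<gamma> \<subseteq> w_annulus \<rho> \<rho>'"
    and \<rho>: "0 < \<rho>" "0 < \<rho>'"
    and a: "summable (\<lambda>n. norm (a n) * \<rho> ^ n)" and b: "summable (\<lambda>n. norm (b n) * \<rho>' ^ n)"
  shows "(\<lambda>n. a n * b n) sums (\<Sum>n. a n * b n)"
    "((\<lambda>z. (\<Sum>n. a n * w_coord z ^ n) * (\<Sum>n. b n * inverse (w_coord z) ^ n) / (z\<^sup>2 + 1))
        has_contour_integral of_real pi * (\<Sum>n. a n * b n)) \<gamma>"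
proof -
  define S where "S = w_annulus \<rho> \<rho>'"
  define A where "A = (\<lambda>z. \<Sum>n. a n * w_coord z ^ n)"
  define B where "B = (\<lambda>z. \<Sum>n. b n * inverse (w_coord z) ^ n)"
  define P where "P = (\<lambda>N z. (\<Sum>m<N. a m * w_coord z ^ m) * (\<Sum>n<N. b n * inverse (w_coord z) ^ n) * (1 / (z\<^sup>2 + 1)))"
  have S: "open S" unfolding S_def
    by (intro open_Collect_conj open_Collect_less continuous_intros)
  have nz: "z - \<i> \<noteq> 0" "z + \<i> \<noteq> 0" if "z \<in> S" for z
    using that by (auto simp: S_def)
  have wn: "norm (w_coord z) \<le> \<rho>" "norm (inverse (w_coord z)) \<le> \<rho>'" "w_coord z \<noteq> 0" if "z \<in> S" for z
    using that nz[OF that] by (auto simp: S_def w_coord_def norm_divide divide_simps)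
  note uA = uniform_limit_power_series[of a \<rho> S w_coord, OF a wn(1), folded A_def]
  note uB = uniform_limit_power_series[of b \<rho>' S "\<lambda>z. inverse (w_coord z)", OF b wn(2), folded B_def]
  have bQ: "bounded ((\<lambda>z. 1 / (z\<^sup>2 + 1)) ` S)"
  proof -
    have "norm (1 / (z\<^sup>2 + 1)) \<le> 1 / ((2 / (1 + \<rho>')) * (2 / (1 + \<rho>)))" if "z \<in> S" for z
    proof -
      \<comment> \<open>The points i and -i have distance 2, and on the annulus |z - i| and |z + i|
        are comparable, so neither can be small.\<close>
      have "2 = norm ((z + \<i>) - (z - \<i>))" by (simp add: norm_mult)
      then have 2: "2 \<le> norm (z + \<i>) + norm (z - \<i>)" using norm_triangle_ineq4 by metis
      have "2 / (1 + \<rho>') \<le> norm (z - \<i>)" "2 / (1 + \<rho>) \<le> norm (z + \<i>)"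
        using 2 that \<rho> by (auto simp: S_def divide_simps algebra_simps)
      then have "(2 / (1 + \<rho>')) * (2 / (1 + \<rho>)) \<le> norm (z - \<i>) * norm (z + \<i>)"
        using \<rho> by (intro mult_mono) auto
      then show ?thesis
        unfolding square_plus_one norm_divide norm_mult norm_one using \<rho> nz[OF that]
        by (intro divide_left_mono) (auto intro!: mult_pos_pos divide_pos_pos simp del: times_divide_eq_left times_divide_eq_right)
    qed
    then show ?thesis unfolding bounded_iff by blast
  qed
  have bAB: "bounded ((\<lambda>z. A z * B z) ` S)"
  proof -
    obtain a' b' where ab: "\<forall>z\<in>S. norm (A z) \<le> a'" "\<forall>z\<in>S. norm (B z) \<le> b'"
      using uA(2) uB(2) by (auto simp: bounded_iff)
    have "norm (A z * B z) \<le> a' * b'" if "z \<in> S" for z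
      unfolding norm_mult using ab that by (intro mult_mono) (auto intro: order_trans[OF norm_ge_zero])
    then show ?thesis unfolding bounded_iff by blast
  qed
  have lim: "uniform_limit S P (\<lambda>z. A z * B z * (1 / (z\<^sup>2 + 1))) sequentially"
    unfolding P_def
    by (intro uniform_lim_mult uA uB uniform_limit_const bAB bQ)
  have holP: "P N holomorphic_on S" for N
    unfolding P_def using nz wn by (intro holomorphic_intros) (auto simp: square_plus_one)
  have image': "path_image \<gamma> \<subseteq> S" using image by (simp add: S_def)
  have ipm: "\<i> \<notin> path_image \<gamma>" "- \<i> \<notin> path_image \<gamma>" using nz image' by force+
  have int: "(P N has_contour_integral of_real pi * (\<Sum>n<N. a n * b n)) \<gamma>" for N
  proof -
    have "((\<lambda>z. \<Sum>m<N. \<Sum>n<N. (a m * b n) * (w_coord z ^ m * inverse (w_coord z) ^ n / (z\<^sup>2 + 1)))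
        has_contour_integral (\<Sum>m<N. \<Sum>n<N. (a m * b n) * (if m = n then of_real pi else 0))) \<gamma>"
      by (intro has_contour_integral_sum has_contour_integral_lmul
          has_contour_integral_w_coord_monomial \<gamma> ipm finite_lessThan)
    also have "(\<Sum>m<N. \<Sum>n<N. (a m * b n) * (if m = n then of_real pi else 0)) = of_real pi * (\<Sum>n<N. a n * b n)"
      by (simp add: if_distrib sum_distrib_left mult_ac cong: if_cong)
    also have "(\<lambda>z. \<Sum>m<N. \<Sum>n<N. (a m * b n) * (w_coord z ^ m * inverse (w_coord z) ^ n / (z\<^sup>2 + 1))) = P N"
      unfolding P_def sum_product by (simp add: fun_eq_iff sum_divide_distrib mult_ac)
    finally show ?thesis .
  qed
  note L = contour_integral_uniform_limit_open[OF S \<gamma>(1) image' holP lim int]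
  have "(\<lambda>N. \<Sum>n<N. a n * b n) \<longlonglongrightarrow> contour_integral \<gamma> (\<lambda>z. A z * B z * (1 / (z\<^sup>2 + 1))) / of_real pi"
    using tendsto_divide[OF L(2) tendsto_const[of "complex_of_real pi"]] by simp
  then have s: "(\<lambda>n. a n * b n) sums (contour_integral \<gamma> (\<lambda>z. A z * B z * (1 / (z\<^sup>2 + 1))) / of_real pi)"
    by (simp add: sums_def)
  then show "(\<lambda>n. a n * b n) sums (\<Sum>n. a n * b n)" by (simp add: sums_iff)
  from s have "of_real pi * (\<Sum>n. a n * b n) = contour_integral \<gamma> (\<lambda>z. A z * B z * (1 / (z\<^sup>2 + 1)))"
    by (simp add: sums_iff)
  with has_contour_integral_integral[OF L(1)]
  show "((\<lambda>z. (\<Sum>n. a n * w_coord z ^ n) * (\<Sum>n. b n * inverse (w_coord z) ^ n) / (z\<^sup>2 + 1))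
        has_contour_integral of_real pi * (\<Sum>n. a n * b n)) \<gamma>"
    by (simp add: A_def B_def)
qed

text \<open>The Euclidean centre has distance 2c^2/(1-c^2) from i and 2/(1-c^2) from -i, and the
  radius 2c/(1-c^2) lies strictly between.\<close>

lemma w_circle_facts:
  assumes "0 < c" "c < 1"
  shows "valid_path (w_circle c)" "pathfinish (w_circle c) = pathstart (w_circle c)"
    "winding_number (w_circle c) \<i> = 1" "winding_number (w_circle c) (- \<i>) = 0"
proof -
  have c2: "0 < 1 - c\<^sup>2" using assms by (simp add: power_less_one_iff)
  show "valid_path (w_circle c)" "pathfinish (w_circle c) = pathstart (w_circle c)"
    by (simp_all add: w_circle_def)
  have "\<i> - complex_of_real ((1 + c\<^sup>2) / (1 - c\<^sup>2)) * \<i> = of_real (- 2 * c\<^sup>2 / (1 - c\<^sup>2)) * \<i>"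
    using c2 by (simp add: complex_eq_iff divide_simps)
  then have "norm (\<i> - complex_of_real ((1 + c\<^sup>2) / (1 - c\<^sup>2)) * \<i>) = \<bar>- 2 * c\<^sup>2 / (1 - c\<^sup>2)\<bar>"
    by (simp only: norm_mult norm_of_real norm_ii mult_1_right)
  also have "\<dots> < 2 * c / (1 - c\<^sup>2)"
  proof -
    have "2 * c\<^sup>2 / (1 - c\<^sup>2) < 2 * c / (1 - c\<^sup>2)"
      using c2 assms by (intro divide_strict_right_mono) (auto simp: power2_eq_square)
    then show ?thesis using c2 by simp
  qed
  finally show "winding_number (w_circle c) \<i> = 1"
    unfolding w_circle_def by (rule winding_number_circlepath)
  have "complex_of_real ((1 + c\<^sup>2) / (1 - c\<^sup>2)) * \<i> - (- \<i>) = of_real (2 / (1 - c\<^sup>2)) * \<i>"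
    using c2 by (simp add: complex_eq_iff divide_simps)
  then have "dist (complex_of_real ((1 + c\<^sup>2) / (1 - c\<^sup>2)) * \<i>) (- \<i>) = \<bar>2 / (1 - c\<^sup>2)\<bar>"
    unfolding dist_norm by (simp only: norm_mult norm_of_real norm_ii mult_1_right)
  also have "\<dots> > 2 * c / (1 - c\<^sup>2)"
    using c2 assms by (simp add: divide_simps)
  finally have "- \<i> \<notin> cball (complex_of_real ((1 + c\<^sup>2) / (1 - c\<^sup>2)) * \<i>) (2 * c / (1 - c\<^sup>2))"
    by simp
  then show "winding_number (w_circle c) (- \<i>) = 0"
    using assms c2 unfolding w_circle_def
    by (intro winding_number_zero_outside[where s = "cball (complex_of_real ((1 + c\<^sup>2) / (1 - c\<^sup>2)) * \<i>) (2 * c / (1 - c\<^sup>2))"])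
       (auto simp: sphere_def)
qed

subsection \<open>The duality as a series and as a contour integral\<close>

definition plus_coeff :: "real \<Rightarrow> (complex \<Rightarrow> complex) \<Rightarrow> nat \<Rightarrow> complex" where
  "plus_coeff r h = taylor (\<lambda>w. plus_fun r h (cayley w))"

text \<open>\<open>- cayley u\<close> is the point of the lower half-plane at which 1/w takes the
  value u.\<close>

definition minus_coeff :: "real \<Rightarrow> (complex \<Rightarrow> complex) \<Rightarrow> nat \<Rightarrow> complex" where
  "minus_coeff r f = taylor (\<lambda>u. minus_fun r f (- cayley u))"

abbreviation duality_term :: "real \<Rightarrow> (complex \<Rightarrow> complex) \<Rightarrow> (complex \<Rightarrow> complex) \<Rightarrow> nat \<Rightarrow> complex" where
  "duality_term r h f n \<equiv> wt r n * plus_coeff r h n * minus_coeff r f n"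

text \<open>With the series as definition, one function serves all weights and both analytic and
  smooth f, and no choice of circle, extension or cycle enters.\<close>

definition duality :: "real \<Rightarrow> (complex \<Rightarrow> complex) \<Rightarrow> (complex \<Rightarrow> complex) \<Rightarrow> complex" where
  "duality r h f = (\<Sum>n. duality_term r h f n)"

lemma plus_fun_holomorphic:
  assumes "h holomorphic_on upper_half"
  shows "plus_fun r h holomorphic_on upper_half"
  unfolding plus_fun_def
  by (intro holomorphic_intros assms) (auto simp: complex_nonpos_Reals_iff)

lemma plus_fun_cayley_holomorphic:
  assumes "h holomorphic_on upper_half"
  shows "(\<lambda>w. plus_fun r h (cayley w)) holomorphic_on ball 0 1"
proof -
  have "(plus_fun r h \<circ> cayley) holomorphic_on ball 0 1"
    by (rule holomorphic_on_compose_gen[OF _ plus_fun_holomorphic[OF assms]])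
       (auto intro!: holomorphic_intros simp: cayley_upper)
  then show ?thesis by (simp add: o_def)
qed

lemma minus_fun_cayley_holomorphic:
  assumes "f holomorphic_on lower_half"
  shows "(\<lambda>u. minus_fun r f (- cayley u)) holomorphic_on ball 0 1"
proof -
  have "minus_fun r f holomorphic_on lower_half"
    unfolding minus_fun_def
    by (intro holomorphic_intros assms) (auto simp: complex_nonpos_Reals_iff)
  then have "(minus_fun r f \<circ> (\<lambda>u. - cayley u)) holomorphic_on ball 0 1"
    by (rule holomorphic_on_compose_gen[rotated])
       (auto intro!: holomorphic_intros simp: cayley_upper)
  then show ?thesis by (simp add: o_def)
qed

lemma plus_coeff_sums:
  assumes "h holomorphic_on upper_half" "Im z > 0"
  shows "(\<lambda>n. plus_coeff r h n * w_coord z ^ n) sums plus_fun r h z"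
  using taylor_sums[OF plus_fun_cayley_holomorphic[OF assms(1)] norm_w_coord_less[OF assms(2)]]
    cayley_w_coord[OF upper_half_nz[OF assms(2)]]
  by (simp add: plus_coeff_def)

lemma minus_coeff_sums:
  assumes "f holomorphic_on lower_half" "Im t < 0"
  shows "(\<lambda>n. minus_coeff r f n * w_coord (- t) ^ n) sums minus_fun r f t"
proof -
  have "Im (- t) > 0" using assms by simp
  then show ?thesis
    using taylor_sums[OF minus_fun_cayley_holomorphic[OF assms(1)] norm_w_coord_less, of "- t"]
      cayley_w_coord[OF upper_half_nz, of "- t"]
    by (simp add: minus_coeff_def)
qed

lemma plus_coeff_linear:
  assumes "g holomorphic_on upper_half" "h holomorphic_on upper_half"
  shows "plus_coeff r (\<lambda>z. a * g z + b * h z) n = a * plus_coeff r g n + b * plus_coeff r h n"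
  using taylor_linear[OF plus_fun_cayley_holomorphic[OF assms(1)]
      plus_fun_cayley_holomorphic[OF assms(2)] zero_less_one, of a r b r n]
  by (simp add: plus_coeff_def plus_fun_def algebra_simps)

lemma minus_coeff_linear:
  assumes "f holomorphic_on lower_half" "g holomorphic_on lower_half"
  shows "minus_coeff r (\<lambda>z. a * f z + b * g z) n = a * minus_coeff r f n + b * minus_coeff r g n"
  using taylor_linear[OF minus_fun_cayley_holomorphic[OF assms(1)]
      minus_fun_cayley_holomorphic[OF assms(2)] zero_less_one, of a r b r n]
  by (simp add: minus_coeff_def minus_fun_def algebra_simps)

text \<open>The extension of f^- across the real projective line in the single coordinate u. For R >
  1 the disc contains the whole line, including infinity at u = 1, so the two affine charts are no
  longer needed.\<close>

definition disc_extension :: "real \<Rightarrow> real \<Rightarrow> (complex \<Rightarrow> complex) \<Rightarrow> (complex \<Rightarrow> complex) \<Rightarrow> bool" where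
  "disc_extension r R f G \<longleftrightarrow> G holomorphic_on ball 0 R \<and>
     (\<forall>u. norm u < 1 \<longrightarrow> minus_fun r f (- cayley u) = G u)"

lemma minus_coeff_eq_taylor:
  assumes "disc_extension r R f G"
  shows "minus_coeff r f = taylor G"
  unfolding minus_coeff_def by (rule taylor_cong[of 1]) (use assms in \<open>auto simp: disc_extension_def\<close>)

lemma taylor_abs_summable:
  assumes "F holomorphic_on ball 0 R" "0 \<le> \<rho>" "\<rho> < R"
  shows "summable (\<lambda>n. norm (taylor F n) * \<rho> ^ n)"
proof -
  have x: "norm (complex_of_real ((\<rho> + R) / 2)) = (\<rho> + R) / 2"
    unfolding norm_of_real using assms by simp
  have "summable (\<lambda>n. taylor F n * (of_real ((\<rho> + R) / 2)) ^ n)"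
    by (rule sums_summable[OF taylor_sums[OF assms(1)]]) (use assms in \<open>simp only: x, simp\<close>)
  then have "summable (\<lambda>n. norm (taylor F n * (of_real \<rho>) ^ n))"
    by (rule powser_insidea) (use assms in \<open>simp only: x norm_of_real, simp\<close>)
  then show ?thesis using assms by (simp add: norm_mult norm_power)
qed

text \<open>Ratio test: the quotient of successive terms is (1 + 1/(n+1))^A q, which tends to q <
  1.\<close>

lemma summable_polynomial_geometric:
  fixes q :: real assumes "0 \<le> q" "q < 1"
  shows "summable (\<lambda>n. real (Suc n) ^ A * q ^ n)"
proof -
  obtain c where c: "q < c" "c < 1" using assms dense by blast
  have "(\<lambda>n. (1 + inverse (real (Suc n))) ^ A * q) \<longlonglongrightarrow> (1 + 0) ^ A * q"
    by (intro tendsto_intros LIMSEQ_inverse_real_of_nat)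
  then have "eventually (\<lambda>n. (1 + inverse (real (Suc n))) ^ A * q < c) sequentially"
    using c by (intro order_tendstoD) auto
  then obtain N where N: "\<And>n. n \<ge> N \<Longrightarrow> (1 + inverse (real (Suc n))) ^ A * q < c"
    by (auto simp: eventually_sequentially)
  show ?thesis
  proof (rule summable_ratio_test[OF c(2)])
    fix n assume n: "n \<ge> N"
    have "real (Suc (Suc n)) = (1 + inverse (real (Suc n))) * real (Suc n)"
      by (simp add: field_simps)
    then have "real (Suc (Suc n)) ^ A * q ^ Suc n = ((1 + inverse (real (Suc n))) ^ A * q) * (real (Suc n) ^ A * q ^ n)"
      by (simp only: power_mult_distrib power_Suc mult_ac)
    also have "\<dots> \<le> c * (real (Suc n) ^ A * q ^ n)"
      using N[OF n] assms by (intro mult_right_mono) auto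
    finally show "norm (real (Suc (Suc n)) ^ A * q ^ Suc n) \<le> c * norm (real (Suc n) ^ A * q ^ n)"
      using assms by (simp add: abs_mult)
  qed
qed

lemma summable_wt_geometric:
  assumes "0 \<le> q" "q < 1"
  shows "summable (\<lambda>n. norm (wt r n) * q ^ n)"
proof -
  obtain K A where K: "K > 0" "\<And>n. norm (wt r n) \<le> K * real (Suc n) ^ A"
    using wt_polynomial_bound by blast
  show ?thesis
  proof (rule summable_comparison_test')
    show "summable (\<lambda>n. K * (real (Suc n) ^ A * q ^ n))"
      by (intro summable_mult summable_polynomial_geometric assms)
    show "norm (norm (wt r n) * q ^ n) \<le> K * (real (Suc n) ^ A * q ^ n)" if "n \<ge> 0" for n
      using mult_right_mono[OF K(2), of "q ^ n" n] assms by (simp add: mult_ac)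
  qed
qed

text \<open>The weights grow polynomially, so passing to a slightly larger radius still below R
  absorbs them: multiplication by \<open>wt\<close> does not shrink the disc of convergence.\<close>

lemma taylor_wt_abs_summable:
  assumes "G holomorphic_on ball 0 R" "0 < \<rho>" "\<rho> < R"
  shows "summable (\<lambda>n. norm (wt r n * taylor G n) * \<rho> ^ n)"
proof -
  obtain \<rho>' where \<rho>': "\<rho> < \<rho>'" "\<rho>' < R" using assms dense by blast
  obtain M where M: "\<And>n. norm (taylor G n) \<le> M / \<rho>' ^ n"
    using taylor_geometric_bound[OF assms(1), of \<rho>'] \<rho>' assms by force
  show ?thesis
  proof (rule summable_comparison_test')
    show "summable (\<lambda>n. M * (norm (wt r n) * (\<rho> / \<rho>') ^ n))"
      using \<rho>' assms by (intro summable_mult summable_wt_geometric) auto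
    fix n :: nat
    have "norm (wt r n * taylor G n) * \<rho> ^ n \<le> norm (wt r n) * (M / \<rho>' ^ n) * \<rho> ^ n"
      using M assms unfolding norm_mult by (intro mult_right_mono mult_left_mono) auto
    then show "norm (norm (wt r n * taylor G n) * \<rho> ^ n) \<le> M * (norm (wt r n) * (\<rho> / \<rho>') ^ n)"
      using assms by (simp add: power_divide mult_ac)
  qed
qed

text \<open>The coefficients of h^+ are O(\<rho>'^n) for every \<rho>' > 1, while those of G remain
  summable after multiplication by \<rho>'^n as long as \<rho>' < R. An extension beyond the unit
  circle thus suffices for arbitrary holomorphic h.\<close>

lemma duality_sums:
  assumes "h holomorphic_on upper_half" "disc_extension r R f G" "R > 1"
  shows "(\<lambda>n. duality_term r h f n) sums duality r h f"
proof -
  obtain \<rho>' where \<rho>': "1 < \<rho>'" "\<rho>' < R" using assms dense by blast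
  have G: "G holomorphic_on ball 0 R" using assms(2) by (simp add: disc_extension_def)
  obtain M where M: "\<And>n. norm (plus_coeff r h n) \<le> M / (1 / \<rho>') ^ n"
    using taylor_geometric_bound[OF plus_fun_cayley_holomorphic[OF assms(1)], of "1 / \<rho>'"] \<rho>'
    unfolding plus_coeff_def by force
  have "summable (\<lambda>n. duality_term r h f n)"
  proof (rule summable_comparison_test')
    show "summable (\<lambda>n. M * (norm (wt r n * taylor G n) * \<rho>' ^ n))"
      using \<rho>' by (intro summable_mult taylor_wt_abs_summable[OF G]) auto
    fix n :: nat
    have "norm (wt r n * taylor G n) * norm (plus_coeff r h n) \<le> norm (wt r n * taylor G n) * (M / (1 / \<rho>') ^ n)"
      using M by (intro mult_left_mono) auto
    then show "norm (duality_term r h f n) \<le> M * (norm (wt r n * taylor G n) * \<rho>' ^ n)"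
      by (simp add: norm_mult power_divide mult_ac minus_coeff_eq_taylor[OF assms(2)])
  qed
  then show ?thesis unfolding duality_def by (rule summable_sums)
qed

text \<open>Because (1)_n = n!, the hypergeometric series is the sum of \<open>wt r n\<close> y^n.
  With y = w(tau)/w(z), integration over the circle multiplies the n-th coefficient of G by
  \<open>wt r n\<close> w(z)^(-n). This is the rule for the operator on powers of w, summed over the
  expansion of f^-.\<close>

lemma sigma_integral_eq:
  assumes c: "0 < c" "c < 1" and G: "G holomorphic_on ball 0 R" "1 / c < R"
    and g: "\<And>\<tau>. norm (\<tau> - \<i>) = c * norm (\<tau> + \<i>) \<Longrightarrow> g \<tau> = G (inverse (w_coord \<tau>))"
    and z: "z \<in> w_exterior c" "z + \<i> \<noteq> 0"
  shows "sigma_integral r c g z =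
    inverse (w_coord z) * (\<Sum>n. wt r n * taylor G n * inverse (w_coord z) ^ n)"
proof -
  define x where "x = inverse (w_coord z)"
  have zi: "z - \<i> \<noteq> 0"
  proof
    assume "z - \<i> = 0"
    with z c show False by (auto simp: w_exterior_def)
  qed
  have cx: "norm x < 1 / c"
    using z zi c by (simp add: x_def w_coord_def w_exterior_def norm_divide divide_simps mult_ac)
  have x0: "x \<noteq> 0" using zi z by (simp add: x_def w_coord_def)
  \<comment> \<open>The circle |w| = c has to lie where both series converge: |w| < \<rho> < 1/|x|
    for the hypergeometric series, |1/w| < \<rho>' < R for G.\<close>
  obtain \<rho> where \<rho>: "c < \<rho>" "\<rho> < 1 / norm x"
    using cx x0 c dense[of c "1 / norm x"] by (auto simp: divide_simps mult_ac split: if_splits)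
  obtain \<rho>' where \<rho>': "1 / c < \<rho>'" "\<rho>' < R" using G dense by blast
  have \<rho>'0: "0 < \<rho>'" using \<rho>' c by (meson divide_pos_pos less_trans zero_less_one)
  have \<rho>0: "0 < \<rho>" using \<rho> c by simp
  have "((\<lambda>\<tau>. (\<Sum>n. (wt r n * x ^ n) * w_coord \<tau> ^ n) * (\<Sum>n. taylor G n * inverse (w_coord \<tau>) ^ n) / (\<tau>\<^sup>2 + 1))
      has_contour_integral of_real pi * (\<Sum>n. (wt r n * x ^ n) * taylor G n)) (w_circle c)"
  proof (rule has_contour_integral_w_coord_series(2)[OF w_circle_facts[OF c] _ \<rho>0 \<rho>'0])
    show "path_image (w_circle c) \<subseteq> w_annulus \<rho> \<rho>'"
    proof
      fix \<tau> assume "\<tau> \<in> path_image (w_circle c)"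
      then have \<tau>: "norm (\<tau> - \<i>) = c * norm (\<tau> + \<i>)" by (simp add: path_image_w_circle[OF c])
      have nz: "norm (\<tau> + \<i>) > 0"
      proof (rule ccontr)
        assume "\<not> norm (\<tau> + \<i>) > 0"
        then have "\<tau> + \<i> = 0" "\<tau> - \<i> = 0" using \<tau> by auto
        then show False by (simp add: complex_eq_iff)
      qed
      have "1 < \<rho>' * c" using \<rho>' c by (simp add: divide_simps)
      then have "1 * norm (\<tau> + \<i>) < (\<rho>' * c) * norm (\<tau> + \<i>)" using nz by (rule mult_strict_right_mono)
      moreover have "c * norm (\<tau> + \<i>) < \<rho> * norm (\<tau> + \<i>)" using nz \<rho>(1) by simp
      ultimately show "\<tau> \<in> w_annulus \<rho> \<rho>'"
        using \<tau> by (simp add: mult_ac)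
    qed
    have "summable (\<lambda>n. norm (wt r n) * (\<rho> * norm x) ^ n)"
      using \<rho> \<rho>0 x0 by (intro summable_wt_geometric) (auto simp: field_simps)
    then show "summable (\<lambda>n. norm (wt r n * x ^ n) * \<rho> ^ n)"
      by (simp add: norm_mult norm_power power_mult_distrib mult_ac)
    show "summable (\<lambda>n. norm (taylor G n) * \<rho>' ^ n)"
      using \<rho>' \<rho>'0 by (intro taylor_abs_summable[OF G(1)]) auto
  qed
  then have "((\<lambda>\<tau>. g \<tau> *
       eval_fps (fps_hypergeo [1, 1] [of_real r] 1) (((\<tau> - \<i>) * (z + \<i>)) / ((\<tau> + \<i>) * (z - \<i>)))
       / (\<tau>\<^sup>2 + 1))
      has_contour_integral of_real pi * (\<Sum>n. (wt r n * x ^ n) * taylor G n)) (w_circle c)"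
  proof (rule has_contour_integral_eq)
    fix \<tau> assume "\<tau> \<in> path_image (w_circle c)"
    then have \<tau>: "norm (\<tau> - \<i>) = c * norm (\<tau> + \<i>)" by (simp add: path_image_w_circle[OF c])
    have "norm (inverse (w_coord \<tau>)) < R"
    proof (cases "w_coord \<tau> = 0")
      case True
      then show ?thesis using G(2) c by (simp add: less_trans[OF divide_pos_pos[OF zero_less_one c(1)]])
    next
      case False
      then show ?thesis using G(2) c \<tau> by (simp add: w_coord_def norm_divide)
    qed
    then have 1: "(\<Sum>n. taylor G n * inverse (w_coord \<tau>) ^ n) = g \<tau>"
      using taylor_sums[OF G(1)] g[OF \<tau>] by (simp add: sums_iff)
    have 2: "((\<tau> - \<i>) * (z + \<i>)) / ((\<tau> + \<i>) * (z - \<i>)) = x * w_coord \<tau>"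
      by (simp add: x_def w_coord_def mult.commute)
    \<comment> \<open>The coefficient (1)_n (1)_n / ((r)_n n!) collapses to n!/(r)_n.\<close>
    have 3: "eval_fps (fps_hypergeo [1, 1] [complex_of_real r] 1) y = (\<Sum>n. wt r n * y ^ n)" for y
      by (simp add: eval_fps_def wt_def pochhammer_fact[symmetric])
    show "(\<Sum>n. (wt r n * x ^ n) * w_coord \<tau> ^ n) * (\<Sum>n. taylor G n * inverse (w_coord \<tau>) ^ n) / (\<tau>\<^sup>2 + 1) =
      g \<tau> * eval_fps (fps_hypergeo [1, 1] [of_real r] 1) (((\<tau> - \<i>) * (z + \<i>)) / ((\<tau> + \<i>) * (z - \<i>))) / (\<tau>\<^sup>2 + 1)"
      unfolding 1 2 3 by (simp add: power_mult_distrib mult_ac)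
  qed
  then show ?thesis
    unfolding sigma_integral_def x_def[symmetric]
    by (simp add: contour_integral_unique x_def w_coord_def mult_ac)
qed

text \<open>Isolates what the generic and the exceptional weights share: s is 1/w times a power
  series in 1/w that converges beyond the cycle. The factor 1/w turns 1/(z+i)^2 into 1/(z^2+1), the
  measure for which the monomials are orthogonal.\<close>

lemma has_contour_integral_duality:
  assumes h: "h holomorphic_on upper_half" and C: "duality_cycle c C"
    and \<rho>': "\<rho>' > 0" "\<And>z. z \<in> path_image C \<Longrightarrow> norm (z + \<i>) < \<rho>' * norm (z - \<i>)"
    and e: "summable (\<lambda>n. norm (e n) * \<rho>' ^ n)"
    and s: "\<And>z. z \<in> path_image C \<Longrightarrow> s z = inverse (w_coord z) * (\<Sum>n. e n * inverse (w_coord z) ^ n)"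
  shows "(duality_integrand r h s has_contour_integral (\<Sum>n. plus_coeff r h n * e n)) C"
proof -
  have C': "valid_path C" "pathfinish C = pathstart C" "winding_number C \<i> = 1" "path_image C \<subseteq> upper_half"
    using C by (auto simp: duality_cycle_def)
  have "convex upper_half" using convex_halfspace_Im_gt[of 0] by simp
  then have wm: "winding_number C (- \<i>) = 0"
    using C' by (intro winding_number_zero_outside[of _ upper_half] valid_path_imp_path) auto
  \<comment> \<open>The maximum of |w| on the compact cycle is attained and is therefore below 1,
    which leaves room for \<rho>.\<close>
  have "continuous_on (path_image C) (\<lambda>z. norm (w_coord z))"
    using C'(4) upper_half_nz unfolding w_coord_def by (intro continuous_intros) auto
  then obtain z0 where z0: "z0 \<in> path_image C" "\<And>z. z \<in> path_image C \<Longrightarrow> norm (w_coord z) \<le> norm (w_coord z0)"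
    using continuous_attains_sup[OF compact_valid_path_image[OF C'(1)], of "\<lambda>z. norm (w_coord z)"]
    by (auto simp: path_image_nonempty)
  have "norm (w_coord z0) < 1" using z0 C' by (intro norm_w_coord_less) auto
  then obtain \<rho> where \<rho>: "norm (w_coord z0) < \<rho>" "\<rho> < 1" using dense by blast
  have \<rho>0: "0 < \<rho>" using \<rho> norm_ge_zero le_less_trans by blast
  have im: "path_image C \<subseteq> w_annulus \<rho> \<rho>'"
  proof
    fix z assume z: "z \<in> path_image C"
    then have "norm (w_coord z) < \<rho>" using z0 \<rho> by force
    then have "norm (z - \<i>) < \<rho> * norm (z + \<i>)"
      using upper_half_nz[of z] z C'(4) by (auto simp: w_coord_def norm_divide divide_simps split: if_splits)
    then show "z \<in> w_annulus \<rho> \<rho>'"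
      using \<rho>'(2)[OF z] by simp
  qed
  have a: "summable (\<lambda>n. norm (plus_coeff r h n) * \<rho> ^ n)"
    using \<rho> \<rho>0 unfolding plus_coeff_def
    by (intro taylor_abs_summable[OF plus_fun_cayley_holomorphic[OF h]]) auto
  have "((\<lambda>z. 1 / of_real pi * ((\<Sum>n. plus_coeff r h n * w_coord z ^ n) * (\<Sum>n. e n * inverse (w_coord z) ^ n) / (z\<^sup>2 + 1)))
     has_contour_integral 1 / of_real pi * (of_real pi * (\<Sum>n. plus_coeff r h n * e n))) C"
    by (intro has_contour_integral_lmul
      has_contour_integral_w_coord_series(2)[OF C'(1-3) wm im \<rho>0 \<rho>'(1) a e])
  also have "1 / complex_of_real pi * (of_real pi * (\<Sum>n. plus_coeff r h n * e n)) = (\<Sum>n. plus_coeff r h n * e n)"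
    by simp
  finally show ?thesis
  proof (rule has_contour_integral_eq)
    fix z assume z: "z \<in> path_image C"
    then have up: "Im z > 0" using C'(4) by auto
    have nz: "z + \<i> \<noteq> 0" "z - \<i> \<noteq> 0" using upper_half_nz[OF up] \<rho>'(2)[OF z] by auto
    have 1: "(\<Sum>n. plus_coeff r h n * w_coord z ^ n) = plus_fun r h z"
      using plus_coeff_sums[OF h up] by (simp add: sums_iff)
    have "inverse (w_coord z) * X / (z + \<i>)\<^sup>2 = X / (z\<^sup>2 + 1)" for X
      unfolding square_plus_one using nz by (simp add: w_coord_def power2_eq_square)
    then have "P * (inverse (w_coord z) * X) / (z + \<i>)\<^sup>2 = P * X / (z\<^sup>2 + 1)" for P X
      by (metis mult.left_commute times_divide_eq_right)
    then show "1 / of_real pi * ((\<Sum>n. plus_coeff r h n * w_coord z ^ n) * (\<Sum>n. e n * inverse (w_coord z) ^ n) / (z\<^sup>2 + 1))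
        = duality_integrand r h s z"
      unfolding duality_integrand_def 1 s[OF z] by simp
  qed
qed

text \<open>Cauchy's theorem on the convex upper half-plane, where the pole -i of the remaining
  factor is absent.\<close>

lemma duality_integrand_holomorphic_part:
  assumes "h holomorphic_on upper_half" "\<phi> holomorphic_on upper_half" "duality_cycle c C"
  shows "(duality_integrand r h \<phi> has_contour_integral 0) C"
proof (rule Cauchy_theorem_convex_simple)
  show "duality_integrand r h \<phi> holomorphic_on upper_half"
    unfolding duality_integrand_def using upper_half_nz
    by (intro holomorphic_intros plus_fun_holomorphic assms) auto
  show "convex upper_half" using convex_halfspace_Im_gt[of 0] by simp
qed (use assms in \<open>auto simp: duality_cycle_def\<close>)

subsection \<open>Extensions across the real projective line\<close>

text \<open>The chart 1/t at infinity in terms of u. It is regular at u = 1, the point where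
  \<open>cayley\<close> has its pole, and takes the value 0 there.\<close>

definition cocayley :: "complex \<Rightarrow> complex" where
  "cocayley u = \<i> * (1 - u) / (1 + u)"

text \<open>At u = 1 and u = -1 both sides are 0, by the conventions for division by 0.\<close>

lemma cocayley_eq: "1 / (- cayley u) = cocayley u"
proof -
  have "1 / (- cayley u) = - ((1 - u) / (\<i> * (1 + u)))" by (simp add: cayley_def)
  also have "\<dots> = (- inverse \<i>) * ((1 - u) / (1 + u))"
    by (simp only: divide_inverse inverse_mult_distrib minus_mult_left minus_mult_right mult_ac)
  finally show ?thesis by (simp add: cocayley_def)
qed

lemma cayley_eq_0_iff: "u \<noteq> 1 \<Longrightarrow> cayley u = 0 \<longleftrightarrow> u = -1"
  by (auto simp: cayley_def add_eq_0_iff)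

lemma cocayley_holomorphic: "cocayley holomorphic_on - {-1}"
  unfolding cocayley_def by (intro holomorphic_intros) (auto simp: add_eq_0_iff)

lemma uminus_cayley_holomorphic: "(\<lambda>u. - cayley u) holomorphic_on - {1}"
  by (intro holomorphic_intros) auto

lemma open_chart:
  "open U \<Longrightarrow> open (- {1} \<inter> (\<lambda>u. - cayley u) -` U)" "open V \<Longrightarrow> open (- {-1} \<inter> cocayley -` V)"
  by (auto intro!: continuous_open_preimage holomorphic_on_imp_continuous_on cocayley_holomorphic uminus_cayley_holomorphic)

text \<open>The substitution \<open>u = 1 / w\<close> turns the two charts at infinity into a single function
  on a neighbourhood of the closed unit disc.\<close>
lemma extension_P1_glue:
  assumes "extension_P1 P F U g"
  obtains G V k where "open V" "0 \<in> V" "P k V"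
    "\<And>u. u \<noteq> 1 \<Longrightarrow> - cayley u \<in> U \<Longrightarrow> G u = g (- cayley u)"
    "\<And>u. u \<noteq> -1 \<Longrightarrow> cocayley u \<in> V \<Longrightarrow> G u = k (cocayley u)"
proof -
  obtain V k where Vk: "open V" "0 \<in> V" "P k V" "\<And>z. z \<in> U \<Longrightarrow> z \<noteq> 0 \<Longrightarrow> 1 / z \<in> V \<Longrightarrow> g z = k (1 / z)"
    using assms unfolding extension_P1_def by blast
  define G where "G = (\<lambda>u. if u \<noteq> 1 \<and> - cayley u \<in> U then g (- cayley u) else k (cocayley u))"
  show ?thesis
  proof
    show "G u = k (cocayley u)" if "u \<noteq> -1" "cocayley u \<in> V" for u
      using that Vk(4)[of "- cayley u"] cayley_eq_0_iff[of u] unfolding cocayley_eq by (auto simp: G_def)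
  qed (use Vk in \<open>auto simp: G_def\<close>)
qed

lemma open_superset_of_cball:
  fixes W :: "complex set"
  assumes "open W" "cball 0 a \<subseteq> W" "a \<ge> 0"
  obtains R where "R > a" "ball 0 R \<subseteq> W"
proof -
  obtain e where e: "e > 0" "(\<Union>x\<in>cball 0 a. ball x e) \<subseteq> W"
    using compact_subset_open_imp_ball_epsilon_subset[OF compact_cball assms(1,2)] by blast
  have "ball 0 (a + e) \<subseteq> W"
  proof
    fix u :: complex assume u: "u \<in> ball 0 (a + e)"
    show "u \<in> W"
    proof (cases "norm u \<le> a")
      case True then show ?thesis using assms by auto
    next
      case False
      \<comment> \<open>The radial projection of u to the circle of radius a, at distance |u| - a
        from u.\<close>
      define x where "x = of_real (a / norm u) * u"
      have "norm x = a / norm u * norm u" unfolding x_def norm_mult norm_of_real using assms(3) by simp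
      then have "norm x = a" using False assms(3) by auto
      moreover have "x - u = of_real (a / norm u - 1) * u" by (simp add: x_def algebra_simps)
      then have "dist x u = \<bar>a / norm u - 1\<bar> * norm u" unfolding dist_norm by (simp only: norm_mult norm_of_real)
      then have "dist x u = norm u - a" using False assms(3) by (auto simp: divide_simps abs_if algebra_simps split: if_splits)
      then have "dist x u < e" using u by simp
      ultimately show ?thesis using e(2) by force
    qed
  qed
  then show ?thesis using that[of "a + e"] e(1) by simp
qed

lemma cayley_minus_i: "u \<noteq> 1 \<Longrightarrow> cayley u - \<i> = 2 * \<i> * u / (1 - u)"
  and cayley_plus_i: "u \<noteq> 1 \<Longrightarrow> cayley u + \<i> = 2 * \<i> / (1 - u)"
  by (simp_all add: cayley_def divide_simps) (simp_all add: algebra_simps)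

lemma extension_P1_holomorphic_disc:
  assumes ext: "extension_P1 (holomorphic_on) (minus_fun r f) U g" and c: "0 < c" "c \<le> 1"
    and U: "{z. c * norm (z + \<i>) \<le> norm (z - \<i>)} \<subseteq> U"
  obtains R G where "R > 1 / c" "disc_extension r R f G"
    "\<And>u. u \<noteq> 1 \<Longrightarrow> norm u \<le> 1 / c \<Longrightarrow> G u = g (- cayley u)"
proof -
  obtain G V k where G: "open V" "0 \<in> V" "k holomorphic_on V"
    "\<And>u. u \<noteq> 1 \<Longrightarrow> - cayley u \<in> U \<Longrightarrow> G u = g (- cayley u)"
    "\<And>u. u \<noteq> -1 \<Longrightarrow> cocayley u \<in> V \<Longrightarrow> G u = k (cocayley u)"
    using extension_P1_glue[OF ext] by metis
  have U': "open U" "g holomorphic_on U" and gf: "\<And>t. Im t < 0 \<Longrightarrow> g t = minus_fun r f t"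
    using ext by (auto simp: extension_P1_def)
  define W1 where "W1 = - {1} \<inter> (\<lambda>u. - cayley u) -` U"
  define W2 where "W2 = - {-1} \<inter> cocayley -` V"
  have "open W1" "open W2" unfolding W1_def W2_def using open_chart U'(1) G(1) by auto
  have "(g \<circ> (\<lambda>u. - cayley u)) holomorphic_on W1"
    by (rule holomorphic_on_compose_gen[OF holomorphic_on_subset[OF uminus_cayley_holomorphic] U'(2)]) (auto simp: W1_def)
  then have G1: "G holomorphic_on W1"
    by (rule holomorphic_transform) (simp add: W1_def G(4))
  have "(k \<circ> cocayley) holomorphic_on W2"
    by (rule holomorphic_on_compose_gen[OF holomorphic_on_subset[OF cocayley_holomorphic] G(3)]) (auto simp: W2_def)
  then have G2: "G holomorphic_on W2"
    by (rule holomorphic_transform) (simp add: W2_def G(5))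
  have GW: "G holomorphic_on W1 \<union> W2"
    using G1 G2 \<open>open W1\<close> \<open>open W2\<close> by (rule holomorphic_on_Un)
  have inU: "- cayley u \<in> U" if "u \<noteq> 1" "norm u \<le> 1 / c" for u
  proof -
    have 1: "- cayley u + \<i> = - (cayley u - \<i>)" "- cayley u - \<i> = - (cayley u + \<i>)" by simp_all
    have "c * norm u \<le> 1" using that c by (simp add: field_simps)
    then have "c * norm (- cayley u + \<i>) \<le> norm (- cayley u - \<i>)"
      unfolding 1 norm_minus_cancel cayley_minus_i[OF that(1)] cayley_plus_i[OF that(1)]
      using that(1) by (simp add: norm_divide norm_mult divide_simps mult_ac)
    then show ?thesis using U by blast
  qed
  have "cball 0 (1 / c) \<subseteq> W1 \<union> W2"
  proof
    fix u :: complex assume u: "u \<in> cball 0 (1 / c)"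
    show "u \<in> W1 \<union> W2"
    proof (cases "u = 1")
      case True then show ?thesis using G(2) by (simp add: W2_def cocayley_def)
    next
      case False
      then show ?thesis using inU[of u] u by (simp add: W1_def)
    qed
  qed
  then obtain R where R: "R > 1 / c" "ball 0 R \<subseteq> W1 \<union> W2"
    using open_superset_of_cball[of "W1 \<union> W2" "1 / c"] \<open>open W1\<close> \<open>open W2\<close> c by auto
  show ?thesis
  proof
    show "R > 1 / c" by fact
    show G': "G u = g (- cayley u)" if "u \<noteq> 1" "norm u \<le> 1 / c" for u
      using G(4) inU that by blast
    show "disc_extension r R f G"
      unfolding disc_extension_def
    proof safe
      show "G holomorphic_on ball 0 R" by (rule holomorphic_on_subset[OF GW R(2)])
      fix u :: complex assume u: "norm u < 1"
      have "1 \<le> 1 / c" using c by simp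
      with u have "u \<noteq> 1" "norm u \<le> 1 / c" by auto
      then show "minus_fun r f (- cayley u) = G u"
        using G'[of u] gf[of "- cayley u"] cayley_upper[OF u] by simp
    qed
  qed
qed

text \<open>The case c = 1, in which the required region |w| >= 1 is the closed lower
  half-plane.\<close>

lemma D_minus_omega_disc_extension:
  assumes "f \<in> D_minus_omega r"
  obtains R G where "R > 1" "disc_extension r R f G"
proof -
  obtain U g where ext: "extension_P1 (holomorphic_on) (minus_fun r f) U g"
    using assms by (auto simp: D_minus_omega_def)
  have "{z. 1 * norm (z + \<i>) \<le> norm (z - \<i>)} \<subseteq> {t. Im t \<le> 0}"
  proof
    fix z assume "z \<in> {z. 1 * norm (z + \<i>) \<le> norm (z - \<i>)}"
    then have "(norm (z + \<i>))\<^sup>2 \<le> (norm (z - \<i>))\<^sup>2" by (simp add: power_mono)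
    then show "z \<in> {t. Im t \<le> 0}"
      unfolding cmod_power2 by (simp add: power2_eq_square algebra_simps)
  qed
  also have "\<dots> \<subseteq> U" using ext by (simp add: extension_P1_def)
  finally show ?thesis
    using extension_P1_holomorphic_disc[OF ext, of 1] that by fastforce
qed

lemma D_minus_omega_holomorphic: "f \<in> D_minus_omega r \<Longrightarrow> f holomorphic_on lower_half"
  by (simp add: D_minus_omega_def)

section \<open>Polynomial functions in the exceptional weights\<close>

lemma taylor_poly: "taylor (poly Q) = coeff Q"
proof -
  have "coeff Q = taylor (poly Q)"
  proof (rule taylor_unique[of 1])
    fix w :: complex
    have "(\<lambda>n. coeff Q n * w ^ n) sums (\<Sum>n\<le>degree Q. coeff Q n * w ^ n)"
      by (rule sums_finite) (auto simp: coeff_eq_0)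
    then show "(\<lambda>n. coeff Q n * w ^ n) sums poly Q w" by (simp add: poly_altdef)
  qed simp
  then show ?thesis by simp
qed

text \<open>Q is the degree N homogenization of q, evaluated at the pair (p2, p1) of polynomials of
  degree at most 1. In weight -N this describes the Cayley transform, the action of the group and
  the basis functions alike.\<close>

lemma homogenize_poly:
  fixes q p1 p2 :: "complex poly"
  assumes "degree q \<le> N" "degree p1 \<le> 1" "degree p2 \<le> 1"
  obtains Q where "degree Q \<le> N"
    "\<And>u. poly p1 u \<noteq> 0 \<Longrightarrow> poly Q u = poly p1 u ^ N * poly q (poly p2 u / poly p1 u)"
proof
  let ?Q = "\<Sum>j\<le>degree q. smult (coeff q j) (p1 ^ (N - j) * p2 ^ j)"
  show "degree ?Q \<le> N"
  proof (rule degree_sum_le)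
    fix j assume "j \<in> {..degree q}"
    then have j: "j \<le> N" using assms by simp
    have "degree (smult (coeff q j) (p1 ^ (N - j) * p2 ^ j)) \<le> degree (p1 ^ (N - j)) + degree (p2 ^ j)"
      by (rule order_trans[OF degree_smult_le degree_mult_le])
    also have "\<dots> \<le> degree p1 * (N - j) + degree p2 * j" by (intro add_mono degree_power_le)
    also have "\<dots> \<le> 1 * (N - j) + 1 * j" using assms by (intro add_mono mult_right_mono) auto
    finally show "degree (smult (coeff q j) (p1 ^ (N - j) * p2 ^ j)) \<le> N" using j by simp
  qed simp
  fix u :: complex assume u: "poly p1 u \<noteq> 0"
  have "poly p1 u ^ N * (poly p2 u / poly p1 u) ^ j = poly p1 u ^ (N - j) * poly p2 u ^ j" if "j \<le> N" for j
  proof -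
    have "poly p1 u ^ N = poly p1 u ^ (N - j) * poly p1 u ^ j" using that by (simp flip: power_add)
    then show ?thesis using u by (simp add: power_divide)
  qed
  then show "poly ?Q u = poly p1 u ^ N * poly q (poly p2 u / poly p1 u)"
    using assms by (auto simp: poly_sum poly_altdef[of q] sum_distrib_left mult.left_commute[of _ "coeff q _"] intro!: sum.cong)
qed

lemma powr_of_minus_nat:
  assumes "(z::complex) \<noteq> 0" shows "z powr of_real (- real N) = inverse z ^ N"
  using assms powr_nat[of z N] by (simp add: powr_minus power_inverse)

lemma minus_fun_cayley:
  assumes "norm u < 1"
  shows "minus_fun r f (- cayley u) = (2 * \<i> / (1 - u)) powr of_real r * f (- cayley u)"
proof -
  have "u \<noteq> 1" using assms by auto
  then show ?thesis unfolding minus_fun_def using cayley_plus_i[of u] by (simp add: add.commute)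
qed

text \<open>For t = \<open>- cayley u\<close> one has i - t = 2i/(1-u), so (i-t)^(-N) contributes
  (1-u)^N, which clears the pole of q(t) at u = 1. Hence f^- is a polynomial in u and extends to
  every disc.\<close>

lemma D_minus_pol_disc_extension:
  assumes "f \<in> D_minus_pol r" "r = - real N"
  obtains Q where "degree Q \<le> N" "\<And>R. disc_extension r R f (poly Q)"
proof -
  obtain q where q: "degree q \<le> N" "\<And>t. Im t < 0 \<Longrightarrow> f t = poly q t"
    using assms by (auto simp: D_minus_pol_def)
  obtain Q where "degree Q \<le> N" "\<And>u. poly [:1, -1:] u \<noteq> 0 \<Longrightarrow>
      poly Q u = poly [:1, -1:] u ^ N * poly q (poly [:- \<i>, - \<i>:] u / poly [:1, -1:] u)"
    by (rule homogenize_poly[OF q(1), of "[:1, -1:]" "[:- \<i>, - \<i>:]"]) auto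
  then have Q: "degree Q \<le> N" "\<And>u. u \<noteq> 1 \<Longrightarrow> poly Q u = (1 - u) ^ N * poly q (- cayley u)"
    by (simp_all add: cayley_def algebra_simps minus_divide_left)
  show ?thesis
  proof
    let ?Q = "smult (inverse (2 * \<i>) ^ N) Q"
    show "degree ?Q \<le> N" using Q(1) degree_smult_le order_trans by blast
    fix R
    show "disc_extension r R f (poly ?Q)"
      unfolding disc_extension_def
    proof safe
      fix u :: complex assume u: "norm u < 1"
      then have "u \<noteq> 1" by auto
      then have "(2 * \<i> / (1 - u)) powr of_real r = inverse (2 * \<i> / (1 - u)) ^ N"
        unfolding assms(2) by (intro powr_of_minus_nat) auto
      also have "\<dots> = (1 - u) ^ N * inverse (2 * \<i>) ^ N"
        unfolding inverse_divide power_divide by (simp only: divide_inverse power_inverse)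
      finally show "minus_fun r f (- cayley u) = poly ?Q u"
        unfolding minus_fun_cayley[OF u] using Q(2)[OF \<open>u \<noteq> 1\<close>] q(2)[of "- cayley u"] cayley_upper[OF u]
        by (simp add: mult_ac)
    qed (intro holomorphic_intros)
  qed
qed

lemma D_minus_pol_holomorphic:
  assumes "f \<in> D_minus_pol r" shows "f holomorphic_on lower_half"
proof -
  obtain q where q: "\<And>t. Im t < 0 \<Longrightarrow> f t = poly q t"
    using assms by (auto simp: D_minus_pol_def)
  have "poly q holomorphic_on lower_half" by (intro holomorphic_intros)
  then show ?thesis by (rule holomorphic_transform) (simp add: q)
qed

text \<open>Here -i - \<open>cayley u\<close> = -2i/(1-u), and the same cancellation makes h^+ a
  polynomial of degree at most N in w.\<close>

lemma D_plus_pol_coeff: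
  assumes "h \<in> D_plus_pol r" "r = - real N" "n > N"
  shows "plus_coeff r h n = 0"
proof -
  obtain q where q: "degree q \<le> N" "\<And>t. Im t > 0 \<Longrightarrow> h t = poly q t"
    using assms by (auto simp: D_plus_pol_def)
  obtain Q where "degree Q \<le> N" "\<And>u. poly [:1, -1:] u \<noteq> 0 \<Longrightarrow>
      poly Q u = poly [:1, -1:] u ^ N * poly q (poly [:\<i>, \<i>:] u / poly [:1, -1:] u)"
    by (rule homogenize_poly[OF q(1), of "[:1, -1:]" "[:\<i>, \<i>:]"]) auto
  then have Q: "degree Q \<le> N" "\<And>u. u \<noteq> 1 \<Longrightarrow> poly Q u = (1 - u) ^ N * poly q (cayley u)"
    by (simp_all add: cayley_def algebra_simps)
  let ?Q = "smult (inverse (- 2 * \<i>) ^ N) Q"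
  have "plus_coeff r h = taylor (poly ?Q)"
    unfolding plus_coeff_def
  proof (rule taylor_cong[of 1])
    fix u :: complex assume u: "norm u < 1"
    then have "u \<noteq> 1" by auto
    have "- \<i> - cayley u = - 2 * \<i> / (1 - u)"
      using arg_cong[OF cayley_plus_i[OF \<open>u \<noteq> 1\<close>], of uminus] by (simp add: algebra_simps)
    then have "plus_fun r h (cayley u) = (- 2 * \<i> / (1 - u)) powr of_real r * h (cayley u)"
      unfolding plus_fun_def by simp
    also have "(- 2 * \<i> / (1 - u)) powr of_real r = inverse (- 2 * \<i> / (1 - u)) ^ N"
      unfolding assms(2) using \<open>u \<noteq> 1\<close> by (intro powr_of_minus_nat) auto
    also have "\<dots> = (1 - u) ^ N * inverse (- 2 * \<i>) ^ N"
      unfolding inverse_divide power_divide by (simp only: divide_inverse power_inverse)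
    finally show "plus_fun r h (cayley u) = poly ?Q u"
      using Q(2)[OF \<open>u \<noteq> 1\<close>] q(2)[of "cayley u"] cayley_upper[OF u]
      by (simp add: mult_ac)
  qed simp
  then show ?thesis
    using assms(3) Q(1) by (simp add: taylor_poly coeff_eq_0)
qed

lemma sum_nonpos_int_reindex:
  fixes F :: "int \<Rightarrow> complex"
  shows "(\<Sum>n\<in>{- int N..0}. F n) = (\<Sum>n\<le>N. F (- int n))"
  by (rule sum.reindex_bij_witness[of _ "\<lambda>n. - int n" "\<lambda>n. nat (- n)"]) auto

text \<open>Both descriptions of the operator lead to the series 1/w times the sum of
  \<open>wt r n * minus_coeff r f n\<close> w^(-n): the hypergeometric integral for generic r, the
  prescribed finite sum for r = -N. As the value is \<open>duality\<close>, it depends neither on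
  the circle and the extension nor on the cycle.\<close>

lemma has_contour_integral_duality_sigma:
  assumes h: "h holomorphic_on upper_half" and s: "is_sigma r f c s" and C: "duality_cycle c C"
  shows "(duality_integrand r h s has_contour_integral duality r h f) C"
proof (cases "r \<in> \<int>\<^sub>\<le>\<^sub>0")
  case False
  obtain U g where c: "0 < c" "c < 1" and ext: "extension_P1 (holomorphic_on) (minus_fun r f) U g" and
    U: "{z. c * norm (z + \<i>) \<le> norm (z - \<i>)} \<subseteq> U" and s: "\<And>z. z \<in> w_exterior c \<Longrightarrow> s z = sigma_integral r c g z"
    using s False unfolding is_sigma_def by auto
  obtain R G where R: "R > 1 / c" and f: "disc_extension r R f G" and
    G: "\<And>u. u \<noteq> 1 \<Longrightarrow> norm u \<le> 1 / c \<Longrightarrow> G u = g (- cayley u)"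
    using extension_P1_holomorphic_disc[OF ext c(1) less_imp_le[OF c(2)] U] by blast
  have Gh: "G holomorphic_on ball 0 R" using f by (simp add: disc_extension_def)
  have "(duality_integrand r h s has_contour_integral (\<Sum>n. plus_coeff r h n * (wt r n * taylor G n))) C"
  proof (rule has_contour_integral_duality[OF h C, of "1 / c"])
    show "summable (\<lambda>n. norm (wt r n * taylor G n) * (1 / c) ^ n)"
      using R c by (intro taylor_wt_abs_summable[OF Gh]) auto
    fix z assume z: "z \<in> path_image C"
    then have z': "Im z > 0" "z \<in> w_exterior c" using C by (auto simp: duality_cycle_def)
    show "norm (z + \<i>) < 1 / c * norm (z - \<i>)"
      using z'(2) c by (simp add: w_exterior_def field_simps)
    show "s z = inverse (w_coord z) * (\<Sum>n. wt r n * taylor G n * inverse (w_coord z) ^ n)"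
      unfolding s[OF z'(2)]
    proof (rule sigma_integral_eq[OF c Gh R _ z'(2) upper_half_nz[OF z'(1)]])
      fix \<tau> assume \<tau>: "norm (\<tau> - \<i>) = c * norm (\<tau> + \<i>)"
      have nz: "\<tau> - \<i> \<noteq> 0" "\<tau> + \<i> \<noteq> 0"
      proof -
        have "\<tau> - \<i> = 0 \<longleftrightarrow> \<tau> + \<i> = 0"
          using \<tau> c by (metis mult_eq_0_iff norm_eq_zero less_irrefl)
        then show "\<tau> - \<i> \<noteq> 0" "\<tau> + \<i> \<noteq> 0" by (auto simp: complex_eq_iff)
      qed
      have "- \<tau> + \<i> \<noteq> 0" using nz(1) by (simp add: algebra_simps)
      then have "- cayley (inverse (w_coord \<tau>)) = \<tau>"
        using cayley_w_coord[of "- \<tau>"] by (simp add: w_coord_minus)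
      moreover have "norm (inverse (w_coord \<tau>)) = 1 / c"
        using \<tau> nz c by (simp add: w_coord_def norm_divide)
      moreover have "w_coord \<tau> \<noteq> 1"
        using nz by (simp add: w_coord_def)
      ultimately show "g \<tau> = G (inverse (w_coord \<tau>))"
        using G[of "inverse (w_coord \<tau>)"] by simp
    qed
  qed (use c in simp)
  then show ?thesis
    by (simp add: duality_def minus_coeff_eq_taylor[OF f] mult_ac)
next
  case True
  then obtain N where N: "r = - real N" by (auto elim!: nonpos_Ints_cases')
  have cr: "\<lceil>r\<rceil> = - int N" unfolding N by linarith
  obtain d where c: "c = 0" and
    d: "\<And>t. Im t < 0 \<Longrightarrow> minus_fun r f t = (\<Sum>n\<le>N. d (- int n) * w_coord t powi (- int n))" and
    s: "\<And>z. z \<in> w_exterior c \<Longrightarrow> s z = (\<Sum>n\<le>N. d (- int n) * (wt r n * w_coord z powi (- int n - 1)))"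
    using s True unfolding is_sigma_def cr sum_nonpos_int_reindex by (auto simp: wt_def)
  have m: "minus_coeff r f = (\<lambda>n. if n \<le> N then d (- int n) else 0)"
    unfolding minus_coeff_def
  proof (rule taylor_unique[symmetric, of 1])
    fix u :: complex assume u: "norm u < 1"
    then have "u \<noteq> 1" by auto
    have "(\<lambda>n. (if n \<le> N then d (- int n) else 0) * u ^ n) sums
      (\<Sum>n\<le>N. (if n \<le> N then d (- int n) else 0) * u ^ n)"
      by (rule sums_finite) auto
    then show "(\<lambda>n. (if n \<le> N then d (- int n) else 0) * u ^ n) sums minus_fun r f (- cayley u)"
      using cayley_upper[OF u] w_coord_cayley[OF \<open>u \<noteq> 1\<close>] by (simp add: d w_coord_powi_lower)
  qed simp
  have "continuous_on (path_image C) (\<lambda>z. norm ((z + \<i>) / (z - \<i>)))"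
    using C by (intro continuous_intros) (auto simp: duality_cycle_def w_exterior_def c)
  moreover have "compact (path_image C)" using C by (intro compact_valid_path_image) (simp add: duality_cycle_def)
  ultimately obtain M where M: "\<And>z. z \<in> path_image C \<Longrightarrow> norm ((z + \<i>) / (z - \<i>)) \<le> M"
    using continuous_attains_sup[of "path_image C" "\<lambda>z. norm ((z + \<i>) / (z - \<i>))"] by (auto simp: path_image_nonempty)
  \<comment> \<open>The coefficients vanish beyond N, so every radius is admissible; only a strict
    bound for |1/w| on the compact cycle, which avoids i, is wanted.\<close>
  define \<rho>' where "\<rho>' = \<bar>M\<bar> + 1"
  have "(duality_integrand r h s has_contour_integral (\<Sum>n. plus_coeff r h n * (wt r n * minus_coeff r f n))) C"
  proof (rule has_contour_integral_duality[OF h C, of \<rho>'])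
    show "\<rho>' > 0" by (simp add: \<rho>'_def)
    show "summable (\<lambda>n. norm (wt r n * minus_coeff r f n) * \<rho>' ^ n)"
      by (rule summable_finite[of "{..N}"]) (auto simp: m)
    fix z assume z: "z \<in> path_image C"
    then have z': "Im z > 0" "z \<in> w_exterior c" using C by (auto simp: duality_cycle_def)
    have nz: "z - \<i> \<noteq> 0" using z'(2) c by (auto simp: w_exterior_def)
    have "norm ((z + \<i>) / (z - \<i>)) < \<rho>'" using M[OF z] by (simp add: \<rho>'_def)
    then show "norm (z + \<i>) < \<rho>' * norm (z - \<i>)" using nz by (simp add: norm_divide field_simps)
    have "w_coord z \<noteq> 0" using nz upper_half_nz[OF z'(1)] by (simp add: w_coord_def)
    then have "s z = (\<Sum>n\<le>N. inverse (w_coord z) * (wt r n * minus_coeff r f n * inverse (w_coord z) ^ n))"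
      unfolding s[OF z'(2)] by (intro sum.cong) (auto simp: m power_int_diff power_int_minus power_inverse divide_inverse mult_ac)
    also have "\<dots> = inverse (w_coord z) * (\<Sum>n\<le>N. wt r n * minus_coeff r f n * inverse (w_coord z) ^ n)"
      by (simp add: sum_distrib_left)
    also have "(\<Sum>n\<le>N. wt r n * minus_coeff r f n * inverse (w_coord z) ^ n) =
      (\<Sum>n. wt r n * minus_coeff r f n * inverse (w_coord z) ^ n)"
      by (rule suminf_finite[symmetric]) (auto simp: m)
    finally show "s z = inverse (w_coord z) * (\<Sum>n. wt r n * minus_coeff r f n * inverse (w_coord z) ^ n)" .
  qed
  then show ?thesis by (simp add: duality_def mult_ac)
qed

subsection \<open>Kernels and density\<close>

text \<open>Fixes the branch in identities between sums of logarithms.\<close>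
lemma exp_eq_1_small:
  assumes "exp X = 1" "\<bar>Im X\<bar> < 2 * pi" shows "X = 0"
proof -
  obtain n :: int where n: "Re X = 0" "Im X = of_int (2 * n) * pi"
    using assms(1) exp_eq_1 by blast
  have "\<bar>of_int (2 * n)\<bar> * pi < 2 * pi" using assms(2) n(2) by (simp add: abs_mult)
  then have "\<bar>of_int (2 * n) :: real\<bar> < 2" by simp
  then have "n = 0" by linarith
  then show ?thesis using n by (simp add: complex_eq_iff)
qed

lemma Im_Ln_neg_lt_imp:
  assumes "Im x < 0" shows "- pi < Im (Ln x) \<and> Im (Ln x) < 0"
proof -
  have "x \<noteq> 0" using assms by auto
  then show ?thesis
    using Im_Ln_pos_le[of x] mpi_less_Im_Ln[of x] Im_Ln_le_pi[of x] assms by linarith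
qed

definition pole_kernel :: "real \<Rightarrow> complex \<Rightarrow> complex \<Rightarrow> complex" where
  "pole_kernel r t z = (t - z) powr of_real (- r)"

lemma kernel_holomorphic: "Im t < 0 \<Longrightarrow> pole_kernel r t holomorphic_on upper_half"
  unfolding pole_kernel_def by (intro holomorphic_intros) (auto simp: complex_nonpos_Reals_iff)

lemma norm_w_coord_mult_less:
  assumes "Im z > 0" "Im t < 0" shows "norm (w_coord (- t) * w_coord z) < 1"
  using norm_w_coord_less[of z] norm_w_coord_less[of "- t"] assms
    mult_strict_mono[of "norm (w_coord (- t))" 1 "norm (w_coord z)" 1] by (simp add: norm_mult)

text \<open>The logarithmic form of 1 - w(-t) w(z) = 2i (t-z)/((t-i)(z+i)). It separates the two
  variables in the kernel up to a factor to which the binomial series applies.\<close>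

lemma Ln_kernel:
  assumes z: "Im z > 0" and t: "Im t < 0"
  shows "Ln (- \<i> - z) - Ln (t - z) = Ln (- 2 * \<i>) - Ln (t - \<i>) - Ln (1 - w_coord (- t) * w_coord z)"
proof -
  let ?p = "w_coord (- t) * w_coord z"
  note p = norm_w_coord_mult_less[OF z t]
  have Re: "Re (1 - ?p) > 0" using complex_Re_le_cmod[of ?p] p by simp
  have nz: "- \<i> - z \<noteq> 0" "t - z \<noteq> 0" "t - \<i> \<noteq> 0" "1 - ?p \<noteq> 0" "z + \<i> \<noteq> 0"
    using z t Re by (auto simp: complex_eq_iff)
  have I: "- pi < Im (Ln (- \<i> - z))" "Im (Ln (- \<i> - z)) < 0" "- pi < Im (Ln (t - z))" "Im (Ln (t - z)) < 0"
    "- pi < Im (Ln (t - \<i>))" "Im (Ln (t - \<i>)) < 0"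
    using Im_Ln_neg_lt_imp[of "- \<i> - z"] Im_Ln_neg_lt_imp[of "t - z"] Im_Ln_neg_lt_imp[of "t - \<i>"] z t by auto
  have I1: "\<bar>Im (Ln (1 - ?p))\<bar> < pi / 2" using Re Re_Ln_pos_lt_imp by blast
  have I2: "Im (Ln (- 2 * \<i>)) = - pi / 2"
    by (subst Im_Ln_eq_pi_half) auto
  define X where "X = Ln (- \<i> - z) - Ln (t - z) - Ln (- 2 * \<i>) + Ln (t - \<i>) + Ln (1 - ?p)"
  have "exp X = (- \<i> - z) / (t - z) / (- 2 * \<i>) * (t - \<i>) * (1 - ?p)"
    using nz by (simp add: X_def exp_add exp_diff)
  also have "1 - ?p = 2 * \<i> * (t - z) / ((t - \<i>) * (z + \<i>))"
  proof -
    have "w_coord (- t) = (t + \<i>) / (t - \<i>)" by (simp add: w_coord_minus, simp add: w_coord_def)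
    then show ?thesis unfolding w_coord_def[of z] using nz by (simp add: divide_simps) (simp add: algebra_simps)
  qed
  also have "- \<i> - z = - (z + \<i>)" by simp
  also have "- (z + \<i>) / (t - z) / (- 2 * \<i>) * (t - \<i>) * (2 * \<i> * (t - z) / ((t - \<i>) * (z + \<i>))) = 1"
  proof -
    have "- x / y / (- 2 * \<i>) * q * (2 * \<i> * y / (q * x)) = 1" if "x \<noteq> 0" "y \<noteq> 0" "q \<noteq> 0" for x y q :: complex
      using that by (simp add: field_simps)
    then show ?thesis using nz by blast
  qed
  finally have "exp X = 1" .
  \<comment> \<open>The three arguments in (-pi, 0), the value -pi/2 and the argument below pi/2 in
    modulus add up to strictly between -2 pi and 2 pi, with no slack.\<close>
  moreover have "\<bar>Im X\<bar> < 2 * pi"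
    unfolding X_def using I I1 I2 by (simp add: abs_if split: if_splits)
  ultimately have "X = 0" by (rule exp_eq_1_small)
  then show ?thesis by (simp add: X_def algebra_simps)
qed

lemma plus_fun_kernel:
  assumes z: "Im z > 0" and t: "Im t < 0"
  shows "plus_fun r (pole_kernel r t) z =
    (- 2 * \<i>) powr of_real r * (t - \<i>) powr of_real (- r) * (1 - w_coord (- t) * w_coord z) powr of_real (- r)"
proof -
  let ?p = "w_coord (- t) * w_coord z"
  have p1: "1 - ?p \<noteq> 0" using norm_w_coord_mult_less[OF z t] by auto
  have nz: "- \<i> - z \<noteq> 0" "t - z \<noteq> 0" "t - \<i> \<noteq> 0"
    using z t by (auto simp: complex_eq_iff)
  have "plus_fun r (pole_kernel r t) z = exp (of_real r * (Ln (- \<i> - z) - Ln (t - z)))"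
    using nz by (simp add: plus_fun_def pole_kernel_def powr_def exp_diff exp_minus right_diff_distrib divide_inverse)
  also have "\<dots> = exp (of_real r * Ln (- 2 * \<i>)) * exp (of_real (- r) * Ln (t - \<i>)) * exp (of_real (- r) * Ln (1 - ?p))"
    unfolding Ln_kernel[OF z t] by (simp only: exp_add[symmetric]) (simp add: algebra_simps)
  finally show ?thesis using nz p1 by (simp add: powr_def)
qed

definition kernel_const :: "real \<Rightarrow> complex \<Rightarrow> complex" where
  "kernel_const r t = (- 2 * \<i>) powr of_real r * (t - \<i>) powr of_real (- r)"

lemma kernel_const_nz: "Im t < 0 \<Longrightarrow> kernel_const r t \<noteq> 0"
proof -
  assume "Im t < 0"
  then have "t - \<i> \<noteq> 0" by (auto simp: complex_eq_iff)
  then show ?thesis by (simp add: kernel_const_def)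
qed

text \<open>Binomial series with exponent -r: the signs cancel in (-1)^n binom(-r, n) = (r)_n/n!.
  Where nonzero, this factor is the reciprocal of \<open>wt r n\<close>.\<close>

lemma plus_coeff_kernel:
  assumes t: "Im t < 0"
  shows "plus_coeff r (pole_kernel r t) n =
    kernel_const r t * (pochhammer (of_real r) n / fact n) * w_coord (- t) ^ n"
proof -
  let ?a = "w_coord (- t)"
  have a: "norm ?a < 1" using t by (intro norm_w_coord_less) simp
  have "(\<lambda>n. kernel_const r t * (pochhammer (of_real r) n / fact n) * ?a ^ n) = plus_coeff r (pole_kernel r t)"
    unfolding plus_coeff_def
  proof (rule taylor_unique[of 1])
    fix w :: complex assume w: "norm w < 1"
    then have "w \<noteq> 1" by auto
    have "norm (- (?a * w)) < 1"
      using a w mult_strict_mono[of "norm ?a" 1 "norm w" 1] by (simp add: norm_mult)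
    note gen_binomial_complex[OF this, of "of_real (- r)"]
    moreover have "(of_real (- r) gchoose n) * (- (?a * w)) ^ n = pochhammer (of_real r) n / fact n * (?a ^ n * w ^ n)" for n
    proof -
      have "(- (?a * w)) ^ n = (- 1) ^ n * (?a ^ n * w ^ n)"
        by (subst power_minus) (simp add: power_mult_distrib)
      then have "(of_real (- r) gchoose n) * (- (?a * w)) ^ n =
        ((- 1) ^ n * (- 1) ^ n) * (pochhammer (of_real r) n / fact n * (?a ^ n * w ^ n))"
        by (simp add: gbinomial_pochhammer mult_ac)
      then show ?thesis by (simp flip: power_mult_distrib)
    qed
    ultimately
    have "(\<lambda>n. pochhammer (of_real r) n / fact n * (?a ^ n * w ^ n)) sums (1 - ?a * w) powr of_real (- r)"
      by simp
    then have "(\<lambda>n. kernel_const r t * (pochhammer (of_real r) n / fact n * (?a ^ n * w ^ n))) sums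
       (kernel_const r t * (1 - ?a * w) powr of_real (- r))" by (rule sums_mult)
    then show "(\<lambda>n. kernel_const r t * (pochhammer (of_real r) n / fact n) * ?a ^ n * w ^ n) sums
        plus_fun r (pole_kernel r t) (cayley w)"
      unfolding plus_fun_kernel[OF cayley_upper[OF w] t] w_coord_cayley[OF \<open>w \<noteq> 1\<close>] kernel_const_def
      by (simp add: mult_ac)
  qed simp
  then show ?thesis by metis
qed

text \<open>The weights cancel and the expansion of f^- at t remains. Terms of weight 0 would be
  lost from it, which is why the coefficients of f are required to vanish there. The constant does
  not depend on t.\<close>

lemma duality_kernel:
  assumes f: "f holomorphic_on lower_half" and t: "Im t < 0"
    and m: "\<And>n. wt r n = 0 \<Longrightarrow> minus_coeff r f n = 0"
  shows "duality r (pole_kernel r t) f = (- 2 * \<i>) powr of_real r * exp (\<i> * of_real (pi * r)) * f t"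
proof -
  have "wt r n * plus_coeff r (pole_kernel r t) n * minus_coeff r f n =
     kernel_const r t * (minus_coeff r f n * w_coord (- t) ^ n)" for n
  proof (cases "wt r n = 0")
    case True then show ?thesis using m by simp
  next
    case False
    then have "pochhammer (complex_of_real r) n \<noteq> 0" by (auto simp: wt_def)
    then have 1: "wt r n * (pochhammer (of_real r) n / fact n) = 1" by (simp add: wt_def)
    have "wt r n * plus_coeff r (pole_kernel r t) n * minus_coeff r f n =
      (wt r n * (pochhammer (of_real r) n / fact n)) * (kernel_const r t * (minus_coeff r f n * w_coord (- t) ^ n))"
      unfolding plus_coeff_kernel[OF t] by (simp only: mult_ac)
    then show ?thesis unfolding 1 by simp
  qed
  then have "duality r (pole_kernel r t) f = (\<Sum>n. kernel_const r t * (minus_coeff r f n * w_coord (- t) ^ n))"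
    unfolding duality_def by (rule arg_cong[of _ _ suminf, OF ext])
  also have "\<dots> = kernel_const r t * minus_fun r f t"
    using sums_mult[OF minus_coeff_sums[OF f t]] by (simp add: sums_iff)
  also have "\<dots> = (- 2 * \<i>) powr of_real r * ((t - \<i>) powr of_real (- r) * (\<i> - t) powr of_real r) * f t"
    by (simp add: kernel_const_def minus_fun_def)
  also have "(t - \<i>) powr of_real (- r) * (\<i> - t) powr of_real r = exp (\<i> * of_real (pi * r))"
  proof -
    have nz: "t - \<i> \<noteq> 0" "\<i> - t \<noteq> 0" using t by (auto simp: complex_eq_iff)
    \<comment> \<open>As t - i lies in the lower half-plane, its negative has argument larger by pi;
      this is the origin of the factor exp(i pi r).\<close>
    have "Ln (\<i> - t) = Ln (t - \<i>) + \<i> * pi"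
      using Ln_minus[OF nz(1)] t by simp
    then show ?thesis
      using nz by (simp add: powr_def exp_add[symmetric] algebra_simps)
  qed
  finally show ?thesis .
qed

section \<open>Continuous functionals for uniform convergence on compact sets\<close>

definition plus_basis :: "real \<Rightarrow> nat \<Rightarrow> complex \<Rightarrow> complex" where
  "plus_basis r n z = (- \<i> - z) powr of_real (- r) * w_coord z ^ n"

lemma plus_basis_holomorphic: "plus_basis r n holomorphic_on upper_half"
  unfolding plus_basis_def
  by (intro holomorphic_intros) (auto simp: complex_nonpos_Reals_iff complex_eq_iff)

lemma plus_fun_basis: "Im z > 0 \<Longrightarrow> plus_fun r (plus_basis r n) z = w_coord z ^ n"
proof -
  assume "Im z > 0"
  then have "- \<i> - z \<noteq> 0" by (auto simp: complex_eq_iff)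
  then show ?thesis by (simp add: plus_fun_def plus_basis_def powr_minus)
qed

text \<open>Continuity of a linear functional in the topology of compact convergence means a bound
  by one seminorm, the supremum over a compact Q. An arbitrary upper bound M in place of the
  supremum makes empty Q harmless.\<close>

definition bounded_functional :: "((complex \<Rightarrow> complex) \<Rightarrow> complex) \<Rightarrow> bool" where
  "bounded_functional \<Lambda> \<longleftrightarrow> linear_form_on D_plus_neg_omega \<Lambda> \<and>
    (\<exists>Q K. compact Q \<and> Q \<subseteq> upper_half \<and> (\<forall>h M. h \<in> D_plus_neg_omega \<longrightarrow> (\<forall>z\<in>Q. norm (h z) \<le> M) \<longrightarrow>
      0 \<le> M \<longrightarrow> norm (\<Lambda> h) \<le> K * M))"

lemma bounded_functionalE:
  assumes "bounded_functional \<Lambda>"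
  obtains Q K where "linear_form_on D_plus_neg_omega \<Lambda>" "compact Q" "Q \<subseteq> upper_half"
    "\<And>h M. h \<in> D_plus_neg_omega \<Longrightarrow> (\<forall>z\<in>Q. norm (h z) \<le> M) \<Longrightarrow> 0 \<le> M \<Longrightarrow> norm (\<Lambda> h) \<le> K * M"
  using assms unfolding bounded_functional_def by blast

lemma linear_form_on_sum:
  assumes L: "linear_form_on D_plus_neg_omega \<Lambda>" and "\<And>n::nat. g n \<in> D_plus_neg_omega"
  shows "\<Lambda> (\<lambda>z. \<Sum>n<N. c n * g n z) = (\<Sum>n<N. c n * \<Lambda> (g n))"
proof (induction N)
  case 0
  have "\<Lambda> (\<lambda>z. 0 * g 0 z + 0 * g 0 z) = 0 * \<Lambda> (g 0) + 0 * \<Lambda> (g 0)"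
    using assms unfolding linear_form_on_def by blast
  then show ?case by simp
next
  case (Suc N)
  have "(\<lambda>z. \<Sum>n<N. c n * g n z) \<in> D_plus_neg_omega"
    using assms(2) unfolding D_plus_neg_omega_def by (auto intro!: holomorphic_intros)
  then have "\<Lambda> (\<lambda>z. 1 * (\<Sum>n<N. c n * g n z) + c N * g N z) = 1 * \<Lambda> (\<lambda>z. \<Sum>n<N. c n * g n z) + c N * \<Lambda> (g N)"
    using assms(2)[of N] L[unfolded linear_form_on_def, rule_format] by blast
  then show ?case using Suc by simp
qed

text \<open>On the compact Q one has |w| <= q < 1, so the expansion of g^+ converges uniformly
  there, and multiplication by the bounded factor (-i-z)^(-r) preserves this. A continuous
  functional is thus determined by its values on the basis functions.\<close>

lemma bounded_functional_sums:
  assumes \<Lambda>: "bounded_functional \<Lambda>" and g: "g \<in> D_plus_neg_omega"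
  shows "(\<lambda>n. plus_coeff r g n * \<Lambda> (plus_basis r n)) sums \<Lambda> g"
proof -
  obtain Q K where L: "linear_form_on D_plus_neg_omega \<Lambda>" and Q: "compact Q" "Q \<subseteq> upper_half" and
    K: "\<And>h M. h \<in> D_plus_neg_omega \<Longrightarrow> (\<forall>z\<in>Q. norm (h z) \<le> M) \<Longrightarrow> 0 \<le> M \<Longrightarrow> norm (\<Lambda> h) \<le> K * M"
    using bounded_functionalE[OF \<Lambda>] by blast
  have gh: "g holomorphic_on upper_half" using g by (simp add: D_plus_neg_omega_def)
  define S where "S = (\<lambda>N z. \<Sum>n<N. plus_coeff r g n * plus_basis r n z)"
  have basis: "plus_basis r n \<in> D_plus_neg_omega" for n
    by (simp add: D_plus_neg_omega_def plus_basis_holomorphic)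
  have S: "S N \<in> D_plus_neg_omega" for N
    unfolding S_def D_plus_neg_omega_def by (auto intro!: holomorphic_intros plus_basis_holomorphic)
  have lim: "uniform_limit Q S g sequentially"
  proof (cases "Q = {}")
    case False
    have wc: "continuous_on Q (\<lambda>z. norm (w_coord z))"
      using Q(2) upper_half_nz unfolding w_coord_def by (intro continuous_intros) auto
    obtain z0 where z0: "z0 \<in> Q" "\<And>z. z \<in> Q \<Longrightarrow> norm (w_coord z) \<le> norm (w_coord z0)"
      using continuous_attains_sup[OF Q(1) False wc] by auto
    define q where "q = norm (w_coord z0)"
    have q: "q < 1" "0 \<le> q" using z0 Q norm_w_coord_less by (auto simp: q_def)
    have "summable (\<lambda>n. norm (plus_coeff r g n) * q ^ n)"
      unfolding plus_coeff_def by (intro taylor_abs_summable[OF plus_fun_cayley_holomorphic[OF gh]] q)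
    then have "uniform_limit Q (\<lambda>N z. \<Sum>n<N. plus_coeff r g n * w_coord z ^ n) (\<lambda>z. \<Sum>n. plus_coeff r g n * w_coord z ^ n) sequentially"
      by (rule uniform_limit_power_series(1)) (use z0(2) in \<open>simp add: q_def\<close>)
    also have "?this \<longleftrightarrow> uniform_limit Q (\<lambda>N z. \<Sum>n<N. plus_coeff r g n * w_coord z ^ n) (plus_fun r g) sequentially"
    proof (rule uniform_limit_cong')
      fix z assume "z \<in> Q"
      then have "Im z > 0" using Q by auto
      then show "(\<Sum>n. plus_coeff r g n * w_coord z ^ n) = plus_fun r g z"
        using plus_coeff_sums[OF gh] by (simp add: sums_iff)
    qed simp
    finally have u: "uniform_limit Q (\<lambda>N z. \<Sum>n<N. plus_coeff r g n * w_coord z ^ n) (plus_fun r g) sequentially" .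
    have hol: "(\<lambda>z. (- \<i> - z) powr of_real (- r)) holomorphic_on upper_half"
      by (intro holomorphic_intros) (auto simp: complex_nonpos_Reals_iff)
    have "bounded ((\<lambda>z. (- \<i> - z) powr of_real (- r)) ` Q)"
      by (intro compact_imp_bounded compact_continuous_image Q
          continuous_on_subset[OF holomorphic_on_imp_continuous_on[OF hol]])
    moreover have "bounded (plus_fun r g ` Q)"
      by (intro compact_imp_bounded compact_continuous_image Q
          continuous_on_subset[OF holomorphic_on_imp_continuous_on[OF plus_fun_holomorphic[OF gh]]])
    ultimately have "uniform_limit Q (\<lambda>N z. (- \<i> - z) powr of_real (- r) * (\<Sum>n<N. plus_coeff r g n * w_coord z ^ n))
       (\<lambda>z. (- \<i> - z) powr of_real (- r) * plus_fun r g z) sequentially"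
      by (intro uniform_lim_mult uniform_limit_const u)
    also have "?this \<longleftrightarrow> uniform_limit Q S g sequentially"
    proof (rule uniform_limit_cong')
      fix z assume "z \<in> Q"
      then have "- \<i> - z \<noteq> 0" using Q by (auto simp: complex_eq_iff)
      then show "(- \<i> - z) powr of_real (- r) * plus_fun r g z = g z"
        by (simp add: plus_fun_def powr_minus)
      show "(- \<i> - z) powr of_real (- r) * (\<Sum>n<N. plus_coeff r g n * w_coord z ^ n) = S N z" for N
        by (simp add: S_def plus_basis_def sum_distrib_left mult_ac)
    qed
    finally show ?thesis .
  qed simp
  have "(\<lambda>N. \<Lambda> (S N)) \<longlonglongrightarrow> \<Lambda> g"
  proof (rule tendstoI)
    fix e :: real assume "e > 0"
    \<comment> \<open>K may be zero or negative, hence |K| + 1.\<close>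
    then have e: "e / (\<bar>K\<bar> + 1) > 0" by simp
    from uniform_limitD[OF lim this]
    show "eventually (\<lambda>N. dist (\<Lambda> (S N)) (\<Lambda> g) < e) sequentially"
    proof eventually_elim
      case (elim N)
      have "\<Lambda> (\<lambda>z. 1 * S N z + (- 1) * g z) = 1 * \<Lambda> (S N) + (- 1) * \<Lambda> g"
        using L S g unfolding linear_form_on_def by blast
      then have 1: "\<Lambda> (\<lambda>z. S N z - g z) = \<Lambda> (S N) - \<Lambda> g" by simp
      have "(\<lambda>z. S N z - g z) \<in> D_plus_neg_omega"
        using S g by (auto simp: D_plus_neg_omega_def intro!: holomorphic_intros)
      then have "norm (\<Lambda> (\<lambda>z. S N z - g z)) \<le> K * (e / (\<bar>K\<bar> + 1))"
        using elim e by (intro K) (auto simp: dist_norm less_imp_le)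
      also have "\<dots> < (\<bar>K\<bar> + 1) * (e / (\<bar>K\<bar> + 1))" using e by (intro mult_strict_right_mono) auto
      finally show ?case unfolding 1 by (simp add: dist_norm)
    qed
  qed
  then show ?thesis
    unfolding sums_def S_def linear_form_on_sum[OF L basis] .
qed

text \<open>The expansion of the kernels in powers of \<open>w\<close> involves every monomial \<open>w\<^sup>n\<close> with
  \<open>(r)\<^sub>n \<noteq> 0\<close>, so functionals that agree on all kernels agree on these monomials.\<close>
lemma bounded_functional_eqI:
  assumes \<Lambda>: "bounded_functional \<Lambda>" "bounded_functional \<Lambda>'"
    and k: "\<And>t. Im t < 0 \<Longrightarrow> \<Lambda> (pole_kernel r t) = \<Lambda>' (pole_kernel r t)"
    and h: "h \<in> D_plus_neg_omega" and c: "\<And>n. wt r n = 0 \<Longrightarrow> plus_coeff r h n = 0"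
  shows "\<Lambda> h = \<Lambda>' h"
proof -
  let ?d = "\<lambda>n. \<Lambda> (plus_basis r n) - \<Lambda>' (plus_basis r n)"
  have d: "(\<lambda>n. plus_coeff r g n * ?d n) sums (\<Lambda> g - \<Lambda>' g)" if "g \<in> D_plus_neg_omega" for g
    using sums_diff[OF bounded_functional_sums[OF \<Lambda>(1) that, of r] bounded_functional_sums[OF \<Lambda>(2) that, of r]]
    by (simp add: right_diff_distrib)
  \<comment> \<open>As t runs through the lower half-plane, a = w(-t) runs through the whole disc,
    and the difference of the functionals at the kernel is a nonzero factor times a power series in
    a. It vanishes identically, hence coefficientwise.\<close>
  have "(\<lambda>n. pochhammer (of_real r) n / fact n * ?d n) = taylor (\<lambda>_. 0)"
  proof (rule taylor_unique[of 1])
    fix a :: complex assume a: "norm a < 1"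
    then have "a \<noteq> 1" by auto
    define t where "t = - cayley a"
    have t: "Im t < 0" "w_coord (- t) = a"
      using cayley_upper[OF a] w_coord_cayley[OF \<open>a \<noteq> 1\<close>] by (auto simp: t_def)
    have "pole_kernel r t \<in> D_plus_neg_omega" by (simp add: D_plus_neg_omega_def kernel_holomorphic t)
    from d[OF this]
    have "(\<lambda>n. kernel_const r t * (pochhammer (of_real r) n / fact n * ?d n * a ^ n)) sums 0"
      unfolding plus_coeff_kernel[OF t(1)] k[OF t(1)] t(2) by (simp add: mult_ac)
    from sums_mult[OF this, of "inverse (kernel_const r t)"]
    show "(\<lambda>n. pochhammer (of_real r) n / fact n * ?d n * a ^ n) sums 0"
      using kernel_const_nz[OF t(1), of r] by (simp add: mult.assoc[symmetric])
  qed simp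
  also have "taylor (\<lambda>_. 0) = (\<lambda>_. 0)" by (simp add: taylor_def fun_eq_iff)
  finally have *: "pochhammer (of_real r) n / fact n * ?d n = 0" for n by metis
  \<comment> \<open>Either (r)_n is nonzero and \<open>?d n\<close> vanishes, or the weight is 0 by
    division by 0 and the coefficient of h vanishes.\<close>
  have "plus_coeff r h n * ?d n = 0" for n
    using c[of n] *[of n] by (auto simp: wt_def)
  then have "(\<lambda>n. plus_coeff r h n * ?d n) = (\<lambda>_. 0)" by (rule ext)
  then show ?thesis using d[OF h] by (simp add: sums_iff)
qed

lemma duality_linear_minus:
  assumes "f holomorphic_on lower_half" "g holomorphic_on lower_half"
    and "(\<lambda>n. duality_term r h f n) sums duality r h f" "(\<lambda>n. duality_term r h g n) sums duality r h g"
  shows "duality r h (\<lambda>z. a * f z + b * g z) = a * duality r h f + b * duality r h g"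
  using sums_add[OF sums_mult[OF assms(3), of a] sums_mult[OF assms(4), of b]]
  unfolding duality_def[of r h "\<lambda>z. a * f z + b * g z"] minus_coeff_linear[OF assms(1,2)]
  by (simp add: sums_iff algebra_simps)

lemma duality_linear_plus:
  assumes "disc_extension r R f G" "R > 1"
  shows "linear_form_on D_plus_neg_omega (\<lambda>h. duality r h f)"
  unfolding linear_form_on_def
proof (intro ballI allI)
  fix g h a b assume "g \<in> D_plus_neg_omega" "h \<in> D_plus_neg_omega"
  then have gh: "g holomorphic_on upper_half" "h holomorphic_on upper_half" by (auto simp: D_plus_neg_omega_def)
  have "(\<lambda>n. a * (duality_term r g f n) + b * (duality_term r h f n))
     sums (a * duality r g f + b * duality r h f)"
    by (intro sums_add sums_mult duality_sums[OF _ assms] gh)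
  then show "duality r (\<lambda>z. a * g z + b * h z) f = a * duality r g f + b * duality r h f"
    unfolding duality_def[of r "\<lambda>z. a * g z + b * h z"] plus_coeff_linear[OF gh]
    by (simp add: sums_iff algebra_simps)
qed

text \<open>Cauchy's estimate on |w| = 1/\<rho>' bounds the coefficients of h^+ by a multiple of
  \<rho>'^n times a bound for h on Q. The coefficients of G absorb \<rho>'^n because \<rho>' <
  R.\<close>

lemma duality_bounded:
  assumes f: "disc_extension r R f G" "R > 1"
  shows "bounded_functional (\<lambda>h. duality r h f)"
proof -
  obtain \<rho>' where \<rho>': "1 < \<rho>'" "\<rho>' < R" using assms dense by blast
  define \<rho> where "\<rho> = 1 / \<rho>'"
  have \<rho>: "0 < \<rho>" "\<rho> < 1" using \<rho>' by (auto simp: \<rho>_def)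
  have G: "G holomorphic_on ball 0 R" using f by (simp add: disc_extension_def)
  define Q where "Q = cayley ` cball 0 \<rho>"
  have Q: "compact Q"
    unfolding Q_def using \<rho>
    by (intro compact_continuous_image holomorphic_on_imp_continuous_on holomorphic_intros) auto
  have Qu: "Q \<subseteq> upper_half" using \<rho> cayley_upper by (auto simp: Q_def)
  have hol: "(\<lambda>z. (- \<i> - z) powr of_real r) holomorphic_on upper_half"
    by (intro holomorphic_intros) (auto simp: complex_nonpos_Reals_iff)
  have "bounded ((\<lambda>z. (- \<i> - z) powr of_real r) ` Q)"
    by (intro compact_imp_bounded compact_continuous_image Q
        continuous_on_subset[OF holomorphic_on_imp_continuous_on[OF hol]] Qu)
  then obtain D where D: "\<And>z. z \<in> Q \<Longrightarrow> norm ((- \<i> - z) powr of_real r) \<le> D"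
    by (auto simp: bounded_iff)
  define K where "K = (\<Sum>n. norm (wt r n * taylor G n) * \<rho>' ^ n)"
  have s: "summable (\<lambda>n. norm (wt r n * taylor G n) * \<rho>' ^ n)"
    using \<rho>' by (intro taylor_wt_abs_summable[OF G]) auto
  have bd: "norm (duality r h f) \<le> (K * D) * M"
    if h: "h \<in> D_plus_neg_omega" and M: "\<forall>z\<in>Q. norm (h z) \<le> M" "0 \<le> M" for h M
  proof -
    have hh: "h holomorphic_on upper_half" using h by (simp add: D_plus_neg_omega_def)
    have c: "norm (plus_coeff r h n) \<le> (D * M) * \<rho>' ^ n" for n
    proof -
      have "norm (plus_coeff r h n) \<le> (D * M) / \<rho> ^ n"
        unfolding plus_coeff_def
      proof (rule taylor_bound[OF plus_fun_cayley_holomorphic[OF hh] \<rho>])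
        fix w :: complex assume "norm w = \<rho>"
        then have w: "cayley w \<in> Q" by (simp add: Q_def)
        show "norm (plus_fun r h (cayley w)) \<le> D * M"
          unfolding plus_fun_def norm_mult using D[OF w] M w
          by (intro mult_mono) (auto intro: order_trans[OF norm_ge_zero])
      qed
      then show ?thesis by (simp add: \<rho>_def power_divide)
    qed
    have "norm (duality r h f) \<le> (\<Sum>n. (D * M) * (norm (wt r n * taylor G n) * \<rho>' ^ n))"
      unfolding duality_def
    proof (rule norm_suminf_le)
      fix n
      show "norm (duality_term r h f n) \<le> (D * M) * (norm (wt r n * taylor G n) * \<rho>' ^ n)"
        using mult_left_mono[OF c[of n], of "norm (wt r n * taylor G n)"]
        by (simp add: norm_mult minus_coeff_eq_taylor[OF f(1)] mult_ac)
    qed (intro summable_mult s)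
    also have "\<dots> = (D * M) * K" unfolding K_def by (rule suminf_mult[OF s])
    finally show ?thesis by (simp add: mult_ac)
  qed
  show ?thesis
    unfolding bounded_functional_def using duality_linear_plus[OF f] Q Qu bd by blast
qed

subsection \<open>Invariance\<close>

text \<open>The logarithms of the factors are summable, so the infinite product is the exponential
  of their sum. This yields that multiplier systems have no zeros.\<close>

lemma eta_power_nonzero:
  assumes "Im z > 0"
  shows "eta_power s z \<noteq> 0"
proof -
  define q where "q = exp (2 * of_real pi * \<i> * z)"
  have q: "norm q < 1" using assms by (simp add: q_def norm_exp_eq_Re)
  have qn: "exp (2 * of_real pi * \<i> * of_nat (Suc n) * z) = q * q ^ n" for n
    using exp_of_nat_mult[of "Suc n" "2 * of_real pi * \<i> * z"]
    by (simp add: q_def mult_ac del: of_nat_Suc)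
  have ne: "1 + - (q * q ^ n) \<noteq> 0" for n
  proof -
    have "norm (q ^ Suc n) < 1" using q by (simp only: norm_power power_less_one_iff[OF norm_ge_zero], simp)
    then show ?thesis by auto
  qed
  have "summable (\<lambda>n. norm (- (q * q ^ n)))"
    using q by (simp add: norm_mult norm_power summable_geometric summable_mult)
  then have "convergent_prod (\<lambda>n. 1 + - (q * q ^ n))"
    by (rule summable_imp_convergent_prod_complex) (use ne in \<open>auto simp: add_eq_0_iff\<close>)
  from summable_mult[OF summable_Ln_complex[OF this ne], of "of_real s"]
  have "(\<Prod>n. exp (of_real s * Ln (1 - q * q ^ n))) = exp (\<Sum>n. of_real s * Ln (1 - q * q ^ n))"
    by (intro prodinf_exp) simp
  then have "(\<Prod>n. (1 - q * q ^ n) powr of_real s) \<noteq> 0"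
    using ne by (simp add: powr_def)
  then show ?thesis by (simp add: eta_power_def qn del: of_nat_Suc)
qed

section \<open>Moebius transformations, automorphy factors and their branches\<close>

lemma SL2Z_det:
  fixes A :: "int ^ 2 ^ 2"
  assumes "A \<in> SL2Z"
  shows "complex_of_int (A $ 1 $ 1) * of_int (A $ 2 $ 2) - of_int (A $ 1 $ 2) * of_int (A $ 2 $ 1) = 1"
proof -
  have "A $ 1 $ 1 * A $ 2 $ 2 - A $ 1 $ 2 * A $ 2 $ 1 = 1"
    using assms by (simp add: SL2Z_def det_2)
  then have "complex_of_int (A $ 1 $ 1 * A $ 2 $ 2 - A $ 1 $ 2 * A $ 2 $ 1) = of_int 1" by presburger
  then show ?thesis by simp
qed

lemma moebius_den_nonzero:
  assumes "A \<in> SL2Z" "Im z \<noteq> 0" shows "moebius_den A z \<noteq> 0"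
proof
  assume "moebius_den A z = 0"
  then have "of_int (A $ 2 $ 1) * Im z = 0" "of_int (A $ 2 $ 1) * Re z + of_int (A $ 2 $ 2) = 0"
    by (simp_all add: moebius_den_def complex_eq_iff)
  then have "A $ 2 $ 1 = 0" "A $ 2 $ 2 = 0" using assms(2) by auto
  then show False using SL2Z_det[OF assms(1)] by simp
qed

text \<open>Clearing denominators leaves the determinant times t - z. The points may lie in
  different half-planes: this gives the covariance of the kernels, and with t the conjugate of z it
  gives the formula for the imaginary part.\<close>

lemma moebius_diff:
  assumes "A \<in> SL2Z" "Im z \<noteq> 0" "Im t \<noteq> 0"
  shows "(moebius A t - moebius A z) * moebius_den A z * moebius_den A t = t - z"
proof -
  have "(moebius A t - moebius A z) * moebius_den A z * moebius_den A t =
    moebius_num A t * moebius_den A z - moebius_num A z * moebius_den A t"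
    using moebius_den_nonzero[OF assms(1)] assms(2,3) by (simp add: moebius_def left_diff_distrib)
  also have "\<dots> = (of_int (A $ 1 $ 1) * of_int (A $ 2 $ 2) - of_int (A $ 1 $ 2) * of_int (A $ 2 $ 1)) * (t - z)"
    by (simp add: moebius_num_def moebius_den_def algebra_simps)
  finally show ?thesis using SL2Z_det[OF assms(1)] by simp
qed

lemma moebius_cnj: "moebius A (cnj z) = cnj (moebius A z)"
  and moebius_den_cnj: "moebius_den A (cnj z) = cnj (moebius_den A z)"
  by (simp_all add: moebius_def moebius_num_def moebius_den_def)

lemma Im_moebius:
  assumes "A \<in> SL2Z" "Im z \<noteq> 0"
  shows "Im (moebius A z) = Im z / (norm (moebius_den A z))\<^sup>2"
proof -
  have "(cnj (moebius A z) - moebius A z) * (moebius_den A z * cnj (moebius_den A z)) = cnj z - z"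
    using moebius_diff[OF assms(1,2), of "cnj z"] assms(2) by (simp add: moebius_cnj moebius_den_cnj mult.assoc)
  then have "(cnj (moebius A z) - moebius A z) * of_real ((norm (moebius_den A z))\<^sup>2) = cnj z - z"
    by (simp only: complex_norm_square)
  from arg_cong[OF this, of Im] show ?thesis
    using moebius_den_nonzero[OF assms] by (simp add: field_simps)
qed

lemma moebius_upper: "A \<in> SL2Z \<Longrightarrow> Im z > 0 \<Longrightarrow> Im (moebius A z) > 0"
  using moebius_den_nonzero[of A z] by (simp add: Im_moebius)

lemma moebius_lower: "A \<in> SL2Z \<Longrightarrow> Im z < 0 \<Longrightarrow> Im (moebius A z) < 0"
  using moebius_den_nonzero[of A z] by (simp add: Im_moebius divide_neg_pos)

text \<open>The witness is the adjugate matrix, the inverse for determinant 1.\<close>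

lemma SL2Z_inverse:
  fixes A :: "int ^ 2 ^ 2"
  assumes A: "A \<in> SL2Z"
  obtains A' where "A' \<in> SL2Z" "\<And>t. Im t \<noteq> 0 \<Longrightarrow> moebius A (moebius A' t) = t"
proof
  let ?d = "vector [vector [A $ 2 $ 2, - A $ 1 $ 2], vector [- A $ 2 $ 1, A $ 1 $ 1]] :: int ^ 2 ^ 2"
  show d: "?d \<in> SL2Z" using A by (simp add: SL2Z_def det_2 mult.commute)
  fix t assume t: "Im t \<noteq> 0"
  define D where "D = moebius_den ?d t"
  have D: "D \<noteq> 0" unfolding D_def using moebius_den_nonzero[OF d] t by simp
  have Dt: "D = - of_int (A $ 2 $ 1) * t + of_int (A $ 1 $ 1)" by (simp add: D_def moebius_den_def)
  have m: "moebius ?d t = (of_int (A $ 2 $ 2) * t - of_int (A $ 1 $ 2)) / D"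
    by (simp add: moebius_def D_def moebius_num_def)
  have "moebius_num A (moebius ?d t) * D =
    (of_int (A $ 1 $ 1) * of_int (A $ 2 $ 2) - of_int (A $ 1 $ 2) * of_int (A $ 2 $ 1)) * t"
    unfolding moebius_num_def m using D by (simp add: distrib_right, simp add: Dt algebra_simps)
  moreover have "moebius_den A (moebius ?d t) * D =
    (of_int (A $ 1 $ 1) * of_int (A $ 2 $ 2) - of_int (A $ 1 $ 2) * of_int (A $ 2 $ 1))"
    unfolding moebius_den_def m using D by (simp add: distrib_right, simp add: Dt algebra_simps)
  ultimately have "moebius_num A (moebius ?d t) * D = t" "moebius_den A (moebius ?d t) * D = 1"
    using SL2Z_det[OF A] by simp_all
  then show "moebius A (moebius ?d t) = t"
    unfolding moebius_def[of A] using D by (metis div_by_1 mult_divide_mult_cancel_right)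
qed

lemma multiplier_system_nonzero:
  assumes "multiplier_system r v" "A \<in> SL2Z" shows "v A \<noteq> 0"
proof -
  obtain p where p: "\<forall>A\<in>SL2Z. \<forall>z\<in>upper_half.
      v A = eta_power (2 * p) (moebius A z) / (moebius_den A z powr of_real p * eta_power (2 * p) z)"
    using assms unfolding multiplier_system_def by blast
  have "v A = eta_power (2 * p) (moebius A \<i>) / (moebius_den A \<i> powr of_real p * eta_power (2 * p) \<i>)"
    using p[rule_format, OF assms(2), of \<i>] by simp
  then show ?thesis
    using eta_power_nonzero[of "moebius A \<i>"] eta_power_nonzero[of \<i>] moebius_upper[OF assms(2), of \<i>]
      moebius_den_nonzero[OF assms(2), of \<i>] by simp
qed

text \<open>The imaginary part of cz + d has the sign of c throughout the upper half-plane, so both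
  arguments lie in the same open interval of length pi; for c = 0 the two numbers coincide.\<close>

lemma Ln_moebius_den_diff:
  assumes "Im z > 0" "Im s > 0"
  shows "\<bar>Im (Ln (moebius_den A z)) - Im (Ln (moebius_den A s))\<bar> < pi"
proof -
  define c where "c = real_of_int (A $ 2 $ 1)"
  have Im: "Im (moebius_den A z) = c * Im z" "Im (moebius_den A s) = c * Im s"
    by (simp_all add: moebius_den_def c_def)
  consider "c > 0" | "c < 0" | "c = 0" by linarith
  then show ?thesis
  proof cases
    case 1
    then have "Im (moebius_den A z) > 0" "Im (moebius_den A s) > 0" using assms by (simp_all add: Im)
    then show ?thesis
      using Im_Ln_pos_lt_imp[of "moebius_den A z"] Im_Ln_pos_lt_imp[of "moebius_den A s"] by (auto simp: abs_if)
  next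
    case 2
    then have "Im (moebius_den A z) < 0" "Im (moebius_den A s) < 0" using assms by (simp_all add: Im mult_neg_pos)
    then show ?thesis
      using Im_Ln_neg_lt_imp[of "moebius_den A z"] Im_Ln_neg_lt_imp[of "moebius_den A s"] by (auto simp: abs_if)
  next
    case 3
    then have "moebius_den A z = moebius_den A s" by (simp add: moebius_den_def c_def)
    then show ?thesis by simp
  qed
qed

text \<open>The logarithmic form of \<open>moebius_diff\<close>. The arguments of the two
  differences lie in (-pi, 0), and those of cz + d and its counterpart at the conjugate of t differ
  by less than pi. Conjugation realises the interval [-pi, pi) on the lower half-plane; for c = 0
  and d < 0 the arguments pi and -pi then cancel.\<close>

lemma Ln_moebius:
  assumes A: "A \<in> SL2Z" and z: "Im z > 0" and t: "Im t < 0"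
  shows "Ln (moebius A t - moebius A z) + Ln (moebius_den A z) + cnj (Ln (cnj (moebius_den A t))) = Ln (t - z)"
proof -
  have nz: "moebius_den A z \<noteq> 0" "moebius_den A t \<noteq> 0" "t - z \<noteq> 0" "moebius A t - moebius A z \<noteq> 0"
    using moebius_den_nonzero[OF A] moebius_upper[OF A z] moebius_lower[OF A t] z t by auto
  define X where "X = Ln (moebius A t - moebius A z) + Ln (moebius_den A z) + cnj (Ln (cnj (moebius_den A t))) - Ln (t - z)"
  have "exp X = (moebius A t - moebius A z) * moebius_den A z * moebius_den A t / (t - z)"
    using nz by (simp add: X_def exp_add exp_diff exp_cnj[symmetric] del: right_minus_eq)
  also have "\<dots> = 1" using moebius_diff[OF A, of z t] z t nz by simp
  finally have "exp X = 1" .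
  moreover have "\<bar>Im X\<bar> < 2 * pi"
    using Ln_moebius_den_diff[OF z, of "cnj t" A] Im_Ln_neg_lt_imp[of "moebius A t - moebius A z"]
      Im_Ln_neg_lt_imp[of "t - z"] z t moebius_upper[OF A z] moebius_lower[OF A t]
    by (simp add: X_def moebius_den_cnj abs_if split: if_splits)
  ultimately have "X = 0" by (rule exp_eq_1_small)
  then show ?thesis by (simp add: X_def)
qed

lemma powr_low_eq_exp: "x \<noteq> 0 \<Longrightarrow> powr_low x s = exp (of_real s * cnj (Ln (cnj x)))"
  by (simp add: powr_low_def powr_def exp_cnj)

text \<open>The factor in t that splits off has exponent r and is the inverse of the one in
  \<open>slash_minus\<close>, so the two cancel in the pairing.\<close>

lemma slash_plus_kernel:
  assumes A: "A \<in> SL2Z" and z: "Im z > 0" and t: "Im t < 0"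
  shows "slash_plus v r A (pole_kernel r (moebius A t)) z =
    inverse (v A) * powr_low (moebius_den A t) r * pole_kernel r t z"
proof -
  have nz: "moebius_den A z \<noteq> 0" "moebius_den A t \<noteq> 0" "t - z \<noteq> 0" "moebius A t - moebius A z \<noteq> 0"
    using moebius_den_nonzero[OF A] moebius_upper[OF A z] moebius_lower[OF A t] z t by auto
  have "moebius_den A z powr of_real (- r) * pole_kernel r (moebius A t) (moebius A z) =
     exp (of_real (- r) * Ln (moebius_den A z)) * exp (of_real (- r) * Ln (moebius A t - moebius A z))"
    using nz by (simp add: pole_kernel_def powr_def)
  also have "\<dots> = exp (of_real r * cnj (Ln (cnj (moebius_den A t)))) * exp (of_real (- r) * Ln (t - z))"
    unfolding Ln_moebius[OF assms, symmetric] exp_add[symmetric] by (simp add: algebra_simps)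
  also have "\<dots> = powr_low (moebius_den A t) r * pole_kernel r t z"
    using nz by (simp add: powr_low_eq_exp pole_kernel_def powr_def)
  finally show ?thesis by (simp add: slash_plus_def mult.assoc)
qed

text \<open>If c = 0 the denominator is a constant, possibly negative and on the branch cut, but
  then its power is constant as well; otherwise it is never real on the half-plane.\<close>

lemma moebius_den_powr_holomorphic:
  assumes A: "A \<in> SL2Z"
  shows "(\<lambda>z. moebius_den A z powr s) holomorphic_on upper_half"
proof (cases "A $ 2 $ 1 = 0")
  case True
  then show ?thesis by (simp add: moebius_den_def)
next
  case False
  then show ?thesis unfolding moebius_den_def
    by (intro holomorphic_intros) (auto simp: complex_nonpos_Reals_iff)
qed

text \<open>Off the real axis the two argument conventions agree, so the principal logarithm may be
  used; the real denominators of the case c = 0 are constant.\<close>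

lemma powr_low_den_holomorphic:
  assumes A: "A \<in> SL2Z"
  shows "(\<lambda>z. powr_low (moebius_den A z) s) holomorphic_on lower_half"
proof (cases "A $ 2 $ 1 = 0")
  case True
  then show ?thesis by (simp add: moebius_den_def)
next
  case False
  have "(\<lambda>z. exp (of_real s * Ln (moebius_den A z))) holomorphic_on lower_half"
    using False unfolding moebius_den_def
    by (intro holomorphic_intros) (auto simp: complex_nonpos_Reals_iff)
  then show ?thesis
  proof (rule holomorphic_transform)
    fix z assume "z \<in> lower_half"
    then have "Im (moebius_den A z) \<noteq> 0" using False by (simp add: moebius_den_def)
    then have "moebius_den A z \<notin> \<real>\<^sub>\<le>\<^sub>0" "moebius_den A z \<noteq> 0" by (auto simp: complex_nonpos_Reals_iff)
    then show "exp (of_real s * Ln (moebius_den A z)) = powr_low (moebius_den A z) s"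
      using cnj_Ln[of "moebius_den A z", symmetric] by (simp add: powr_low_eq_exp)
  qed
qed

lemma moebius_holomorphic:
  "A \<in> SL2Z \<Longrightarrow> moebius A holomorphic_on upper_half"
  "A \<in> SL2Z \<Longrightarrow> moebius A holomorphic_on lower_half"
  using moebius_den_nonzero[of A] unfolding moebius_def moebius_num_def
  by (auto intro!: holomorphic_intros simp: moebius_den_def)

lemma slash_plus_holomorphic:
  assumes A: "A \<in> SL2Z" and h: "h holomorphic_on upper_half"
  shows "slash_plus v r A h holomorphic_on upper_half"
proof -
  have "(h \<circ> moebius A) holomorphic_on upper_half"
    by (rule holomorphic_on_compose_gen[OF moebius_holomorphic(1)[OF A] h]) (auto simp: moebius_upper[OF A])
  then show ?thesis
    unfolding slash_plus_def o_def by (intro holomorphic_intros moebius_den_powr_holomorphic[OF A])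
qed

lemma slash_minus_holomorphic:
  assumes A: "A \<in> SL2Z" and f: "f holomorphic_on lower_half"
  shows "slash_minus v r A f holomorphic_on lower_half"
proof -
  have "(f \<circ> moebius A) holomorphic_on lower_half"
    by (rule holomorphic_on_compose_gen[OF moebius_holomorphic(2)[OF A] f]) (auto simp: moebius_lower[OF A])
  then show ?thesis
    unfolding slash_minus_def o_def by (intro holomorphic_intros powr_low_den_holomorphic[OF A])
qed

text \<open>The transformed function on Q involves h only on the image of Q under the
  transformation, again compact in the upper half-plane, and an automorphy factor that is bounded on
  Q.\<close>

lemma bounded_functional_slash_plus:
  assumes A: "A \<in> SL2Z" and \<Lambda>: "bounded_functional \<Lambda>"
  shows "bounded_functional (\<lambda>h. \<Lambda> (slash_plus v r A h))"
proof -
  obtain Q K where L: "linear_form_on D_plus_neg_omega \<Lambda>" and Q: "compact Q" "Q \<subseteq> upper_half" and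
    K: "\<And>h M. h \<in> D_plus_neg_omega \<Longrightarrow> (\<forall>z\<in>Q. norm (h z) \<le> M) \<Longrightarrow> 0 \<le> M \<Longrightarrow> norm (\<Lambda> h) \<le> K * M"
    using bounded_functionalE[OF \<Lambda>] by blast
  have sl: "slash_plus v r A h \<in> D_plus_neg_omega" if "h \<in> D_plus_neg_omega" for h
    using that slash_plus_holomorphic[OF A] by (simp add: D_plus_neg_omega_def)
  have lin: "linear_form_on D_plus_neg_omega (\<lambda>h. \<Lambda> (slash_plus v r A h))"
    unfolding linear_form_on_def
  proof (intro ballI allI)
    fix g h a b assume "g \<in> D_plus_neg_omega" "h \<in> D_plus_neg_omega"
    then have "\<Lambda> (\<lambda>z. a * slash_plus v r A g z + b * slash_plus v r A h z) =
      a * \<Lambda> (slash_plus v r A g) + b * \<Lambda> (slash_plus v r A h)"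
      using L[unfolded linear_form_on_def, rule_format] sl by blast
    moreover have "slash_plus v r A (\<lambda>z. a * g z + b * h z) = (\<lambda>z. a * slash_plus v r A g z + b * slash_plus v r A h z)"
      by (simp add: slash_plus_def fun_eq_iff algebra_simps)
    ultimately show "\<Lambda> (slash_plus v r A (\<lambda>z. a * g z + b * h z)) =
      a * \<Lambda> (slash_plus v r A g) + b * \<Lambda> (slash_plus v r A h)" by simp
  qed
  have hol: "(\<lambda>z. inverse (v A) * moebius_den A z powr of_real (- r)) holomorphic_on upper_half"
    by (intro holomorphic_intros moebius_den_powr_holomorphic A)
  have "bounded ((\<lambda>z. inverse (v A) * moebius_den A z powr of_real (- r)) ` Q)"
    by (intro compact_imp_bounded compact_continuous_image Q
        continuous_on_subset[OF holomorphic_on_imp_continuous_on[OF hol]])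
  then obtain D where D: "\<And>z. z \<in> Q \<Longrightarrow> norm (inverse (v A) * moebius_den A z powr of_real (- r)) \<le> D"
    unfolding bounded_iff by blast
  have cQ: "compact (moebius A ` Q)"
    by (intro compact_continuous_image Q
        continuous_on_subset[OF holomorphic_on_imp_continuous_on[OF moebius_holomorphic(1)[OF A]]])
  have uQ: "moebius A ` Q \<subseteq> upper_half" using Q(2) moebius_upper[OF A] by auto
  have bd: "norm (\<Lambda> (slash_plus v r A h)) \<le> (K * \<bar>D\<bar>) * M"
    if h: "h \<in> D_plus_neg_omega" "\<forall>z\<in>moebius A ` Q. norm (h z) \<le> M" "0 \<le> M" for h M
  proof -
    have "norm (slash_plus v r A h z) \<le> \<bar>D\<bar> * M" if "z \<in> Q" for z
    proof -
      have "norm (slash_plus v r A h z) =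
        norm (inverse (v A) * moebius_den A z powr of_real (- r)) * norm (h (moebius A z))"
        by (simp add: slash_plus_def norm_mult)
      also have "\<dots> \<le> \<bar>D\<bar> * M"
        using D[OF that] h that by (intro mult_mono) auto
      finally show ?thesis .
    qed
    then have "norm (\<Lambda> (slash_plus v r A h)) \<le> K * (\<bar>D\<bar> * M)"
      using h(3) by (intro K sl h(1)) auto
    then show ?thesis by simp
  qed
  show ?thesis unfolding bounded_functional_def using lin cQ uQ bd by blast
qed

text \<open>Values outside the half-plane are arbitrary, so identities such as the transformation
  rule of the kernels are available only on it.\<close>

lemma duality_cong_plus:
  assumes "\<And>z. Im z > 0 \<Longrightarrow> g z = h z" shows "duality r g f = duality r h f"
proof -
  have "plus_coeff r g = plus_coeff r h"
    unfolding plus_coeff_def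
    by (rule taylor_cong[of 1]) (auto simp: plus_fun_def assms cayley_upper)
  then show ?thesis by (simp add: duality_def)
qed

text \<open>For fixed f both sides are continuous functionals of h, compared on kernels. The
  vanishing hypotheses are what remains of polynomiality when r is a nonpositive integer, where
  kernels do not detect the higher coefficients.\<close>

lemma duality_invariant:
  assumes A: "A \<in> SL2Z" and v: "v A \<noteq> 0"
    and f: "f holomorphic_on lower_half" "disc_extension r R f G" "R > 1"
      "\<And>n. wt r n = 0 \<Longrightarrow> minus_coeff r f n = 0"
    and f': "disc_extension r R' (slash_minus v r A f) G'" "R' > 1"
      "\<And>n. wt r n = 0 \<Longrightarrow> minus_coeff r (slash_minus v r A f) n = 0"
    and h: "h holomorphic_on upper_half" "\<And>n. wt r n = 0 \<Longrightarrow> plus_coeff r h n = 0"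
  shows "duality r (slash_plus v r A h) (slash_minus v r A f) = duality r h f"
proof -
  let ?f = "slash_minus v r A f"
  have bf': "bounded_functional (\<lambda>h. duality r h ?f)" by (rule duality_bounded[OF f'(1,2)])
  define C where "C = (- 2 * \<i>) powr of_real r * exp (\<i> * of_real (pi * r))"
  obtain A' where A': "A' \<in> SL2Z" "\<And>t. Im t \<noteq> 0 \<Longrightarrow> moebius A (moebius A' t) = t"
    using SL2Z_inverse[OF A] by blast
  have "duality r (slash_plus v r A (pole_kernel r s)) ?f = duality r (pole_kernel r s) f" if s: "Im s < 0" for s
  proof -
    define t where "t = moebius A' s"
    have t: "Im t < 0" "moebius A t = s" using s A' moebius_lower by (auto simp: t_def)
    have nz: "moebius_den A t \<noteq> 0" using moebius_den_nonzero[OF A] t by simp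
    define c where "c = inverse (v A) * powr_low (moebius_den A t) r"
    have pk: "pole_kernel r t \<in> D_plus_neg_omega" using kernel_holomorphic t by (simp add: D_plus_neg_omega_def)
    have "duality r (slash_plus v r A (pole_kernel r s)) ?f = duality r (\<lambda>z. c * pole_kernel r t z + 0 * pole_kernel r t z) ?f"
      by (rule duality_cong_plus) (use slash_plus_kernel[OF A _ t(1)] t(2) in \<open>simp add: c_def\<close>)
    also have "\<dots> = c * duality r (pole_kernel r t) ?f"
    proof -
      have "linear_form_on D_plus_neg_omega (\<lambda>h. duality r h ?f)"
        using bf' by (simp add: bounded_functional_def)
      from this[unfolded linear_form_on_def, rule_format, OF pk pk, of c 0] show ?thesis by simp
    qed
    also have "duality r (pole_kernel r t) ?f = C * ?f t"
      unfolding C_def by (rule duality_kernel[OF slash_minus_holomorphic[OF A f(1)] t(1) f'(3)])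
    \<comment> \<open>Evaluation at t for the transformed f becomes evaluation at s, and the factors
      of the two actions meet their inverses.\<close>
    also have "c * (C * ?f t) = C * f s * (v A * inverse (v A)) *
        (powr_low (moebius_den A t) r * powr_low (moebius_den A t) (- r))"
      unfolding c_def slash_minus_def t(2) by (simp only: mult_ac)
    also have "powr_low (moebius_den A t) r * powr_low (moebius_den A t) (- r) = 1"
      using nz by (simp add: powr_low_eq_exp exp_minus)
    also have "C * f s * (v A * inverse (v A)) * 1 = C * f s"
      unfolding right_inverse[OF v] by (simp only: mult_1_right)
    also have "C * f s = duality r (pole_kernel r s) f"
      unfolding C_def by (rule duality_kernel[OF f(1) s f(4), symmetric])
    finally show ?thesis .
  qed
  then show ?thesis
    by (rule bounded_functional_eqI[OF bounded_functional_slash_plus[OF A bf'] duality_bounded[OF f(2,3)]])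
      (use h in \<open>auto simp: D_plus_neg_omega_def\<close>)
qed

text \<open>With z0 the preimage of i, combining \<open>Ln_moebius\<close> and
  \<open>Ln_kernel\<close> at z0 collects all branches into a constant and (1 - u w(z0))^(-r). Since
  |w(z0)| < 1, this power is holomorphic beyond the unit circle, which the individual factors do not
  show.\<close>

lemma minus_fun_slash_minus:
  assumes A: "A \<in> SL2Z" and z0: "Im z0 > 0" "moebius A z0 = \<i>" and t: "Im t < 0"
  shows "minus_fun r (slash_minus v r A f) t = v A *
    exp (of_real r * (Ln (moebius_den A z0) + Ln (- 2 * \<i>) - Ln (- \<i> - z0))) *
    exp (of_real (- r) * Ln (1 - w_coord (- t) * w_coord z0)) * minus_fun r f (moebius A t)"
proof -
  let ?s = "moebius A t"
  have s: "Im ?s < 0" by (rule moebius_lower[OF A t])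
  have nz: "\<i> - t \<noteq> 0" "\<i> - ?s \<noteq> 0" "moebius_den A t \<noteq> 0" "t - \<i> \<noteq> 0" "?s - \<i> \<noteq> 0"
    using s t moebius_den_nonzero[OF A, of t] by (auto simp: complex_eq_iff)
  have 1: "Ln (\<i> - t) = Ln (t - \<i>) + \<i> * pi" "Ln (\<i> - ?s) = Ln (?s - \<i>) + \<i> * pi"
    using Ln_minus[OF nz(4)] Ln_minus[OF nz(5)] t s by simp_all
  have E: "Ln (\<i> - t) - cnj (Ln (cnj (moebius_den A t))) - Ln (\<i> - ?s) =
    Ln (moebius_den A z0) + Ln (- 2 * \<i>) - Ln (- \<i> - z0) - Ln (1 - w_coord (- t) * w_coord z0)"
    using Ln_moebius[OF A z0(1) t] Ln_kernel[OF z0(1) t] unfolding 1 z0(2) by (simp add: algebra_simps)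
  have "minus_fun r (slash_minus v r A f) t =
    v A * exp (of_real r * Ln (\<i> - t)) * exp (of_real (- r) * cnj (Ln (cnj (moebius_den A t)))) * f ?s"
    using nz by (simp add: minus_fun_def slash_minus_def powr_low_eq_exp powr_def)
  also have "f ?s = exp (of_real (- r) * Ln (\<i> - ?s)) * minus_fun r f ?s"
    using nz by (simp add: minus_fun_def powr_def mult.assoc[symmetric] exp_minus)
  also have "v A * exp (of_real r * Ln (\<i> - t)) * exp (of_real (- r) * cnj (Ln (cnj (moebius_den A t)))) *
      (exp (of_real (- r) * Ln (\<i> - ?s)) * minus_fun r f ?s) =
    v A * exp (of_real r * (Ln (\<i> - t) - cnj (Ln (cnj (moebius_den A t))) - Ln (\<i> - ?s))) * minus_fun r f ?s"
    by (simp add: right_diff_distrib exp_diff exp_add exp_minus field_simps)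
  also have "exp (of_real r * (Ln (\<i> - t) - cnj (Ln (cnj (moebius_den A t))) - Ln (\<i> - ?s))) =
    exp (of_real r * (Ln (moebius_den A z0) + Ln (- 2 * \<i>) - Ln (- \<i> - z0))) *
    exp (of_real (- r) * Ln (1 - w_coord (- t) * w_coord z0))"
    unfolding E exp_add[symmetric] by (simp add: algebra_simps)
  finally show ?thesis by (simp add: mult.assoc)
qed

text \<open>In the coordinate u the group element acts by the fractional linear map m, which
  preserves the closed disc. Hence G composed with m, times the regular factor of
  \<open>minus_fun_slash_minus\<close>, extends across the circle.\<close>

lemma slash_minus_disc_extension:
  assumes A: "A \<in> SL2Z" and f: "disc_extension r R f G" "R > 1"
  obtains R' G' where "R' > 1" "disc_extension r R' (slash_minus v r A f) G'"
proof -
  define a b c d where "a = real_of_int (A $ 1 $ 1)" "b = real_of_int (A $ 1 $ 2)"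
    "c = real_of_int (A $ 2 $ 1)" "d = real_of_int (A $ 2 $ 2)"
  note abcd = this
  have "complex_of_real (a * d - b * c) = of_real 1" using SL2Z_det[OF A] by (simp add: abcd)
  then have det: "a * d - b * c = 1" by (simp only: of_real_eq_iff)
  \<comment> \<open>With t = -i(1+u)/(1-u), these are the coefficients in u of (1-u)(at + b +
    i(ct+d)) and (1-u)(at + b - i(ct+d)).\<close>
  define P0 P1 Q0 Q1 where "P0 = Complex (b + c) (d - a)" "P1 = Complex (c - b) (- a - d)"
    "Q0 = Complex (b - c) (- a - d)" "Q1 = Complex (- b - c) (d - a)"
  note PQ = this
  define m where "m = (\<lambda>u. (P0 + P1 * u) / (Q0 + Q1 * u))"
  \<comment> \<open>The Hermitian form of signature (1,1) is preserved up to the factor 4 introduced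
    by the Cayley transform.\<close>
  have norms: "(norm (Q0 + Q1 * u))\<^sup>2 - (norm (P0 + P1 * u))\<^sup>2 = 4 * (1 - (norm u)\<^sup>2)" for u
  proof -
    have "(norm (Q0 + Q1 * u))\<^sup>2 - (norm (P0 + P1 * u))\<^sup>2 = 4 * (a * d - b * c) * (1 - (norm u)\<^sup>2)"
      unfolding cmod_power2 by (simp add: PQ power2_eq_square algebra_simps)
    then show ?thesis by (simp add: det)
  qed
  have nz: "Q0 + Q1 * u \<noteq> 0" if "norm u \<le> 1" for u
  proof
    assume "Q0 + Q1 * u = 0"
    then have "norm Q0 = norm Q1 * norm u" by (metis add_eq_0_iff norm_minus_cancel norm_mult)
    then have "norm Q0 \<le> norm Q1" using that by (simp add: mult_left_le)
    then have "(norm Q0)\<^sup>2 \<le> (norm Q1)\<^sup>2" by (simp add: power_mono)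
    moreover have "(norm Q0)\<^sup>2 - (norm Q1)\<^sup>2 = 4 * (a * d - b * c)"
      unfolding cmod_power2 by (simp add: PQ power2_eq_square algebra_simps)
    ultimately have "4 * (a * d - b * c) \<le> 0" by linarith
    then show False using det by simp
  qed
  have m1: "norm (m u) \<le> 1" if "norm u \<le> 1" for u
  proof -
    have "(norm u)\<^sup>2 \<le> 1" using that by (simp add: power_le_one)
    then have "0 \<le> (norm (Q0 + Q1 * u))\<^sup>2 - (norm (P0 + P1 * u))\<^sup>2" unfolding norms by simp
    then have "(norm (P0 + P1 * u))\<^sup>2 \<le> (norm (Q0 + Q1 * u))\<^sup>2" by (simp only: diff_ge_0_iff_ge)
    then have "norm (P0 + P1 * u) \<le> norm (Q0 + Q1 * u)" by simp
    then show ?thesis using nz[OF that] by (simp add: m_def norm_divide)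
  qed
  have meq: "w_coord (- moebius A (- cayley u)) = m u" if u: "norm u < 1" for u
  proof -
    have u1: "1 - u \<noteq> 0" using u by auto
    let ?t = "- cayley u"
    have t: "Im ?t < 0" using cayley_upper[OF u] by simp
    have dn: "moebius_den A ?t \<noteq> 0" using moebius_den_nonzero[OF A] t by simp
    have ct: "cayley u * (1 - u) = \<i> * (1 + u)" using u1 by (simp add: cayley_def)
    have "(moebius_num A ?t + \<i> * moebius_den A ?t) * (1 - u) =
      - (of_real a + \<i> * of_real c) * (cayley u * (1 - u)) + (of_real b + \<i> * of_real d) * (1 - u)"
      by (simp add: moebius_num_def moebius_den_def abcd algebra_simps)
    also have "\<dots> = P0 + P1 * u"
      unfolding ct by (simp add: PQ complex_eq_iff algebra_simps)
    finally have N: "(moebius_num A ?t + \<i> * moebius_den A ?t) * (1 - u) = P0 + P1 * u" .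
    have "(moebius_num A ?t - \<i> * moebius_den A ?t) * (1 - u) =
      - (of_real a - \<i> * of_real c) * (cayley u * (1 - u)) + (of_real b - \<i> * of_real d) * (1 - u)"
      by (simp add: moebius_num_def moebius_den_def abcd algebra_simps)
    also have "\<dots> = Q0 + Q1 * u"
      unfolding ct by (simp add: PQ complex_eq_iff algebra_simps)
    finally have D: "(moebius_num A ?t - \<i> * moebius_den A ?t) * (1 - u) = Q0 + Q1 * u" .
    have "w_coord (- moebius A ?t) = (moebius A ?t + \<i>) / (moebius A ?t - \<i>)"
      by (simp add: w_coord_minus, simp add: w_coord_def)
    also have "\<dots> = ((moebius A ?t + \<i>) * (moebius_den A ?t * (1 - u))) / ((moebius A ?t - \<i>) * (moebius_den A ?t * (1 - u)))"
      using dn u1 by simp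
    also have "(moebius A ?t + \<i>) * (moebius_den A ?t * (1 - u)) = P0 + P1 * u"
      unfolding N[symmetric] moebius_def using dn by (simp add: distrib_right mult.assoc)
    also have "(moebius A ?t - \<i>) * (moebius_den A ?t * (1 - u)) = Q0 + Q1 * u"
      unfolding D[symmetric] moebius_def using dn by (simp add: left_diff_distrib mult.assoc)
    finally show ?thesis by (simp add: m_def)
  qed
  obtain z0 where z0: "Im z0 > 0" "moebius A z0 = \<i>"
    using SL2Z_inverse[OF A] moebius_upper[of _ \<i>] by (metis imaginary_unit.sel(2) zero_less_one zero_neq_one)
  have w0: "norm (w_coord z0) < 1" by (rule norm_w_coord_less[OF z0(1)])
  \<comment> \<open>The conditions keep m regular, its value in the disc of G, and 1 - u w(z0) off
    the branch cut; all three hold on the closed unit disc.\<close>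
  define W where "W = {u. Q0 + Q1 * u \<noteq> 0} \<inter> m -` ball 0 R \<inter> {u. Re (1 - u * w_coord z0) > 0}"
  have W: "open W"
  proof -
    have "open {u. Q0 + Q1 * u \<noteq> 0}" by (intro open_Collect_neq continuous_intros)
    moreover have "continuous_on {u. Q0 + Q1 * u \<noteq> 0} m" unfolding m_def by (intro continuous_intros) auto
    ultimately have "open ({u. Q0 + Q1 * u \<noteq> 0} \<inter> m -` ball 0 R)" by (intro continuous_open_preimage) auto
    then show ?thesis unfolding W_def by (rule open_Int) (intro open_Collect_less continuous_intros)
  qed
  have "cball 0 1 \<subseteq> W"
  proof
    fix u :: complex assume "u \<in> cball 0 1"
    then have u: "norm u \<le> 1" by simp
    have "Re (u * w_coord z0) \<le> norm (u * w_coord z0)" by (rule complex_Re_le_cmod)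
    also have "\<dots> \<le> norm (w_coord z0)" using u by (simp add: norm_mult mult_left_le_one_le)
    finally have "Re (u * w_coord z0) < 1" using w0 by simp
    then show "u \<in> W" using nz[OF u] m1[OF u] f(2) by (simp add: W_def)
  qed
  then obtain R' where R': "R' > 1" "ball 0 R' \<subseteq> W" using open_superset_of_cball[OF W, of 1] by auto
  define G' where "G' = (\<lambda>u. v A *
    exp (of_real r * (Ln (moebius_den A z0) + Ln (- 2 * \<i>) - Ln (- \<i> - z0))) *
    exp (of_real (- r) * Ln (1 - u * w_coord z0)) * G (m u))"
  show ?thesis
  proof
    show "R' > 1" by fact
    show "disc_extension r R' (slash_minus v r A f) G'"
      unfolding disc_extension_def
    proof safe
      have G: "G holomorphic_on ball 0 R" using f by (simp add: disc_extension_def)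
      have "m holomorphic_on W" unfolding m_def by (intro holomorphic_intros) (simp add: W_def)
      then have "(G \<circ> m) holomorphic_on W"
        by (rule holomorphic_on_compose_gen[OF _ G]) (auto simp: W_def)
      then have "G' holomorphic_on W"
        unfolding G'_def o_def by (intro holomorphic_intros) (auto simp: W_def complex_nonpos_Reals_iff)
      then show "G' holomorphic_on ball 0 R'" by (rule holomorphic_on_subset[OF _ R'(2)])
      fix u :: complex assume u: "norm u < 1"
      have u1: "u \<noteq> 1" using u by auto
      have t: "Im (- cayley u) < 0" using cayley_upper[OF u] by simp
      have s: "Im (moebius A (- cayley u)) < 0" by (rule moebius_lower[OF A t])
      have nm: "norm (m u) < 1" unfolding meq[OF u, symmetric] by (rule norm_w_coord_less) (use s in simp)
      have "- cayley (m u) = moebius A (- cayley u)"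
        unfolding meq[OF u, symmetric] using cayley_w_coord[OF upper_half_nz, of "- moebius A (- cayley u)"] s by simp
      then have "minus_fun r f (moebius A (- cayley u)) = G (m u)"
        using f(1) nm by (metis disc_extension_def)
      then show "minus_fun r (slash_minus v r A f) (- cayley u) = G' u"
        unfolding minus_fun_slash_minus[OF A z0 t] G'_def by (simp add: w_coord_cayley[OF u1])
    qed
  qed
qed

lemma slash_minus_D_minus_pol:
  assumes A: "A \<in> SL2Z" and f: "f \<in> D_minus_pol r" and r: "r = - real N"
  shows "slash_minus v r A f \<in> D_minus_pol r"
proof -
  obtain q where q: "degree q \<le> N" "\<And>t. Im t < 0 \<Longrightarrow> f t = poly q t"
    using f r by (auto simp: D_minus_pol_def)
  define pn pd where "pn = [:complex_of_int (A $ 1 $ 2), of_int (A $ 1 $ 1):]"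
    "pd = [:complex_of_int (A $ 2 $ 2), of_int (A $ 2 $ 1):]"
  note pnd = this
  have pnd': "poly pn t = moebius_num A t" "poly pd t = moebius_den A t" for t
    by (simp_all add: pnd moebius_num_def moebius_den_def)
  obtain Q where Q: "degree Q \<le> N"
    "\<And>t. moebius_den A t \<noteq> 0 \<Longrightarrow> poly Q t = moebius_den A t ^ N * poly q (moebius_num A t / moebius_den A t)"
    by (rule homogenize_poly[OF q(1), of pd pn, unfolded pnd']) (auto simp: pnd)
  then have "degree (smult (v A) Q) \<le> N" using degree_smult_le order_trans by blast
  moreover have "slash_minus v r A f t = poly (smult (v A) Q) t" if t: "Im t < 0" for t
  proof -
    have dn: "moebius_den A t \<noteq> 0" using moebius_den_nonzero[OF A] t by simp
    have "powr_low (moebius_den A t) (- r) = moebius_den A t ^ N"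
      using dn powr_nat[of "cnj (moebius_den A t)" N] by (simp add: powr_low_def r)
    then show ?thesis
      using q(2)[OF moebius_lower[OF A t]] Q(2)[OF dn] by (simp add: slash_minus_def moebius_def mult.assoc)
  qed
  ultimately show ?thesis
    unfolding D_minus_pol_def using r by (intro CollectI exI[of _ "smult (v A) Q"]) simp
qed

subsection \<open>Boundary values of smooth vectors\<close>

text \<open>Smoothness as data: a whole sequence of successive derivatives, so that the effect of a
  change of parameter can be followed explicitly in every order.\<close>

definition tower_on :: "real set \<Rightarrow> (nat \<Rightarrow> real \<Rightarrow> complex) \<Rightarrow> bool" where
  "tower_on X T \<longleftrightarrow> (\<forall>i. \<forall>x\<in>X. (T i has_vector_derivative T (Suc i) x) (at x))"

text \<open>The tower of derivatives of \<open>\<sigma> (1 + x\<^sup>2) T\<^sub>0'\<close>; since \<open>x = - cot \<theta>\<close> satisfies \<open>x' = 1 + x\<^sup>2\<close>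
  and \<open>x = - tan \<theta>\<close> satisfies \<open>x' = - (1 + x\<^sup>2)\<close>, this is the effect of \<open>d/d\<theta>\<close>.\<close>
definition tower_step :: "real \<Rightarrow> (nat \<Rightarrow> real \<Rightarrow> complex) \<Rightarrow> nat \<Rightarrow> real \<Rightarrow> complex" where
  "tower_step \<sigma> T i x = \<sigma> *\<^sub>R ((1 + x\<^sup>2) *\<^sub>R T (Suc i) x + (2 * real i * x) *\<^sub>R T i x + (real i * (real i - 1)) *\<^sub>R T (i - 1) x)"

lemma tower_step:
  assumes "tower_on X T" shows "tower_on X (tower_step \<sigma> T)"
  unfolding tower_on_def
proof (intro allI ballI)
  fix i x assume x: "x \<in> X"
  have T: "(T i has_vector_derivative T (Suc i) x) (at x)" for i using assms x by (simp add: tower_on_def)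
  have 1: "((\<lambda>x. \<sigma> *\<^sub>R ((1 + x\<^sup>2) *\<^sub>R T (Suc i) x + (2 * real i * x) *\<^sub>R T i x + (real i * (real i - 1)) *\<^sub>R T (i - 1) x))
    has_vector_derivative \<sigma> *\<^sub>R (((1 + x\<^sup>2) *\<^sub>R T (Suc (Suc i)) x + (2 * x) *\<^sub>R T (Suc i) x) +
      ((2 * real i * x) *\<^sub>R T (Suc i) x + (2 * real i) *\<^sub>R T i x) + (real i * (real i - 1)) *\<^sub>R T (Suc (i - 1)) x)) (at x)"
    by (intro has_vector_derivative_add has_vector_derivative_scaleR
        bounded_linear.has_vector_derivative[OF bounded_linear_scaleR_right] T)
       (auto intro!: derivative_eq_intros)
  \<comment> \<open>Leibniz' rule for the quadratic 1 + x^2 ends after three terms. For i = 0 the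
    truncated index i - 1 is wrong, but its coefficient is 0.\<close>
  have 2: "(real i * (real i - 1)) *\<^sub>R T (Suc (i - 1)) x = (real i * (real i - 1)) *\<^sub>R T i x"
    by (cases i) auto
  have 3: "\<sigma> *\<^sub>R (((1 + x\<^sup>2) *\<^sub>R A + (2 * x) *\<^sub>R B) + ((2 * real i * x) *\<^sub>R B + (2 * real i) *\<^sub>R C) + (real i * (real i - 1)) *\<^sub>R C) =
     \<sigma> *\<^sub>R ((1 + x\<^sup>2) *\<^sub>R A + (2 * real (Suc i) * x) *\<^sub>R B + (real (Suc i) * (real (Suc i) - 1)) *\<^sub>R C)" for A B C :: complex
    by (simp add: algebra_simps scaleR_conv_of_real)
  show "(tower_step \<sigma> T i has_vector_derivative tower_step \<sigma> T (Suc i) x) (at x)"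
    using 1 unfolding 2 3 tower_step_def[abs_def] diff_Suc_1 .
qed

abbreviation vderiv :: "(real \<Rightarrow> complex) \<Rightarrow> real \<Rightarrow> complex" where
  "vderiv \<equiv> (\<lambda>\<phi> x. vector_derivative \<phi> (at x))"

text \<open>Since \<xi>' = \<sigma> (1 + \<xi>^2), each derivative in \<theta> acts on the tower as
  one \<open>tower_step\<close>. Openness of S allows the identity for order j to be differentiated
  again.\<close>

lemma iterated_vderiv_tower:
  assumes S: "open S" and T: "tower_on X T"
    and \<xi>: "\<And>\<theta>. \<theta> \<in> S \<Longrightarrow> \<xi> \<theta> \<in> X" "\<And>\<theta>. \<theta> \<in> S \<Longrightarrow> (\<xi> has_real_derivative \<sigma> * (1 + (\<xi> \<theta>)\<^sup>2)) (at \<theta>)"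
    and \<phi>: "\<And>\<theta>. \<theta> \<in> S \<Longrightarrow> \<phi> \<theta> = T 0 (\<xi> \<theta>)" and \<theta>: "\<theta> \<in> S"
  shows "((vderiv ^^ j) \<phi> has_vector_derivative (vderiv ^^ Suc j) \<phi> \<theta>) (at \<theta>)"
proof -
  have tow: "tower_on X ((tower_step \<sigma> ^^ j) T)" for j
    by (induction j) (auto intro: T tower_step)
  have *: "((vderiv ^^ j) \<phi> has_vector_derivative (tower_step \<sigma> ^^ Suc j) T 0 (\<xi> \<theta>)) (at \<theta>)"
    if eq: "\<forall>\<theta>\<in>S. (vderiv ^^ j) \<phi> \<theta> = (tower_step \<sigma> ^^ j) T 0 (\<xi> \<theta>)" and \<theta>: "\<theta> \<in> S" for j \<theta>
  proof -
    have "(((tower_step \<sigma> ^^ j) T 0 \<circ> \<xi>) has_vector_derivative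
       (\<sigma> * (1 + (\<xi> \<theta>)\<^sup>2)) *\<^sub>R (tower_step \<sigma> ^^ j) T 1 (\<xi> \<theta>)) (at \<theta>)"
      using \<xi>[OF \<theta>] tow[of j]
      by (intro vector_diff_chain_at) (auto simp: has_real_derivative_iff_has_vector_derivative tower_on_def)
    also have "(\<sigma> * (1 + (\<xi> \<theta>)\<^sup>2)) *\<^sub>R (tower_step \<sigma> ^^ j) T 1 (\<xi> \<theta>) = (tower_step \<sigma> ^^ Suc j) T 0 (\<xi> \<theta>)"
      by (simp add: tower_step_def)
    finally show ?thesis
      by (rule has_vector_derivative_transform_within_open[OF _ S \<theta>]) (use eq in auto)
  qed
  have eq: "\<forall>\<theta>\<in>S. (vderiv ^^ j) \<phi> \<theta> = (tower_step \<sigma> ^^ j) T 0 (\<xi> \<theta>)" for j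
  proof (induction j)
    case 0 then show ?case using \<phi> by simp
  next
    case (Suc j)
    show ?case
    proof
      fix \<theta> assume "\<theta> \<in> S"
      from vector_derivative_at[OF *[OF Suc this]]
      show "(vderiv ^^ Suc j) \<phi> \<theta> = (tower_step \<sigma> ^^ Suc j) T 0 (\<xi> \<theta>)" by simp
    qed
  qed
  from *[OF eq \<theta>] show ?thesis using eq[of "Suc j"] \<theta> by metis
qed

text \<open>The pure derivatives \<open>D i 0\<close> in the real direction, restricted to the real
  axis, form the tower.\<close>

lemma C_infinity_on_tower:
  assumes "C_infinity_on g U"
  obtains T where "tower_on {x. of_real x \<in> U} T" "T 0 = (\<lambda>x. g (of_real x))"
proof -
  obtain D where D: "D 0 0 = g" "\<And>i j z. z \<in> U \<Longrightarrow> (D i j has_derivative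
            (\<lambda>x. Re x *\<^sub>R D (Suc i) j z + Im x *\<^sub>R D i (Suc j) z)) (at z)"
    using assms unfolding C_infinity_on_def by blast
  show ?thesis
  proof
    show "tower_on {x. of_real x \<in> U} (\<lambda>i x. D i 0 (of_real x))"
      unfolding tower_on_def
    proof (intro allI ballI)
      fix i x assume "x \<in> {x. complex_of_real x \<in> U}"
      then have "(D i 0 has_derivative (\<lambda>y. Re y *\<^sub>R D (Suc i) 0 (of_real x) + Im y *\<^sub>R D i (Suc 0) (of_real x))) (at (of_real x))"
        using D(2) by simp
      then have "((D i 0 \<circ> of_real) has_derivative
         ((\<lambda>y. Re y *\<^sub>R D (Suc i) 0 (of_real x) + Im y *\<^sub>R D i (Suc 0) (of_real x)) \<circ> of_real)) (at x)"
        by (intro diff_chain_at) (auto intro!: derivative_eq_intros)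
      then show "((\<lambda>x. D i 0 (of_real x)) has_vector_derivative D (Suc i) 0 (of_real x)) (at x)"
        by (simp add: has_vector_derivative_def o_def)
    qed
    show "(\<lambda>x. D 0 0 (complex_of_real x)) = (\<lambda>x. g (of_real x))" by (simp add: D(1))
  qed
qed

lemma C_infinity_on_continuous: "C_infinity_on g U \<Longrightarrow> z \<in> U \<Longrightarrow> isCont g z"
  unfolding C_infinity_on_def using has_derivative_continuous by metis

lemma C_infinity_on_diff:
  assumes "C_infinity_on g U" "C_infinity_on k V"
  shows "C_infinity_on (\<lambda>z. g z - k z) (U \<inter> V)"
proof -
  obtain D where D: "D 0 0 = g" "\<And>i j z. z \<in> U \<Longrightarrow> (D i j has_derivative
            (\<lambda>x. Re x *\<^sub>R D (Suc i) j z + Im x *\<^sub>R D i (Suc j) z)) (at z)"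
    using assms(1) unfolding C_infinity_on_def by blast
  obtain E where E: "E 0 0 = k" "\<And>i j z. z \<in> V \<Longrightarrow> (E i j has_derivative
            (\<lambda>x. Re x *\<^sub>R E (Suc i) j z + Im x *\<^sub>R E i (Suc j) z)) (at z)"
    using assms(2) unfolding C_infinity_on_def by blast
  have "((\<lambda>z. D i j z - E i j z) has_derivative
            (\<lambda>x. Re x *\<^sub>R (D (Suc i) j z - E (Suc i) j z) + Im x *\<^sub>R (D i (Suc j) z - E i (Suc j) z))) (at z)"
    if "z \<in> U \<inter> V" for i j z
    using has_derivative_diff[OF D(2)[of z i j] E(2)[of z i j]] that by (simp add: algebra_simps)
  then show ?thesis
    unfolding C_infinity_on_def using D(1) E(1) by (intro exI[of _ "\<lambda>i j z. D i j z - E i j z"]) auto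
qed

lemma D_minus_infty_diff:
  assumes "f \<in> D_minus_infty r" "g \<in> D_minus_infty r"
  shows "(\<lambda>t. f t - g t) \<in> D_minus_infty r"
proof -
  obtain U p V k where f: "f holomorphic_on lower_half" "open U" "{t. Im t \<le> 0} \<subseteq> U" "C_infinity_on p U"
    "\<forall>t\<in>lower_half. p t = minus_fun r f t" "open V" "0 \<in> V" "C_infinity_on k V"
    "\<forall>z\<in>U. z \<noteq> 0 \<and> 1 / z \<in> V \<longrightarrow> p z = k (1 / z)"
    using assms(1) unfolding D_minus_infty_def extension_P1_def by blast
  obtain U' p' V' k' where g: "g holomorphic_on lower_half" "open U'" "{t. Im t \<le> 0} \<subseteq> U'" "C_infinity_on p' U'"
    "\<forall>t\<in>lower_half. p' t = minus_fun r g t" "open V'" "0 \<in> V'" "C_infinity_on k' V'"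
    "\<forall>z\<in>U'. z \<noteq> 0 \<and> 1 / z \<in> V' \<longrightarrow> p' z = k' (1 / z)"
    using assms(2) unfolding D_minus_infty_def extension_P1_def by blast
  have "extension_P1 C_infinity_on (minus_fun r (\<lambda>t. f t - g t)) (U \<inter> U') (\<lambda>z. p z - p' z)"
    unfolding extension_P1_def
  proof (intro conjI exI[of _ "V \<inter> V'"] exI[of _ "\<lambda>z. k z - k' z"])
    show "C_infinity_on (\<lambda>z. p z - p' z) (U \<inter> U')" "C_infinity_on (\<lambda>z. k z - k' z) (V \<inter> V')"
      using f g by (auto intro: C_infinity_on_diff)
    show "\<forall>t\<in>lower_half. p t - p' t = minus_fun r (\<lambda>t. f t - g t) t"
      using f(5) g(5) by (simp add: minus_fun_def algebra_simps)
  qed (use f g in auto)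
  then show ?thesis
    unfolding D_minus_infty_def using f(1) g(1) by (auto intro!: holomorphic_intros)
qed

lemma boundary_value_finite:
  assumes "extension_P1 C_infinity_on F U g" "sin \<theta> \<noteq> 0"
  shows "boundary_value F \<theta> = g (of_real (- cot \<theta>))"
proof -
  let ?x = "complex_of_real (- cot \<theta>)"
  have U: "?x \<in> U" "C_infinity_on g U" and gF: "\<And>t. Im t < 0 \<Longrightarrow> g t = F t"
    using assms unfolding extension_P1_def by auto
  have "(g \<longlongrightarrow> g ?x) (at ?x within lower_half)"
    using C_infinity_on_continuous[OF U(2,1)] by (auto simp: isCont_def intro: tendsto_within_subset)
  then have "(F \<longlongrightarrow> g ?x) (at ?x within lower_half)"
    by (rule Lim_transform_eventually) (auto simp: eventually_at_filter gF)
  moreover have "at ?x within lower_half \<noteq> bot"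
  proof -
    have "?x islimpt lower_half"
      unfolding islimpt_approachable
    proof (intro allI impI)
      fix e :: real assume "e > 0"
      then show "\<exists>x'\<in>lower_half. x' \<noteq> ?x \<and> dist x' ?x < e"
        by (intro bexI[of _ "?x - of_real (e / 2) * \<i>"]) (auto simp: dist_norm norm_mult)
    qed
    then show ?thesis by (simp add: trivial_limit_within)
  qed
  ultimately have "Lim (at ?x within lower_half) F = g ?x" by (intro tendsto_Lim)
  then show ?thesis using assms(2) by (simp add: boundary_value_def)
qed

lemma boundary_value_infinity:
  assumes k: "C_infinity_on k V" "open V" "0 \<in> V" and F: "\<And>t. Im t < 0 \<Longrightarrow> 1 / t \<in> V \<Longrightarrow> F t = k (1 / t)"
    and "sin \<theta> = 0"
  shows "boundary_value F \<theta> = k 0"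
proof -
  let ?B = "inf at_infinity (principal lower_half)"
  have i: "((\<lambda>t::complex. 1 / t) \<longlongrightarrow> 0) at_infinity"
    using tendsto_inverse_0[where 'a = complex] by (simp add: divide_inverse)
  have "((\<lambda>t. k (1 / t)) \<longlongrightarrow> k 0) at_infinity"
    by (rule isCont_tendsto_compose[OF C_infinity_on_continuous[OF k(1,3)] i])
  then have "((\<lambda>t. k (1 / t)) \<longlongrightarrow> k 0) ?B" by (rule tendsto_mono[rotated]) simp
  moreover have "eventually (\<lambda>t. k (1 / t) = F t) ?B"
  proof -
    have "eventually (\<lambda>t::complex. 1 / t \<in> V) at_infinity"
      using topological_tendstoD[OF i k(2,3)] .
    then show ?thesis unfolding eventually_inf_principal by eventually_elim (auto simp: F)
  qed
  ultimately have "(F \<longlongrightarrow> k 0) ?B" by (rule Lim_transform_eventually)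
  moreover have "?B \<noteq> bot"
  proof
    assume "?B = bot"
    then have "eventually (\<lambda>t. False) ?B" by simp
    then have "eventually (\<lambda>t. t \<notin> lower_half) (at_infinity :: complex filter)" by (simp add: eventually_inf_principal)
    then obtain b where b: "\<And>t::complex. norm t \<ge> b \<Longrightarrow> t \<notin> lower_half" by (auto simp: eventually_at_infinity)
    have "- (of_real (\<bar>b\<bar> + 1) * \<i>) \<notin> lower_half" by (rule b) (simp add: norm_mult del: of_real_add)
    then show False by simp
  qed
  ultimately have "Lim ?B F = k 0" by (intro tendsto_Lim)
  then show ?thesis using assms(5) by (simp add: boundary_value_def)
qed

lemma boundary_value_periodic: "boundary_value F (\<theta> + pi) = boundary_value F \<theta>"
  by (simp add: boundary_value_def cot_def)

text \<open>One formula in the chart 1/t covers both cases in the definition of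
  \<open>boundary_value\<close>, so that it can be differentiated at the multiples of pi.\<close>

lemma boundary_value_near_infinity:
  assumes ext: "extension_P1 C_infinity_on F U g"
    and k: "open V" "0 \<in> V" "C_infinity_on k V" "\<And>z. z \<in> U \<Longrightarrow> z \<noteq> 0 \<Longrightarrow> 1 / z \<in> V \<Longrightarrow> g z = k (1 / z)"
    and \<theta>: "cos \<theta> \<noteq> 0" "of_real (- tan \<theta>) \<in> V"
  shows "boundary_value F \<theta> = k (of_real (- tan \<theta>))"
proof (cases "sin \<theta> = 0")
  case True
  have "boundary_value F \<theta> = k 0"
  proof (rule boundary_value_infinity[OF k(3,1,2) _ True])
    fix t assume t: "Im t < 0" "1 / t \<in> V"
    then have "t \<in> U" "g t = F t" "t \<noteq> 0" using ext unfolding extension_P1_def by auto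
    then show "F t = k (1 / t)" using k(4)[of t] t by simp
  qed
  then show ?thesis using True by (simp add: tan_def)
next
  case False
  have "of_real (- cot \<theta>) \<in> U" using ext unfolding extension_P1_def by auto
  moreover have "complex_of_real (- cot \<theta>) \<noteq> 0" using False \<theta> by (simp add: cot_def)
  moreover have "1 / complex_of_real (- cot \<theta>) = of_real (- tan \<theta>)" by (simp add: cot_def tan_def)
  ultimately show ?thesis
    using boundary_value_finite[OF ext False] k(4)[of "of_real (- cot \<theta>)"] \<theta> by simp
qed

text \<open>Two parameters cover the circle: -cot away from infinity and -tan near it. They satisfy
  the same differential equation with opposite sign \<sigma>.\<close>

lemma boundary_value_smooth:
  assumes ext: "extension_P1 C_infinity_on F U g"
  shows "((vderiv ^^ j) (boundary_value F) has_vector_derivative (vderiv ^^ Suc j) (boundary_value F) \<theta>) (at \<theta>)"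
proof -
  obtain V k where Vk: "open V" "0 \<in> V" "C_infinity_on k V" "\<And>z. z \<in> U \<Longrightarrow> z \<noteq> 0 \<Longrightarrow> 1 / z \<in> V \<Longrightarrow> g z = k (1 / z)"
    using ext unfolding extension_P1_def by blast
  have U: "C_infinity_on g U" "{t. Im t \<le> 0} \<subseteq> U" using ext unfolding extension_P1_def by auto
  show ?thesis
  proof (cases "sin \<theta> = 0")
    case False
    obtain T where T: "tower_on {x. of_real x \<in> U} T" "T 0 = (\<lambda>x. g (of_real x))"
      using C_infinity_on_tower[OF U(1)] .
    show ?thesis
    proof (rule iterated_vderiv_tower[OF _ T(1), of "{\<theta>. sin \<theta> \<noteq> 0}" "\<lambda>\<theta>. - cot \<theta>" 1])
      show "open {\<theta>::real. sin \<theta> \<noteq> 0}" by (intro open_Collect_neq continuous_intros)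
      show "\<theta> \<in> {\<theta>. sin \<theta> \<noteq> 0}" using False by simp
      fix \<theta> :: real assume \<theta>: "\<theta> \<in> {\<theta>. sin \<theta> \<noteq> 0}"
      show "- cot \<theta> \<in> {x. of_real x \<in> U}" using U(2) by auto
      have "(sin \<theta>)\<^sup>2 + (cos \<theta>)\<^sup>2 = 1" by simp
      then have "1 + (- cot \<theta>)\<^sup>2 = inverse ((sin \<theta>)\<^sup>2)"
        using \<theta> by (simp add: cot_def field_simps)
      then show "((\<lambda>\<theta>. - cot \<theta>) has_real_derivative 1 * (1 + (- cot \<theta>)\<^sup>2)) (at \<theta>)"
        using DERIV_minus[OF DERIV_cot[of \<theta>]] \<theta> by simp
      show "boundary_value F \<theta> = T 0 (- cot \<theta>)"
        using boundary_value_finite[OF ext] \<theta> by (simp add: T(2))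
    qed
  next
    case True
    obtain T where T: "tower_on {x. of_real x \<in> V} T" "T 0 = (\<lambda>x. k (of_real x))"
      using C_infinity_on_tower[OF Vk(3)] .
    let ?S = "{\<theta>. cos \<theta> \<noteq> 0} \<inter> (\<lambda>\<theta>. complex_of_real (- tan \<theta>)) -` V"
    show ?thesis
    proof (rule iterated_vderiv_tower[OF _ T(1), of ?S "\<lambda>\<theta>. - tan \<theta>" "-1"])
      have "open {\<theta>::real. cos \<theta> \<noteq> 0}" by (intro open_Collect_neq continuous_intros)
      then show "open ?S" using Vk(1)
        by (intro continuous_open_preimage continuous_intros) auto
      show "\<theta> \<in> ?S" using True Vk(2) by (auto simp: tan_def dest: sin_zero_abs_cos_one)
      fix \<theta> :: real assume \<theta>: "\<theta> \<in> ?S"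
      show "- tan \<theta> \<in> {x. of_real x \<in> V}" using \<theta> by auto
      have "(sin \<theta>)\<^sup>2 + (cos \<theta>)\<^sup>2 = 1" by simp
      then have "1 + (- tan \<theta>)\<^sup>2 = inverse ((cos \<theta>)\<^sup>2)"
        using \<theta> by (simp add: tan_def field_simps)
      then show "((\<lambda>\<theta>. - tan \<theta>) has_real_derivative -1 * (1 + (- tan \<theta>)\<^sup>2)) (at \<theta>)"
        using DERIV_minus[OF DERIV_tan[of \<theta>]] \<theta> by simp
      show "boundary_value F \<theta> = T 0 (- tan \<theta>)"
        using boundary_value_near_infinity[OF ext Vk] \<theta> by (simp add: T(2))
    qed
  qed
qed

lemma boundary_derivative_periodic:
  assumes ext: "extension_P1 C_infinity_on F U g"
  shows "(vderiv ^^ j) (boundary_value F) (\<theta> + pi) = (vderiv ^^ j) (boundary_value F) \<theta>"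
proof (induction j arbitrary: \<theta>)
  case 0 show ?case by (simp add: boundary_value_periodic)
next
  case (Suc j)
  let ?\<phi> = "(vderiv ^^ j) (boundary_value F)"
  have "(?\<phi> \<circ> (\<lambda>x. x + pi) has_vector_derivative 1 *\<^sub>R (vderiv ^^ Suc j) (boundary_value F) (\<theta> + pi)) (at \<theta>)"
    by (rule vector_diff_chain_at[OF _ boundary_value_smooth[OF ext]]) (auto intro!: derivative_eq_intros)
  then have "(?\<phi> has_vector_derivative (vderiv ^^ Suc j) (boundary_value F) (\<theta> + pi)) (at \<theta>)"
    by (simp add: o_def Suc)
  then show ?case using boundary_value_smooth[OF ext, of j \<theta>] vector_derivative_unique_at by blast
qed

text \<open>Ensures that the \<open>SUP\<close> in \<open>boundary_seminorm\<close> really bounds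
  the derivatives. Periodicity reduces the claim to continuity on the compact interval
  [0, pi].\<close>

lemma boundary_derivative_bounded:
  assumes ext: "extension_P1 C_infinity_on F U g"
  shows "bdd_above (range (\<lambda>\<theta>. norm ((vderiv ^^ j) (boundary_value F) \<theta>)))"
proof -
  let ?\<phi> = "(vderiv ^^ j) (boundary_value F)"
  have "continuous_on {0..pi} ?\<phi>"
    using boundary_value_smooth[OF ext] by (intro continuous_at_imp_continuous_on ballI has_vector_derivative_continuous)
  then have "bounded (?\<phi> ` {0..pi})" by (intro compact_imp_bounded compact_continuous_image) auto
  then obtain M where M: "\<And>\<theta>. \<theta> \<in> {0..pi} \<Longrightarrow> norm (?\<phi> \<theta>) \<le> M" unfolding bounded_iff by blast
  interpret periodic_fun_simple ?\<phi> pi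
    by standard (rule boundary_derivative_periodic[OF ext])
  have "norm (?\<phi> \<theta>) \<le> M" for \<theta>
  proof -
    define x where "x = \<theta> - of_int \<lfloor>\<theta> / pi\<rfloor> * pi"
    have "of_int \<lfloor>\<theta> / pi\<rfloor> \<le> \<theta> / pi" "\<theta> / pi < of_int \<lfloor>\<theta> / pi\<rfloor> + 1" by linarith+
    then have "of_int \<lfloor>\<theta> / pi\<rfloor> * pi \<le> \<theta>" "\<theta> < (of_int \<lfloor>\<theta> / pi\<rfloor> + 1) * pi"
      by (simp_all only: pos_le_divide_eq[OF pi_gt_zero] pos_divide_less_eq[OF pi_gt_zero])
    then have "x \<in> {0..pi}" by (simp add: x_def distrib_right)
    moreover have "?\<phi> \<theta> = ?\<phi> x" using plus_of_int[of x "\<lfloor>\<theta> / pi\<rfloor>"] by (simp add: x_def)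
    ultimately show ?thesis using M by simp
  qed
  then show ?thesis by (auto simp: bdd_above_def)
qed

section \<open>Smooth vectors on the closed disc and their Fourier coefficients\<close>

lemma exp_double_angle:
  "exp (- 2 * \<i> * of_real \<theta>) = Complex (1 - 2 * (sin \<theta>)\<^sup>2) (- 2 * sin \<theta> * cos \<theta>)"
proof -
  have "exp (- 2 * \<i> * of_real \<theta>) = cis (- (2 * \<theta>))"
    by (simp add: cis_conv_exp mult_ac)
  also have "\<dots> = Complex (cos (2 * \<theta>)) (- sin (2 * \<theta>))" by (simp only: cis.ctr cos_minus sin_minus)
  also have "\<dots> = Complex (1 - 2 * (sin \<theta>)\<^sup>2) (- 2 * sin \<theta> * cos \<theta>)"
    by (simp only: cos_double_sin sin_double) simp
  finally show ?thesis .
qed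

text \<open>u = e^(-2i \<theta>) is the coordinate 1/w of the boundary point t = -cot
  \<theta>.\<close>

lemma cayley_exp:
  assumes "sin \<theta> \<noteq> 0"
  shows "exp (- 2 * \<i> * of_real \<theta>) \<noteq> 1" "cayley (exp (- 2 * \<i> * of_real \<theta>)) = of_real (cot \<theta>)"
proof -
  note u = exp_double_angle[of \<theta>]
  show 1: "exp (- 2 * \<i> * of_real \<theta>) \<noteq> 1"
    unfolding u using assms by (simp add: complex_eq_iff)
  have cs: "(cos \<theta>)\<^sup>2 = 1 - (sin \<theta>)\<^sup>2" by (simp add: cos_squared_eq)
  have "\<i> * (1 + exp (- 2 * \<i> * of_real \<theta>)) = of_real (cot \<theta>) * (1 - exp (- 2 * \<i> * of_real \<theta>))"
    unfolding u using assms cs by (simp add: complex_eq_iff cot_def power2_eq_square)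
  then show "cayley (exp (- 2 * \<i> * of_real \<theta>)) = of_real (cot \<theta>)"
    using 1 by (simp add: cayley_def)
qed

text \<open>A smooth extension need not be holomorphic outside the disc, so only continuity on the
  closed disc is kept; this is what Cauchy's formula on the unit circle requires.\<close>

lemma D_minus_infty_disc:
  assumes "f \<in> D_minus_infty r"
  obtains G where "continuous_on (cball 0 1) G" "G holomorphic_on ball 0 1"
    "\<And>u. norm u < 1 \<Longrightarrow> minus_fun r f (- cayley u) = G u"
    "\<And>\<theta>. G (exp (- 2 * \<i> * of_real \<theta>)) = boundary_value (minus_fun r f) \<theta>"
proof -
  obtain U g where f: "f holomorphic_on lower_half" and ext: "extension_P1 C_infinity_on (minus_fun r f) U g"
    using assms unfolding D_minus_infty_def by blast
  obtain G V k where G: "open V" "0 \<in> V" "C_infinity_on k V"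
    "\<And>u. u \<noteq> 1 \<Longrightarrow> - cayley u \<in> U \<Longrightarrow> G u = g (- cayley u)"
    "\<And>u. u \<noteq> -1 \<Longrightarrow> cocayley u \<in> V \<Longrightarrow> G u = k (cocayley u)"
    using extension_P1_glue[OF ext] by metis
  have U: "open U" "{t. Im t \<le> 0} \<subseteq> U" "C_infinity_on g U" and gF: "\<And>t. Im t < 0 \<Longrightarrow> g t = minus_fun r f t"
    using ext unfolding extension_P1_def by auto
  have inU: "- cayley u \<in> U" if "norm u \<le> 1" "u \<noteq> 1" for u
  proof -
    have "(norm u)\<^sup>2 \<le> 1" using that by (simp add: power_le_one)
    then show ?thesis using U(2) that by (auto simp: Im_cayley)
  qed
  have eq: "minus_fun r f (- cayley u) = G u" if u: "norm u < 1" for u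
  proof -
    have "u \<noteq> 1" using u by auto
    then show ?thesis using G(4) inU u gF[of "- cayley u"] cayley_upper[OF u] by simp
  qed
  have cont: "continuous_on (cball 0 1) G"
  proof (intro continuous_at_imp_continuous_on ballI)
    fix u :: complex assume u: "u \<in> cball 0 1"
    show "isCont G u"
    proof (cases "u = 1")
      case False
      define W where "W = - {1} \<inter> (\<lambda>u. - cayley u) -` U"
      have "open W" unfolding W_def by (rule open_chart(1)[OF U(1)])
      moreover have "continuous_on W (g \<circ> (\<lambda>u. - cayley u))"
        using C_infinity_on_continuous[OF U(3)]
        by (intro continuous_on_compose continuous_at_imp_continuous_on
            continuous_on_subset[OF holomorphic_on_imp_continuous_on[OF uminus_cayley_holomorphic]]) (auto simp: W_def)
      then have "continuous_on W G" by (rule continuous_on_eq) (simp add: W_def G(4))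
      moreover have "u \<in> W" using inU[of u] u False by (simp add: W_def)
      ultimately show ?thesis using continuous_on_eq_continuous_at by blast
    next
      case True
      define W where "W = - {-1} \<inter> cocayley -` V"
      have "open W" unfolding W_def by (rule open_chart(2)[OF G(1)])
      moreover have "continuous_on W (k \<circ> cocayley)"
        using C_infinity_on_continuous[OF G(3)]
        by (intro continuous_on_compose continuous_at_imp_continuous_on
            continuous_on_subset[OF holomorphic_on_imp_continuous_on[OF cocayley_holomorphic]]) (auto simp: W_def)
      then have "continuous_on W G" by (rule continuous_on_eq) (simp add: W_def G(5))
      moreover have "u \<in> W" using True G(2) by (simp add: W_def cocayley_def)
      ultimately show ?thesis using continuous_on_eq_continuous_at by blast
    qed
  qed
  show ?thesis
  proof
    show "G holomorphic_on ball 0 1"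
      by (rule holomorphic_transform[OF minus_fun_cayley_holomorphic[OF f]]) (use eq in auto)
    fix \<theta> :: real
    let ?u = "exp (- 2 * \<i> * of_real \<theta>)"
    show "G ?u = boundary_value (minus_fun r f) \<theta>"
    proof (cases "sin \<theta> = 0")
      case False
      have "norm ?u = 1" by simp
      then show ?thesis
        using G(4)[of ?u] inU[of ?u] cayley_exp[OF False] boundary_value_finite[OF ext False] by simp
    next
      case True
      have "boundary_value (minus_fun r f) \<theta> = k 0"
      proof (rule boundary_value_infinity[OF G(3,1,2) _ True])
        fix t assume t: "Im t < 0" "1 / t \<in> V"
        define u where "u = w_coord (- t)"
        have u: "norm u < 1" unfolding u_def by (rule norm_w_coord_less) (use t in simp)
        have ct: "- cayley u = t" unfolding u_def using cayley_w_coord[OF upper_half_nz, of "- t"] t by simp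
        have "cayley u \<noteq> 0" using ct t by auto
        then have "u \<noteq> -1" by (auto simp: cayley_def)
        moreover have "cocayley u = 1 / t" using cocayley_eq[of u] ct by simp
        ultimately show "minus_fun r f t = k (1 / t)" using G(5)[of u] eq[OF u] t ct by simp
      qed
      moreover have "?u = 1"
        unfolding exp_double_angle using True by (simp add: complex_eq_iff)
      ultimately show ?thesis using G(5)[of 1] G(2) by (simp add: cocayley_def)
    qed
  qed (use cont eq in auto)
qed

text \<open>Cauchy's formula on the unit circle itself, with u = e^(2 pi i x), that is \<theta> =
  -pi x.\<close>

lemma minus_coeff_fourier:
  assumes "f \<in> D_minus_infty r"
  shows "((\<lambda>x. boundary_value (minus_fun r f) (- pi * x) * exp (- 2 * of_real pi * \<i> * of_nat n * of_real x))
    has_integral minus_coeff r f n) {0..1}"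
proof -
  obtain G where G: "continuous_on (cball 0 1) G" "G holomorphic_on ball 0 1"
    "\<And>u. norm u < 1 \<Longrightarrow> minus_fun r f (- cayley u) = G u"
    "\<And>\<theta>. G (exp (- 2 * \<i> * of_real \<theta>)) = boundary_value (minus_fun r f) \<theta>"
    using D_minus_infty_disc[OF assms] by blast
  have m: "minus_coeff r f = taylor G"
    unfolding minus_coeff_def by (rule taylor_cong[of 1]) (use G(3) in auto)
  have "((\<lambda>u. G u / (u - 0) ^ (Suc n)) has_contour_integral ((2 * pi * \<i>) / fact n * (deriv ^^ n) G 0)) (circlepath 0 1)"
    by (rule Cauchy_has_contour_integral_higher_derivative_circlepath[OF G(1,2)]) simp
  then have "((\<lambda>x::real. G (exp (2 * pi * \<i> * x)) / exp (2 * pi * \<i> * x) ^ Suc n * (2 * pi * \<i> * exp (2 * pi * \<i> * x)))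
     has_integral ((2 * pi * \<i>) / fact n * (deriv ^^ n) G 0)) {0..1}"
    unfolding has_contour_integral_def
  proof (rule has_integral_eq[rotated])
    fix x :: real assume x: "x \<in> {0..1}"
    then have "vector_derivative (circlepath 0 1) (at x within {0..1}) = 2 * pi * \<i> * 1 * exp (2 * pi * \<i> * x)"
      using vector_derivative_circlepath01[of x 0 1] by simp
    then show "G (circlepath 0 1 x) / (circlepath 0 1 x - 0) ^ Suc n * vector_derivative (circlepath 0 1) (at x within {0..1}) =
      G (exp (2 * pi * \<i> * x)) / exp (2 * pi * \<i> * x) ^ Suc n * (2 * pi * \<i> * exp (2 * pi * \<i> * x))"
      by (simp only:) (simp add: circlepath)
  qed
  from has_integral_mult_right[OF this, of "1 / (2 * pi * \<i>)"]
  have "((\<lambda>x::real. 1 / (2 * pi * \<i>) * (G (exp (2 * pi * \<i> * x)) / exp (2 * pi * \<i> * x) ^ Suc n * (2 * pi * \<i> * exp (2 * pi * \<i> * x))))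
     has_integral minus_coeff r f n) {0..1}"
    by (simp add: m taylor_def)
  then show ?thesis
  proof (rule has_integral_eq[rotated])
    fix x :: real
    have 1: "boundary_value (minus_fun r f) (- pi * x) = G (exp (2 * pi * \<i> * x))"
      unfolding G(4)[symmetric] by (simp add: mult_ac)
    have 2: "exp (- 2 * of_real pi * \<i> * of_nat n * of_real x) = inverse (exp (2 * pi * \<i> * x) ^ n)"
      by (simp add: exp_minus[symmetric] exp_of_nat_mult[symmetric] mult_ac)
    have 3: "1 / q * (A / E ^ Suc n * (q * E)) = A * inverse (E ^ n)" if "q \<noteq> 0" "E \<noteq> 0" for q A E :: complex
      using that by (simp add: field_simps)
    show "1 / (2 * pi * \<i>) * (G (exp (2 * pi * \<i> * x)) / exp (2 * pi * \<i> * x) ^ Suc n * (2 * pi * \<i> * exp (2 * pi * \<i> * x))) =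
      boundary_value (minus_fun r f) (- pi * x) * exp (- 2 * of_real pi * \<i> * of_nat n * of_real x)"
      unfolding 1 2 by (rule 3) auto
  qed
qed

text \<open>Integration by parts, j times: the exponential contributes 2 pi n and the substitution
  \<theta> = -pi x contributes pi, so each derivative in \<theta> gains a factor 2n.\<close>

lemma minus_coeff_seminorm:
  assumes f: "f \<in> D_minus_infty r"
  shows "norm (minus_coeff r f n) * (2 * real n) ^ j \<le> boundary_seminorm r j f"
proof -
  obtain U g where ext: "extension_P1 C_infinity_on (minus_fun r f) U g"
    using f unfolding D_minus_infty_def by blast
  define \<phi> where "\<phi> = (\<lambda>j. (vderiv ^^ j) (boundary_value (minus_fun r f)))"
  have \<phi>': "(\<phi> j has_vector_derivative \<phi> (Suc j) \<theta>) (at \<theta>)" for j \<theta>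
    unfolding \<phi>_def by (rule boundary_value_smooth[OF ext])
  have per: "\<phi> j (\<theta> + pi) = \<phi> j \<theta>" for j \<theta>
    unfolding \<phi>_def by (rule boundary_derivative_periodic[OF ext])
  define e where "e = (\<lambda>x::real. exp (- 2 * of_real pi * \<i> * of_nat n * of_real x) :: complex)"
  let ?c = "- 2 * of_real pi * \<i> * of_nat n :: complex"
  have e': "(e has_vector_derivative ?c * e x) (at x)" for x
  proof -
    have "((\<lambda>z. exp (- 2 * of_real pi * \<i> * of_nat n * z)) has_field_derivative ?c * e x) (at (of_real x))"
      by (auto intro!: derivative_eq_intros simp: e_def)
    from has_vector_derivative_real_field[OF this] show ?thesis by (simp add: e_def)
  qed
  have lin: "((\<lambda>x. - pi * x) has_vector_derivative - pi) (at x)" for x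
    by (auto intro!: derivative_eq_intros simp: has_real_derivative_iff_has_vector_derivative[symmetric])
  have p': "((\<lambda>x. \<phi> j (- pi * x)) has_vector_derivative (- pi) *\<^sub>R \<phi> (Suc j) (- pi * x)) (at x)" for j x
    using vector_diff_chain_at[OF lin \<phi>', of j x] by (simp add: o_def)
  have cont: "continuous_on {0..1} (\<lambda>x. \<phi> j (- pi * x) * e x)" for j
    using has_vector_derivative_continuous[OF p'] has_vector_derivative_continuous[OF e']
    by (intro continuous_at_imp_continuous_on ballI isCont_mult)
  define I where "I = (\<lambda>j. integral {0..1} (\<lambda>x. \<phi> j (- pi * x) * e x))"
  have I: "((\<lambda>x. \<phi> j (- pi * x) * e x) has_integral I j) {0..1}" for j
    unfolding I_def by (intro integrable_integral integrable_continuous_interval cont)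
  have "I 0 = minus_coeff r f n"
    using integral_unique[OF minus_coeff_fourier[OF f, of n]] unfolding I_def \<phi>_def e_def
    by (simp only: funpow_0)
  moreover have "norm (I (Suc j)) = 2 * real n * norm (I j)" for j
  proof -
    have d: "((\<lambda>x. \<phi> j (- pi * x) * e x) has_vector_derivative
       (\<phi> j (- pi * x) * (?c * e x) + ((- pi) *\<^sub>R \<phi> (Suc j) (- pi * x)) * e x)) (at x within {0..1})" for x
      by (rule has_vector_derivative_at_within) (rule has_vector_derivative_mult[OF p' e'])
    have J: "((\<lambda>x. \<phi> j (- pi * x) * (?c * e x) + ((- pi) *\<^sub>R \<phi> (Suc j) (- pi * x)) * e x)
      has_integral (\<phi> j (- pi * 1) * e 1 - \<phi> j (- pi * 0) * e 0)) {0..1}"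
      by (rule fundamental_theorem_of_calculus[OF _ d]) simp
    \<comment> \<open>The boundary terms cancel because period pi in \<theta> is period 1 in
      x.\<close>
    have J0: "\<phi> j (- pi * 1) * e 1 - \<phi> j (- pi * 0) * e 0 = 0"
    proof -
      have "e 1 = exp (complex_of_real (2 * of_int (- int n) * pi) * \<i>)" by (simp add: e_def mult_ac)
      then have "e 1 = 1" using exp_integer_2pi[OF Ints_of_int, of "- int n"] by simp
      moreover have "\<phi> j (- pi) = \<phi> j 0" using per[of j "- pi"] by simp
      ultimately show ?thesis by (simp add: e_def)
    qed
    have "((\<lambda>x. ?c * (\<phi> j (- pi * x) * e x) + (- pi) *\<^sub>R (\<phi> (Suc j) (- pi * x) * e x))
       has_integral (?c * I j + (- pi) *\<^sub>R I (Suc j))) {0..1}"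
      by (intro has_integral_add has_integral_mult_right has_integral_cmul I)
    moreover have "?c * (\<phi> j (- pi * x) * e x) + (- pi) *\<^sub>R (\<phi> (Suc j) (- pi * x) * e x) =
      \<phi> j (- pi * x) * (?c * e x) + ((- pi) *\<^sub>R \<phi> (Suc j) (- pi * x)) * e x" for x
      unfolding mult_scaleR_left by (simp only: mult_ac)
    ultimately have "?c * I j + (- pi) *\<^sub>R I (Suc j) = 0"
      using has_integral_unique[OF _ J[unfolded J0]] by (simp only:)
    moreover have "of_real pi * (I (Suc j) + 2 * \<i> * of_nat n * I j) =
      - (?c * I j + (- pi) *\<^sub>R I (Suc j))"
      by (simp add: scaleR_conv_of_real algebra_simps)
    ultimately have "of_real pi * (I (Suc j) + 2 * \<i> * of_nat n * I j) = 0" by (simp only: neg_equal_0_iff_equal)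
    then have "I (Suc j) = - (2 * \<i> * of_nat n * I j)" by (simp add: add_eq_0_iff2)
    then show ?thesis by (simp add: norm_mult)
  qed
  then have "norm (I j) = (2 * real n) ^ j * norm (I 0)"
    by (induction j) (simp_all add: mult_ac)
  moreover have "norm (I j) \<le> boundary_seminorm r j f"
  proof -
    have B: "norm (\<phi> j \<theta>) \<le> boundary_seminorm r j f" for \<theta>
      unfolding boundary_seminorm_def \<phi>_def
      by (rule cSUP_upper[OF _ boundary_derivative_bounded[OF ext]]) simp
    have "norm (I j) \<le> boundary_seminorm r j f * (1 - 0)"
      unfolding content_real[OF zero_le_one, symmetric]
    proof (rule has_integral_bound[where f = "\<lambda>x. \<phi> j (- pi * x) * e x", unfolded cbox_interval])
      show "0 \<le> boundary_seminorm r j f" using B[of 0] norm_ge_zero order_trans by blast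
      have "norm (e x) = 1" for x by (simp add: e_def)
      then show "norm (\<phi> j (- pi * x) * e x) \<le> boundary_seminorm r j f" for x
        using B by (simp add: norm_mult)
    qed (use I in auto)
    then show ?thesis by simp
  qed
  ultimately show ?thesis by (simp add: mult.commute)
qed

lemma boundary_seminorm_nonneg: "f \<in> D_minus_infty r \<Longrightarrow> 0 \<le> boundary_seminorm r j f"
  by (rule order_trans[OF _ minus_coeff_seminorm[of f r 0 j]]) simp_all

text \<open>Cauchy's estimate on a circle that approaches the boundary as n grows. On radius 1 -
  1/(n+2) the growth condition costs a power of n, while the radius to the power -n stays
  bounded.\<close>

lemma plus_coeff_growth:
  assumes "h \<in> D_plus_neg_infty r"
  obtains K b where "K > 0" "\<And>n. norm (plus_coeff r h n) \<le> K * real (Suc n) ^ b"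
proof -
  obtain B K where h: "h holomorphic_on upper_half" and B: "B > 0" and
    K: "\<And>z. Im z > 0 \<Longrightarrow> norm (plus_fun r h z) \<le> K * (\<bar>Im z\<bar> powr (- B) + norm z powr B)"
    using assms unfolding D_plus_neg_infty_def D_plus_neg_omega_def by auto
  define b where "b = nat \<lceil>B\<rceil>"
  have b: "B \<le> real b" unfolding b_def by linarith
  have bound: "norm (plus_fun r h (cayley w)) \<le> 2 * \<bar>K\<bar> * (4 * real (Suc (Suc n))) ^ b"
    if w: "norm w = 1 - 1 / real (Suc (Suc n))" for w n
  proof -
    let ?S = "\<bar>Im (cayley w)\<bar> powr (- B) + norm (cayley w) powr B"
    \<comment> \<open>Dominates 1/Im z and |z| on this circle: |1-w| <= 2 gives Im z >= 1/(4(n+2)),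
      and |1-w| >= 1/(n+2) gives |z| <= 2(n+2).\<close>
    define X where "X = 4 * real (Suc (Suc n))"
    have X: "X \<ge> 1" by (simp add: X_def)
    have w1: "norm w < 1" using w by simp
    then have wn: "w \<noteq> 1" by auto
    have up: "Im (cayley w) > 0" by (rule cayley_upper[OF w1])
    have d1: "norm (1 - w) \<ge> 1 / real (Suc (Suc n))" using norm_triangle_ineq2[of 1 w] w by simp
    have d2: "norm (1 - w) \<le> 2" using norm_triangle_ineq4[of 1 w] w1 by simp
    have d0: "norm (1 - w) > 0" using wn by simp
    have "1 / X \<le> Im (cayley w)"
    proof -
      have "(norm w)\<^sup>2 \<le> norm w" using w1 by (simp add: power2_eq_square mult_left_le_one_le)
      then have "1 / real (Suc (Suc n)) \<le> 1 - (norm w)\<^sup>2" using w by simp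
      moreover have "(norm (1 - w))\<^sup>2 \<le> 4" using power_mono[OF d2 norm_ge_zero, of 2] by simp
      ultimately have "(1 / real (Suc (Suc n))) / 4 \<le> (1 - (norm w)\<^sup>2) / (norm (1 - w))\<^sup>2"
        using d0 w1 power_le_one[of "norm w" 2] by (intro frac_le) auto
      moreover have "1 / X = (1 / real (Suc (Suc n))) / 4" by (simp add: X_def)
      ultimately show ?thesis unfolding Im_cayley[OF wn] by (simp only:)
    qed
    then have "\<bar>Im (cayley w)\<bar> powr (- B) \<le> (1 / X) powr (- B)"
      using X B up by (intro powr_mono2') auto
    also have "(1 / X) powr (- B) = X powr B" using X by (simp add: powr_minus powr_divide)
    also have 1: "X powr B \<le> X ^ b" using powr_mono[OF b X] X by (simp add: powr_realpow)
    finally have A: "\<bar>Im (cayley w)\<bar> powr (- B) \<le> X ^ b" .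
    have "norm (cayley w) = norm (1 + w) / norm (1 - w)" by (simp add: cayley_def norm_mult norm_divide)
    also have "\<dots> \<le> 2 / (1 / real (Suc (Suc n)))"
      using d1 norm_triangle_ineq[of 1 w] w1 by (intro frac_le) auto
    also have "\<dots> \<le> X" by (simp add: X_def)
    finally have "norm (cayley w) powr B \<le> X powr B" using B by (intro powr_mono2) auto
    with 1 A have "?S \<le> 2 * X ^ b" by linarith
    then have "\<bar>K\<bar> * ?S \<le> \<bar>K\<bar> * (2 * X ^ b)"
      by (rule mult_left_mono) simp
    moreover have "K * ?S \<le> \<bar>K\<bar> * ?S" by (intro mult_right_mono) auto
    ultimately show ?thesis using K[OF up] by (simp add: X_def)
  qed
  \<comment> \<open>8 = 4 * 2 stems from \<open>X\<close> and from n+2 <= 2(n+1),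
    \<open>exp 1\<close> from the power of the radius; the summand 1 makes the constant
    positive.\<close>
  define K' where "K' = 2 * \<bar>K\<bar> * 8 ^ b * exp 1 + 1"
  have "norm (plus_coeff r h n) \<le> K' * real (Suc n) ^ b" for n
  proof -
    \<comment> \<open>n + 2 instead of n + 1 keeps the radius positive at n = 0; its inverse is 1 +
      1/(n+1), whose n-th power is at most e.\<close>
    define \<rho> where "\<rho> = 1 - 1 / real (Suc (Suc n))"
    have \<rho>: "0 < \<rho>" "\<rho> < 1" by (auto simp: \<rho>_def divide_simps)
    have "norm (plus_coeff r h n) \<le> (2 * \<bar>K\<bar> * (4 * real (Suc (Suc n))) ^ b) / \<rho> ^ n"
      unfolding plus_coeff_def
      by (rule taylor_bound[OF plus_fun_cayley_holomorphic[OF h] \<rho>]) (rule bound, simp add: \<rho>_def)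
    also have "\<dots> = 2 * \<bar>K\<bar> * (4 * real (Suc (Suc n))) ^ b * (1 / \<rho>) ^ n" by (simp add: power_divide)
    also have "(1 / \<rho>) ^ n \<le> exp 1"
    proof -
      have "1 / \<rho> = 1 + 1 / real (Suc n)" by (simp add: \<rho>_def field_simps)
      also have "\<dots> \<le> exp (1 / real (Suc n))" by (rule exp_ge_add_one_self)
      finally have "(1 / \<rho>) ^ n \<le> exp (1 / real (Suc n)) ^ n" using \<rho> by (intro power_mono) auto
      also have "\<dots> = exp (real n * (1 / real (Suc n)))" by (rule exp_of_nat_mult[symmetric])
      also have "\<dots> \<le> exp 1" by simp
      finally show ?thesis .
    qed
    also have "(4 * real (Suc (Suc n))) ^ b \<le> (8 * real (Suc n)) ^ b" by (intro power_mono) auto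
    finally have "norm (plus_coeff r h n) \<le> 2 * \<bar>K\<bar> * (8 * real (Suc n)) ^ b * exp 1"
      by (simp add: mult_left_mono mult_right_mono)
    also have "\<dots> = 2 * \<bar>K\<bar> * 8 ^ b * exp 1 * real (Suc n) ^ b" by (simp add: power_mult_distrib mult_ac del: of_nat_Suc)
    also have "\<dots> \<le> K' * real (Suc n) ^ b" unfolding K'_def by (intro mult_right_mono) auto
    finally show ?thesis .
  qed
  moreover have "K' > 0" unfolding K'_def by (intro add_nonneg_pos) auto
  ultimately show ?thesis using that by blast
qed

lemma duality_D_minus_infty:
  assumes h: "h \<in> D_plus_neg_infty r"
  obtains C J where "C > 0"
    "\<And>f. f \<in> D_minus_infty r \<Longrightarrow> (\<lambda>n. duality_term r h f n) sums duality r h f"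
    "\<And>f. f \<in> D_minus_infty r \<Longrightarrow> norm (duality r h f) \<le> C * (boundary_seminorm r 0 f + boundary_seminorm r J f)"
proof -
  obtain K A where K: "K > 0" "\<And>n. norm (wt r n) \<le> K * real (Suc n) ^ A"
    using wt_polynomial_bound by blast
  obtain K' B where K': "K' > 0" "\<And>n. norm (plus_coeff r h n) \<le> K' * real (Suc n) ^ B"
    using plus_coeff_growth[OF h] by blast
  \<comment> \<open>A and B compensate the growth of the weights and of the coefficients of h^+; the
    remaining 2 leaves the convergent series of 1/(n+1)^2.\<close>
  define J where "J = A + B + 2"
  define S where "S = (\<Sum>n. 1 / real (Suc n) ^ 2)"
  have sS: "summable (\<lambda>n. 1 / real (Suc n) ^ 2)"
    using summable_Suc_iff[of "\<lambda>n. 1 / real n ^ 2"] inverse_power_summable[of 2, where 'a = real] by (simp add: field_simps)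
  have S0: "S \<ge> 0" unfolding S_def by (intro suminf_nonneg sS) simp
  have tm: "norm (duality_term r h f n) \<le>
      K * K' * (boundary_seminorm r 0 f + boundary_seminorm r J f) * (1 / real (Suc n) ^ 2)"
    if f: "f \<in> D_minus_infty r" for f n
  proof -
    let ?s = "boundary_seminorm r 0 f + boundary_seminorm r J f"
    note s0 = boundary_seminorm_nonneg[OF f]
    have m: "norm (minus_coeff r f n) * real (Suc n) ^ J \<le> ?s"
    \<comment> \<open>At n = 0 the factor 2n vanishes and only the seminorm of order 0 controls the
      coefficient, which is why it enters the bound.\<close>
    proof (cases "n = 0")
      case True
      then show ?thesis using minus_coeff_seminorm[OF f, of 0 0] s0[of J] by simp
    next
      case False
      have "norm (minus_coeff r f n) * real (Suc n) ^ J \<le> norm (minus_coeff r f n) * (2 * real n) ^ J"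
        using False by (intro mult_left_mono power_mono) auto
      then show ?thesis using minus_coeff_seminorm[OF f, of n J] s0[of 0] by linarith
    qed
    have "norm (duality_term r h f n) \<le>
      (K * real (Suc n) ^ A) * (K' * real (Suc n) ^ B) * norm (minus_coeff r f n)"
      unfolding norm_mult using K K' by (intro mult_right_mono mult_mono) (auto simp del: of_nat_Suc)
    also have "\<dots> = K * K' * (norm (minus_coeff r f n) * real (Suc n) ^ J) * (1 / real (Suc n) ^ 2)"
      by (simp add: J_def power_add power2_eq_square field_simps del: of_nat_Suc)
    also have "\<dots> \<le> K * K' * ?s * (1 / real (Suc n) ^ 2)"
      using m K(1) K'(1) by (intro mult_right_mono mult_left_mono) auto
    finally show ?thesis .
  qed
  show ?thesis
  proof (rule that[of "K * K' * S + 1" J])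
    show "K * K' * S + 1 > 0" using K(1) K'(1) S0 by (intro add_nonneg_pos) auto
    fix f assume f: "f \<in> D_minus_infty r"
    let ?s = "boundary_seminorm r 0 f + boundary_seminorm r J f"
    note s0 = boundary_seminorm_nonneg[OF f]
    have "summable (\<lambda>n. duality_term r h f n)"
      by (rule summable_comparison_test'[OF summable_mult[OF sS]]) (rule tm[OF f])
    then show "(\<lambda>n. duality_term r h f n) sums duality r h f"
      unfolding duality_def by (rule summable_sums)
    have "norm (duality r h f) \<le> (\<Sum>n. K * K' * ?s * (1 / real (Suc n) ^ 2))"
      unfolding duality_def by (rule norm_suminf_le[OF tm[OF f] summable_mult[OF sS]])
    also have "\<dots> = K * K' * ?s * S" unfolding S_def by (rule suminf_mult[OF sS])
    also have "\<dots> \<le> (K * K' * S + 1) * ?s" using s0[of 0] s0[of J] by (simp add: algebra_simps)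
    finally show "norm (duality r h f) \<le> (K * K' * S + 1) * ?s" .
  qed
qed

text \<open>The extension of the linear form is the series itself. By linearity, the bound by two
  seminorms places a finite intersection of subbasic sets around each point into the preimage of a
  given ball.\<close>

lemma duality_D_minus_infty_continuous:
  assumes h: "h \<in> D_plus_neg_infty r"
  shows "linear_form_on (D_minus_infty r) (duality r h)"
    "continuous_map (D_minus_infty_topology r) euclidean (duality r h)"
proof -
  obtain C J where C: "C > 0"
    and s: "\<And>f. f \<in> D_minus_infty r \<Longrightarrow> (\<lambda>n. duality_term r h f n) sums duality r h f"
    and b: "\<And>f. f \<in> D_minus_infty r \<Longrightarrow> norm (duality r h f) \<le> C * (boundary_seminorm r 0 f + boundary_seminorm r J f)"
    using duality_D_minus_infty[OF h] by blast
  have hol: "f holomorphic_on lower_half" if "f \<in> D_minus_infty r" for f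
    using that by (simp add: D_minus_infty_def)
  have comb: "duality r h (\<lambda>z. a * f z + c * g z) = a * duality r h f + c * duality r h g"
    if f: "f \<in> D_minus_infty r" and g: "g \<in> D_minus_infty r" for f g a c
    by (rule duality_linear_minus[OF hol[OF f] hol[OF g] s[OF f] s[OF g]])
  then show "linear_form_on (D_minus_infty r) (duality r h)" by (simp add: linear_form_on_def)
  let ?X = "D_minus_infty_topology r"
  let ?N = "\<lambda>f0 j e. {f \<in> D_minus_infty r. boundary_seminorm r j (\<lambda>t. f t - f0 t) < e}"
  have N_open: "openin ?X (?N f0 j e)" if "f0 \<in> D_minus_infty r" "e > 0" for f0 j e
    unfolding D_minus_infty_topology_def using that by (intro topology_generated_by_Basis) auto
  have N_self: "f \<in> ?N f j e" if "f \<in> D_minus_infty r" "e > 0" for f j e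
  proof -
    \<comment> \<open>Boundary values are limits; they are found through the function on the closed
      disc, which is continuous and vanishes in the interior.\<close>
    have "boundary_value (minus_fun r (\<lambda>t. f t - f t)) = (\<lambda>_. 0)"
    proof
      fix \<theta>
      have "(\<lambda>t. 0) \<in> D_minus_infty r" using D_minus_infty_diff[OF that(1) that(1)] by simp
      then obtain G where G: "\<And>u. norm u < 1 \<Longrightarrow> minus_fun r (\<lambda>t. 0) (- cayley u) = G u" "continuous_on (cball 0 1) G"
        "\<And>\<theta>. G (exp (- 2 * \<i> * of_real \<theta>)) = boundary_value (minus_fun r (\<lambda>t. 0)) \<theta>"
        using D_minus_infty_disc by metis
      have "G u = 0" if "u \<in> cball 0 1" for u
      proof (rule continuous_constant_on_closure[of "ball 0 1" G 0 u])
        show "continuous_on (closure (ball 0 1)) G" using G(2) by simp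
        show "\<And>x. x \<in> ball 0 1 \<Longrightarrow> G x = 0" using G(1) by (simp add: minus_fun_def)
        show "u \<in> closure (ball 0 1)" using that by simp
      qed
      then show "boundary_value (minus_fun r (\<lambda>t. f t - f t)) \<theta> = 0" using G(3)[of \<theta>] by simp
    qed
    moreover have "(vderiv ^^ j) (\<lambda>_. 0) = (\<lambda>_. 0)" by (induction j) simp_all
    ultimately have "boundary_seminorm r j (\<lambda>t. f t - f t) = 0" by (simp add: boundary_seminorm_def)
    then show ?thesis using that by simp
  qed
  have top: "topspace ?X = D_minus_infty r"
  proof
    show "topspace ?X \<subseteq> D_minus_infty r"
      unfolding D_minus_infty_topology_def topology_generated_by_topspace by auto
    show "D_minus_infty r \<subseteq> topspace ?X"
    proof
      fix f assume f: "f \<in> D_minus_infty r"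
      have "f \<in> ?N f 0 1" by (rule N_self[OF f]) simp
      then show "f \<in> topspace ?X" using openin_subset[OF N_open[OF f zero_less_one]] by blast
    qed
  qed
  show "continuous_map ?X euclidean (duality r h)"
    unfolding continuous_map_def
  proof (intro conjI allI impI)
    show "duality r h \<in> topspace ?X \<rightarrow> topspace euclidean" by simp
    fix U :: "complex set" assume "openin euclidean U"
    then have U: "open U" by simp
    show "openin ?X {f \<in> topspace ?X. duality r h f \<in> U}" (is "openin _ ?P")
    proof (subst openin_subopen, intro ballI)
      fix f0 assume "f0 \<in> ?P"
      then have f0: "f0 \<in> D_minus_infty r" "duality r h f0 \<in> U" by (auto simp: top)
      obtain e where e: "e > 0" "ball (duality r h f0) e \<subseteq> U" using U f0(2) open_contains_ball by blast
      \<comment> \<open>Two seminorms enter the bound, hence the factor 2.\<close>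
      define \<epsilon> where "\<epsilon> = e / (2 * C)"
      have \<epsilon>: "\<epsilon> > 0" using e C by (simp add: \<epsilon>_def)
      have "?N f0 0 \<epsilon> \<inter> ?N f0 J \<epsilon> \<subseteq> ?P"
      proof
        fix f assume f: "f \<in> ?N f0 0 \<epsilon> \<inter> ?N f0 J \<epsilon>"
        then have f1: "f \<in> D_minus_infty r" by simp
        have "(\<lambda>t. 1 * f t + (- 1) * f0 t) = (\<lambda>t. f t - f0 t)" by simp
        then have "duality r h f - duality r h f0 = duality r h (\<lambda>t. f t - f0 t)"
          using comb[OF f1 f0(1), of 1 "-1"] by simp
        then have "norm (duality r h f - duality r h f0) \<le>
          C * (boundary_seminorm r 0 (\<lambda>t. f t - f0 t) + boundary_seminorm r J (\<lambda>t. f t - f0 t))"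
          using b[OF D_minus_infty_diff[OF f1 f0(1)]] by simp
        also have "\<dots> < C * (\<epsilon> + \<epsilon>)" using f C by (intro mult_strict_left_mono add_strict_mono) auto
        also have "\<dots> = e" using C by (simp add: \<epsilon>_def)
        finally have "duality r h f \<in> ball (duality r h f0) e" by (simp add: dist_norm norm_minus_commute)
        then show "f \<in> ?P" using e f1 by (auto simp: top)
      qed
      moreover have "f0 \<in> ?N f0 0 \<epsilon> \<inter> ?N f0 J \<epsilon>" using N_self[OF f0(1) \<epsilon>] by blast
      moreover have "openin ?X (?N f0 0 \<epsilon> \<inter> ?N f0 J \<epsilon>)"
        by (intro openin_Int N_open f0 \<epsilon>)
      ultimately show "\<exists>T. openin ?X T \<and> f0 \<in> T \<and>
          T \<subseteq> ?P" by blast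
    qed
  qed
qed

subsection \<open>Nondegeneracy and expansions\<close>

text \<open>Treats generic and exceptional weights together: in either case the coefficients of an
  element vanish wherever the weight does.\<close>

abbreviation minus_module :: "real \<Rightarrow> (complex \<Rightarrow> complex) set" where
  "minus_module r \<equiv> if r \<in> \<int>\<^sub>\<le>\<^sub>0 then D_minus_pol r else D_minus_omega r"

abbreviation plus_module :: "real \<Rightarrow> (complex \<Rightarrow> complex) set" where
  "plus_module r \<equiv> if r \<in> \<int>\<^sub>\<le>\<^sub>0 then D_plus_pol r else D_plus_neg_omega"

text \<open>The third fact is vacuous for generic r, whose weights never vanish; for r = -N it is
  the degree bound for the polynomial extending f^-.\<close>

lemma minus_module_facts:
  assumes "f \<in> minus_module r"
  shows "f holomorphic_on lower_half" "\<exists>R>1. \<exists>G. disc_extension r R f G"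
    "\<And>n. wt r n = 0 \<Longrightarrow> minus_coeff r f n = 0"
proof -
  have "f holomorphic_on lower_half \<and> (\<exists>R>1. \<exists>G. disc_extension r R f G) \<and> (\<forall>n. wt r n = 0 \<longrightarrow> minus_coeff r f n = 0)"
  proof (cases "r \<in> \<int>\<^sub>\<le>\<^sub>0")
    case False
    then have f: "f \<in> D_minus_omega r" using assms by simp
    show ?thesis
      using D_minus_omega_holomorphic[OF f] D_minus_omega_disc_extension[OF f] False wt_eq_0_iff by metis
  next
    case True
    then have f: "f \<in> D_minus_pol r" using assms by simp
    obtain N where N: "r = - real N" using True by (auto elim!: nonpos_Ints_cases')
    obtain Q where Q: "degree Q \<le> N" "\<And>R. disc_extension r R f (poly Q)"
      using D_minus_pol_disc_extension[OF f N] by blast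
    have "minus_coeff r f = coeff Q" using minus_coeff_eq_taylor[OF Q(2)] by (simp add: taylor_poly)
    then have "minus_coeff r f n = 0" if "wt r n = 0" for n
      using that Q(1) unfolding wt_eq_0_iff N by (simp add: coeff_eq_0)
    then show ?thesis using D_minus_pol_holomorphic[OF f] Q(2) by (metis one_less_numeral_iff semiring_norm(76))
  qed
  then show "f holomorphic_on lower_half" "\<exists>R>1. \<exists>G. disc_extension r R f G"
    "\<And>n. wt r n = 0 \<Longrightarrow> minus_coeff r f n = 0" by auto
qed

lemma plus_coeff_eq_0_imp:
  assumes "h holomorphic_on upper_half" "\<And>n. plus_coeff r h n = 0" "Im z > 0"
  shows "h z = 0"
proof -
  have "plus_fun r h z = 0" using plus_coeff_sums[OF assms(1,3), of r] assms(2) by (simp add: sums_iff)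
  moreover have "- \<i> - z \<noteq> 0" using assms(3) by (auto simp: complex_eq_iff)
  ultimately show ?thesis by (simp add: plus_fun_def)
qed

lemma minus_coeff_eq_0_imp:
  assumes "f holomorphic_on lower_half" "\<And>n. minus_coeff r f n = 0" "Im t < 0"
  shows "f t = 0"
proof -
  have "minus_fun r f t = 0" using minus_coeff_sums[OF assms(1,3), of r] assms(2) by (simp add: sums_iff)
  moreover have "\<i> - t \<noteq> 0" using assms(3) by (auto simp: complex_eq_iff)
  ultimately show ?thesis by (simp add: minus_fun_def)
qed

definition minus_basis :: "real \<Rightarrow> nat \<Rightarrow> complex \<Rightarrow> complex" where
  "minus_basis r n t = (\<i> - t) powr of_real (- r) * w_coord (- t) ^ n"

lemma minus_fun_basis: "Im t < 0 \<Longrightarrow> minus_fun r (minus_basis r n) t = w_coord (- t) ^ n"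
proof -
  assume "Im t < 0"
  then have "\<i> - t \<noteq> 0" by (auto simp: complex_eq_iff)
  then show ?thesis by (simp add: minus_fun_def minus_basis_def powr_minus)
qed

lemma taylor_power: "taylor (\<lambda>u. u ^ n) m = (if m = n then 1 else 0)"
proof -
  have "taylor (\<lambda>u. u ^ n) = taylor (poly (monom 1 n))"
    by (rule taylor_cong[of 1]) (simp_all add: poly_monom)
  then show ?thesis by (simp add: taylor_poly)
qed

lemma minus_coeff_basis: "minus_coeff r (minus_basis r n) m = (if m = n then 1 else 0)"
proof -
  have "minus_coeff r (minus_basis r n) = taylor (\<lambda>u. u ^ n)"
    unfolding minus_coeff_def
  proof (rule taylor_cong[of 1])
    fix u :: complex assume u: "norm u < 1"
    then have "u \<noteq> 1" by auto
    then show "minus_fun r (minus_basis r n) (- cayley u) = u ^ n"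
      using minus_fun_basis[of "- cayley u"] cayley_upper[OF u] by (simp add: w_coord_cayley)
  qed simp
  then show ?thesis by (simp add: taylor_power)
qed

lemma plus_coeff_basis: "plus_coeff r (plus_basis r n) m = (if m = n then 1 else 0)"
proof -
  have "plus_coeff r (plus_basis r n) = taylor (\<lambda>u. u ^ n)"
    unfolding plus_coeff_def
  proof (rule taylor_cong[of 1])
    fix u :: complex assume u: "norm u < 1"
    then have "u \<noteq> 1" by auto
    then show "plus_fun r (plus_basis r n) (cayley u) = u ^ n"
      using plus_fun_basis[of "cayley u"] cayley_upper[OF u] by (simp add: w_coord_cayley)
  qed simp
  then show ?thesis by (simp add: taylor_power)
qed

text \<open>Pairing with a basis function isolates one coefficient, so nondegeneracy reduces to the
  nonvanishing of the weight.\<close>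

lemma duality_minus_basis: "duality r h (minus_basis r n) = wt r n * plus_coeff r h n"
  unfolding duality_def minus_coeff_basis by (subst suminf_finite[of "{n}"]) auto

lemma duality_plus_basis: "duality r (plus_basis r n) f = wt r n * minus_coeff r f n"
  unfolding duality_def plus_coeff_basis by (subst suminf_finite[of "{n}"]) auto

lemma minus_basis_D_minus_omega: "minus_basis r n \<in> D_minus_omega r"
proof -
  have hol: "minus_basis r n holomorphic_on lower_half"
    unfolding minus_basis_def by (intro holomorphic_intros) (auto simp: complex_nonpos_Reals_iff complex_eq_iff)
  have "extension_P1 (holomorphic_on) (minus_fun r (minus_basis r n)) (- {\<i>}) (\<lambda>t. w_coord (- t) ^ n)"
    unfolding extension_P1_def
  \<comment> \<open>The function at infinity is (t+i)/(t-i) rewritten in x = 1/t; its pole is at x =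
    -i.\<close>
  proof (intro conjI exI[of _ "- {- \<i>}"] exI[of _ "\<lambda>x. ((1 + \<i> * x) / (1 - \<i> * x)) ^ n"] ballI impI)
    show "(\<lambda>t. w_coord (- t) ^ n) holomorphic_on - {\<i>}"
      by (intro holomorphic_intros) auto
    show "(\<lambda>x. ((1 + \<i> * x) / (1 - \<i> * x)) ^ n) holomorphic_on - {- \<i>}"
      by (intro holomorphic_intros) (auto simp: complex_eq_iff)
    fix z assume "z \<in> - {\<i>}" "z \<noteq> 0 \<and> 1 / z \<in> - {- \<i>}"
    then have z: "z \<noteq> 0" "z - \<i> \<noteq> 0" by auto
    have "w_coord (- z) = (z + \<i>) / (z - \<i>)" by (simp add: w_coord_minus, simp add: w_coord_def)
    also have "\<dots> = (1 + \<i> * (1 / z)) / (1 - \<i> * (1 / z))" using z by (simp add: field_simps)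
    finally show "w_coord (- z) ^ n = ((1 + \<i> * (1 / z)) / (1 - \<i> * (1 / z))) ^ n" by simp
  qed (auto simp: minus_fun_basis)
  then show ?thesis using hol unfolding D_minus_omega_def by blast
qed

text \<open>For n <= N the factor (i-t)^N clears the denominator of the n-th power of
  (-i-t)/(i-t).\<close>

lemma minus_basis_D_minus_pol:
  assumes "r = - real N" "n \<le> N" shows "minus_basis r n \<in> D_minus_pol r"
proof -
  obtain Q where Q: "degree Q \<le> N" "\<And>t. \<i> - t \<noteq> 0 \<Longrightarrow> poly Q t = (\<i> - t) ^ N * ((- \<i> - t) / (\<i> - t)) ^ n"
    by (rule homogenize_poly[of "monom 1 n" N "[:\<i>, -1:]" "[:- \<i>, -1:]"])
      (use assms(2) in \<open>auto simp: poly_monom degree_monom_eq\<close>)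
  have "minus_basis r n t = poly Q t" if "Im t < 0" for t
  proof -
    have nz: "\<i> - t \<noteq> 0" using that by (auto simp: complex_eq_iff)
    have "(\<i> - t) powr of_real (- r) = (\<i> - t) ^ N" using nz powr_nat[of "\<i> - t" N] assms(1) by simp
    moreover have "w_coord (- t) = (- \<i> - t) / (\<i> - t)" by (simp add: w_coord_def algebra_simps)
    ultimately show ?thesis using Q(2)[OF nz] by (simp add: minus_basis_def)
  qed
  then show ?thesis unfolding D_minus_pol_def using Q(1) assms(1) by auto
qed

lemma plus_basis_D_plus_pol:
  assumes "r = - real N" "n \<le> N" shows "plus_basis r n \<in> D_plus_pol r"
proof -
  obtain Q where Q: "degree Q \<le> N" "\<And>z. - \<i> - z \<noteq> 0 \<Longrightarrow> poly Q z = (- \<i> - z) ^ N * ((\<i> - z) / (- \<i> - z)) ^ n"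
    by (rule homogenize_poly[of "monom 1 n" N "[:- \<i>, -1:]" "[:\<i>, -1:]"])
      (use assms(2) in \<open>auto simp: poly_monom degree_monom_eq\<close>)
  have "plus_basis r n z = poly Q z" if "Im z > 0" for z
  proof -
    have nz: "- \<i> - z \<noteq> 0" using that by (auto simp: complex_eq_iff)
    have "(- \<i> - z) powr of_real (- r) = (- \<i> - z) ^ N" using nz powr_nat[of "- \<i> - z" N] assms(1) by simp
    moreover have "w_coord z = (\<i> - z) / (- \<i> - z)"
      using minus_divide_divide[of "z - \<i>" "z + \<i>"] unfolding w_coord_def by (simp add: algebra_simps)
    ultimately show ?thesis using Q(2)[OF nz] by (simp add: plus_basis_def)
  qed
  then show ?thesis unfolding D_plus_pol_def using Q(1) assms(1) by auto
qed

lemma D_plus_pol_subset: "D_plus_pol r \<subseteq> D_plus_neg_omega"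
proof
  fix h assume "h \<in> D_plus_pol r"
  then obtain q where q: "\<And>z. Im z > 0 \<Longrightarrow> h z = poly q z" by (auto simp: D_plus_pol_def)
  have "poly q holomorphic_on upper_half" by (intro holomorphic_intros)
  then have "h holomorphic_on upper_half" by (rule holomorphic_transform) (simp add: q)
  then show "h \<in> D_plus_neg_omega" by (simp add: D_plus_neg_omega_def)
qed

section \<open>The properties of the form in generic and exceptional weights\<close>

lemma duality_bilinear:
  "bilinear_form_on D_plus_neg_omega (minus_module r) (duality r)"
  unfolding bilinear_form_on_def
proof (intro conjI ballI)
  fix f assume "f \<in> minus_module r"
  then show "linear_form_on D_plus_neg_omega (\<lambda>h. duality r h f)"
    using minus_module_facts(2) duality_linear_plus by blast
next
  fix h assume "h \<in> D_plus_neg_omega"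
  then have h: "h holomorphic_on upper_half" by (simp add: D_plus_neg_omega_def)
  show "linear_form_on (minus_module r) (duality r h)"
    unfolding linear_form_on_def
  proof (intro ballI allI)
    fix f g a b
    assume f: "f \<in> minus_module r"
      and g: "g \<in> minus_module r"
    show "duality r h (\<lambda>z. a * f z + b * g z) = a * duality r h f + b * duality r h g"
      using minus_module_facts(1,2)[OF f] minus_module_facts(1,2)[OF g] duality_sums[OF h]
      by (intro duality_linear_minus) blast+
  qed
qed

lemma duality_given_by_integral: "given_by_integral r D_plus_neg_omega N (duality r)"
  unfolding given_by_integral_def D_plus_neg_omega_def using has_contour_integral_duality_sigma by blast

lemma duality_integral_shift:
  assumes h: "h \<in> D_plus_neg_omega" and s: "is_sigma r f c s" and C: "duality_cycle c C"
    and \<phi>: "\<phi> holomorphic_on upper_half"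
  shows "(duality_integrand r h (\<lambda>z. s z + \<phi> z) has_contour_integral duality r h f) C"
proof -
  have h': "h holomorphic_on upper_half" using h by (simp add: D_plus_neg_omega_def)
  have "((\<lambda>z. duality_integrand r h s z + duality_integrand r h \<phi> z) has_contour_integral duality r h f + 0) C"
    by (intro has_contour_integral_add has_contour_integral_duality_sigma[OF h' s C]
        duality_integrand_holomorphic_part[OF h' \<phi> C])
  also have "(\<lambda>z. duality_integrand r h s z + duality_integrand r h \<phi> z) = duality_integrand r h (\<lambda>z. s z + \<phi> z)"
    by (simp add: duality_integrand_def fun_eq_iff distrib_left add_divide_distrib)
  finally show ?thesis by simp
qed

lemma plus_module_facts:
  assumes "h \<in> plus_module r"
  shows "h holomorphic_on upper_half" "wt r n = 0 \<Longrightarrow> plus_coeff r h n = 0"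
proof -
  show "h holomorphic_on upper_half"
    using assms D_plus_pol_subset by (auto simp: D_plus_neg_omega_def split: if_splits)
  assume "wt r n = 0"
  then obtain N where N: "r = - real N" "n > N" and r: "r \<in> \<int>\<^sub>\<le>\<^sub>0"
    by (auto simp: wt_eq_0_iff elim!: nonpos_Ints_cases')
  then show "plus_coeff r h n = 0" using assms D_plus_pol_coeff[OF _ N] by simp
qed

lemma duality_Gamma_invariant:
  assumes v: "multiplier_system r v"
  shows "Gamma_invariant_on v r (plus_module r) (minus_module r) (duality r)"
  unfolding Gamma_invariant_on_def
proof (intro ballI)
  fix A h f assume A: "A \<in> SL2Z" and h: "h \<in> plus_module r" and f: "f \<in> minus_module r"
  obtain R G where R: "R > 1" "disc_extension r R f G" using minus_module_facts(2)[OF f] by blast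
  obtain R' G' where R': "R' > 1" "disc_extension r R' (slash_minus v r A f) G'"
    using slash_minus_disc_extension[OF A R(2,1)] .
  show "duality r (slash_plus v r A h) (slash_minus v r A f) = duality r h f"
  proof (rule duality_invariant[OF A multiplier_system_nonzero[OF v A] minus_module_facts(1)[OF f] R(2,1) _
        R'(2,1) _ plus_module_facts(1)[OF h]])
    fix n assume n: "wt r n = 0"
    then obtain N where N: "r = - real N" and r: "r \<in> \<int>\<^sub>\<le>\<^sub>0"
      by (auto simp: wt_eq_0_iff elim!: nonpos_Ints_cases')
    then have "slash_minus v r A f \<in> minus_module r" using slash_minus_D_minus_pol[OF A _ N] f by simp
    then show "minus_coeff r (slash_minus v r A f) n = 0" by (rule minus_module_facts(3)[OF _ n])
    show "minus_coeff r f n = 0" by (rule minus_module_facts(3)[OF f n])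
    show "plus_coeff r h n = 0" by (rule plus_module_facts(2)[OF h n])
  qed
qed

text \<open>For r = -N a nonzero weight means n <= N, the range in which the basis functions are
  polynomials of admissible degree.\<close>

lemma basis_in_module:
  assumes "wt r n \<noteq> 0"
  shows "plus_basis r n \<in> plus_module r" "minus_basis r n \<in> minus_module r"
  using assms plus_basis_D_plus_pol[of r _ n] minus_basis_D_minus_pol[of r _ n]
    plus_basis_holomorphic[of r n] minus_basis_D_minus_omega[of r n]
  by (auto simp: D_plus_neg_omega_def wt_eq_0_iff elim!: nonpos_Ints_cases')

text \<open>Pairing with the basis kills every coefficient of nonzero weight; the others vanish by
  membership in the module.\<close>

lemma duality_nondegenerate: "nondegenerate_on (plus_module r) (minus_module r) (duality r)"
  unfolding nondegenerate_on_def
proof (intro conjI ballI impI)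
  fix h z assume h: "h \<in> plus_module r" "\<forall>f\<in>minus_module r. duality r h f = 0" and z: "z \<in> upper_half"
  have "plus_coeff r h n = 0" for n
    using bspec[OF h(2) basis_in_module(2)] plus_module_facts(2)[OF h(1)]
    by (cases "wt r n = 0") (simp_all add: duality_minus_basis)
  then show "h z = 0" using z plus_coeff_eq_0_imp[OF plus_module_facts(1)[OF h(1)]] by auto
next
  fix f t assume f: "f \<in> minus_module r" "\<forall>h\<in>plus_module r. duality r h f = 0" and t: "t \<in> lower_half"
  have "minus_coeff r f n = 0" for n
    using bspec[OF f(2) basis_in_module(1)] minus_module_facts(3)[OF f(1)]
    by (cases "wt r n = 0") (simp_all add: duality_plus_basis)
  then show "f t = 0" using t minus_coeff_eq_0_imp[OF minus_module_facts(1)[OF f(1)]] by auto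
qed

section \<open>Existence and uniqueness of the expansions\<close>

lemma plus_expansion_iff:
  assumes "h \<in> D_plus_neg_omega" shows "plus_expansion r h c \<longleftrightarrow> c = plus_coeff r h"
proof
  assume c: "plus_expansion r h c"
  show "c = plus_coeff r h"
    unfolding plus_coeff_def
  proof (rule taylor_unique[of 1])
    fix w :: complex assume w: "norm w < 1"
    then have "w \<noteq> 1" by auto
    then show "(\<lambda>n. c n * w ^ n) sums plus_fun r h (cayley w)"
      using c cayley_upper[OF w] w_coord_cayley[of w] unfolding plus_expansion_def by force
  qed simp
next
  assume "c = plus_coeff r h"
  then show "plus_expansion r h c"
    using assms plus_coeff_sums by (simp add: plus_expansion_def D_plus_neg_omega_def)
qed

text \<open>An expansion determines \<open>d\<close> at the nonpositive indices only, so equality is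
  stated along n -> -n.\<close>

lemma minus_expansion_coeff:
  assumes "minus_expansion r f d" shows "(\<lambda>n. d (- int n)) = minus_coeff r f"
  unfolding minus_coeff_def
proof (rule taylor_unique[of 1])
  fix u :: complex assume u: "norm u < 1"
  then have "u \<noteq> 1" by auto
  moreover have "- cayley u \<in> lower_half" using cayley_upper[OF u] by simp
  then have "(\<lambda>n. d (- int n) * w_coord (- (- cayley u)) ^ n) sums minus_fun r f (- cayley u)"
    using assms unfolding minus_expansion_def w_coord_powi_lower by blast
  ultimately show "(\<lambda>n. d (- int n) * u ^ n) sums minus_fun r f (- cayley u)"
    by (simp add: w_coord_cayley)
qed simp

lemma minus_expansion_exists:
  assumes f: "f \<in> minus_module r"
  shows "minus_expansion r f (\<lambda>m. minus_coeff r f (nat (- m)))"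
  unfolding minus_expansion_def w_coord_powi_lower
proof (intro conjI ballI impI allI)
  show "(\<lambda>n. minus_coeff r f (nat (- (- int n))) * w_coord (- t) ^ n) sums minus_fun r f t"
    if "t \<in> lower_half" for t
    using minus_coeff_sums[OF minus_module_facts(1)[OF f]] that by simp
  fix m :: int assume r: "r \<in> \<int>\<^sub>\<le>\<^sub>0" and m: "of_int m < - \<bar>r\<bar>"
  have "real (nat (- m)) > \<bar>r\<bar>" using m by linarith
  then show "minus_coeff r f (nat (- m)) = 0"
    using r by (intro minus_module_facts(3)[OF f]) (simp add: wt_eq_0_iff)
qed

theorem theorem4p1:
  fixes r :: real and v :: "int ^ 2 ^ 2 \<Rightarrow> complex"
  assumes "multiplier_system r v"
  shows "\<exists>B :: (complex \<Rightarrow> complex) \<Rightarrow> (complex \<Rightarrow> complex) \<Rightarrow> complex.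
    (r \<notin> \<int>\<^sub>\<le>\<^sub>0 \<longrightarrow>
       given_by_integral r D_plus_neg_omega (D_minus_omega r) B \<and>
       bilinear_form_on D_plus_neg_omega (D_minus_omega r) B \<and>
       Gamma_invariant_on v r D_plus_neg_omega (D_minus_omega r) B \<and>
       nondegenerate_on D_plus_neg_omega (D_minus_omega r) B \<and>
       (\<forall>h\<in>D_plus_neg_omega. \<forall>f\<in>D_minus_omega r. \<forall>c s C \<phi>.
          is_sigma r f c s \<and> duality_cycle c C \<and> \<phi> holomorphic_on upper_half \<longrightarrow>
          (duality_integrand r h (\<lambda>z. s z + \<phi> z) has_contour_integral B h f) C)) \<and>
    (r \<notin> \<int>\<^sub>\<le>\<^sub>0 \<longrightarrow>
       (\<forall>h\<in>D_plus_neg_infty r. \<exists>L.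
          linear_form_on (D_minus_infty r) L \<and>
          continuous_map (D_minus_infty_topology r) euclidean L \<and>
          (\<forall>f\<in>D_minus_omega r. L f = B h f))) \<and>
    (r \<in> \<int>\<^sub>\<le>\<^sub>0 \<longrightarrow>
       given_by_integral r D_plus_neg_omega (D_minus_pol r) B \<and>
       bilinear_form_on D_plus_neg_omega (D_minus_pol r) B \<and>
       Gamma_invariant_on v r (D_plus_pol r) (D_minus_pol r) B \<and>
       nondegenerate_on (D_plus_pol r) (D_minus_pol r) B) \<and>
    (\<forall>h\<in>D_plus_neg_omega. \<forall>f\<in>(if r \<in> \<int>\<^sub>\<le>\<^sub>0 then D_minus_pol r else D_minus_omega r).
       (\<exists>c. plus_expansion r h c) \<and> (\<exists>d. minus_expansion r f d) \<and>
       (\<forall>c d. plus_expansion r h c \<and> minus_expansion r f d \<longrightarrow>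
          (\<lambda>n. if r \<in> \<int>\<^sub>\<le>\<^sub>0 \<and> real n > \<bar>r\<bar> then 0
               else fact n / pochhammer (of_real r) n * c n * d (- int n)) sums B h f))"
proof (intro exI[of _ "duality r"] conjI impI ballI allI)
  show "given_by_integral r D_plus_neg_omega (D_minus_omega r) (duality r)"
    "given_by_integral r D_plus_neg_omega (D_minus_pol r) (duality r)"
    by (rule duality_given_by_integral)+
  show "bilinear_form_on D_plus_neg_omega (D_minus_omega r) (duality r)"
    "Gamma_invariant_on v r D_plus_neg_omega (D_minus_omega r) (duality r)"
    "nondegenerate_on D_plus_neg_omega (D_minus_omega r) (duality r)" if "r \<notin> \<int>\<^sub>\<le>\<^sub>0"
    using duality_bilinear[of r] duality_Gamma_invariant[OF assms] duality_nondegenerate[of r] that by simp_all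
  show "bilinear_form_on D_plus_neg_omega (D_minus_pol r) (duality r)"
    "Gamma_invariant_on v r (D_plus_pol r) (D_minus_pol r) (duality r)"
    "nondegenerate_on (D_plus_pol r) (D_minus_pol r) (duality r)" if "r \<in> \<int>\<^sub>\<le>\<^sub>0"
    using duality_bilinear[of r] duality_Gamma_invariant[OF assms] duality_nondegenerate[of r] that by simp_all
  show "(duality_integrand r h (\<lambda>z. s z + \<phi> z) has_contour_integral duality r h f) C"
    if "h \<in> D_plus_neg_omega" "is_sigma r f c s \<and> duality_cycle c C \<and> \<phi> holomorphic_on upper_half" for h f c s C \<phi>
    using duality_integral_shift that by blast
  show "\<exists>L. linear_form_on (D_minus_infty r) L \<and> continuous_map (D_minus_infty_topology r) euclidean L \<and>
          (\<forall>f\<in>D_minus_omega r. L f = duality r h f)" if "h \<in> D_plus_neg_infty r" for h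
    using duality_D_minus_infty_continuous[OF that] by blast
  fix h f assume h: "h \<in> D_plus_neg_omega" and f: "f \<in> minus_module r"
  show "\<exists>c. plus_expansion r h c" using plus_expansion_iff[OF h] by blast
  show "\<exists>d. minus_expansion r f d" using minus_expansion_exists[OF f] by blast
  fix c d assume "plus_expansion r h c \<and> minus_expansion r f d"
  then have c: "c = plus_coeff r h" and d: "\<And>n. d (- int n) = minus_coeff r f n"
    using plus_expansion_iff[OF h] minus_expansion_coeff by (auto simp: fun_eq_iff)
  have "(\<lambda>n. duality_term r h f n) sums duality r h f"
    using minus_module_facts(2)[OF f] duality_sums h by (auto simp: D_plus_neg_omega_def)
  \<comment> \<open>The terms declared absent are those whose weight is 0 through division by
    0.\<close>
  also have "(\<lambda>n. duality_term r h f n) =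
    (\<lambda>n. if r \<in> \<int>\<^sub>\<le>\<^sub>0 \<and> real n > \<bar>r\<bar> then 0
               else fact n / pochhammer (of_real r) n * c n * d (- int n))"
    using wt_eq_0_iff[of r] by (auto simp: fun_eq_iff c d wt_def)
  finally show "(\<lambda>n. if r \<in> \<int>\<^sub>\<le>\<^sub>0 \<and> real n > \<bar>r\<bar> then 0
               else fact n / pochhammer (of_real r) n * c n * d (- int n)) sums duality r h f" .
qed

end
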